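(* The map $r_\infty:\mathrm{mHiggs}^{\mathrm{fr}}_G(\mathbb{CP}^1,D,\omega^\vee)\to G_1[[z^{-1}]]$, defined by restricting a multiplicative Higgs field to a formal neighbourhood of $\infty$, is Poisson. That is, the pullback under $r_\infty$ of the Poisson bracket on $\mathcal O(G_1[[z^{-1}]])$ coincides with the Poisson bracket on $\mathcal O(\mathrm{mHiggs}^{\mathrm{fr}}_G(\mathbb{CP}^1,D,\omega^\vee))$: $\{r_\infty^*f_1,r_\infty^*f_2\}=r_\infty^*\{f_1,f_2\}$ for all $f_1,f_2\in\mathcal O(G_1[[z^{-1}]])$.
   Context: $G$ is a reductive complex algebraic group with Lie algebra $\mathfrak g$, and $\kappa$ is a fixed non-degenerate invariant symmetric pairing on $\mathfrak g$, used to identify $\mathfrak g\cong\mathfrak g^*$. $D=\{z_1,\dots,z_k\}\subset\mathbb C$ is finite and $\omega^\vee$ assigns a dominant coweight $\omega^\vee_{z_i}$ to each $z_i$. **Moduli space.** $\mathrm{mHiggs}^{\mathrm{fr}}_G(\mathbb{CP}^1,D,\omega^\vee)$ parametrizes principal $G$-bundles $P$ on $\mathbb{CP}^1$ with an automorphism $g$ of $P|_{\mathbb{CP}^1\setminus D}$ of singularity type $\omega^\vee_{z_i}$ at $z_i$ and a framing at $\infty$ (a trivialization of $P_\infty$ in which $g(\infty)=1$). We work where $P$ is trivial; then the framing trivializes $P$ globally and the moduli space is the set of rational maps $g:\mathbb{CP}^1\to G$, regular away from $D$, with $g(\infty)=1$ and $g\in G[[z-z_i]]\,(z-z_i)^{-\omega^\vee_{z_i}}\,G[[z-z_i]]$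 near each $z_i$. The map $r_\infty$ takes the Taylor expansion of $g$ at $\infty$. **Symplectic form.** A tangent vector $X$ at $g$ is given locally on $\mathbb{CP}^1$ by pairs $(X^L,X^R)$ of holomorphic $\mathfrak g$-valued functions (vanishing at $\infty$), representing $\delta g=X^Lg+gX^R$, modulo $(X^L,X^R)\sim(X^L+\mathrm{Ad}_gY,X^R-Y)$. Let $U_i$ be small disks around $z_i$ ($1\le i\le k$), $U_\infty$ a small disk around $\infty$, $U_0$ the complement of smaller closed disks; subscripts denote holomorphic representatives on these sets. Then $$\Omega(X,X')=\frac1{2\pi i}\sum_{j\in\{1,\dots,k,\infty\}}\oint_{\partial U_j}dz\,\big(\kappa(X^L_j,X'^L_0)-\kappa(X^R_j,X'^R_0)\big).$$ The Poisson bracket on the moduli space is the one of the symplectic form $\Omega$: $\{\phi,\psi\}=\Omega(X_\psi,X_\phi)$, where $\Omega(X,X_\phi)=d\phi(X)$ for all $X$. **Poisson group.** $G_1[[z^{-1}]]$ is the group of $G$-valued power series in $z^{-1}$ with constant term $1$; $\mathcal O(G_1[[z^{-1}]])$ is the algebra of functions depending algebraically on finitely many Taylor coefficients. Its (Sklyanin) Poisson structure, from the Manin triple $(G((z^{-1})),G[z],G_1[[z^{-1}]])$, is $$\{f_1,f_2\}(g)=\langle r,\nabla_Lf_1(g)\otimes\nabla_Lf_2(g)-\nabla_Rf_1(g)\otimes\nabla_Rf_2(g)\rangle,\qquad r=\frac{\Omega_{\mathrm{Cas}}}{z-w}=\Omega_{\mathrm{Cas}}\sum_{i\ge0}z^{-i-1}w^i,$$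 with $\Omega_{\mathrm{Cas}}\in\mathfrak g^{\otimes2}$ the quadratic Casimir of $\kappa$, $\langle\cdot,\cdot\rangle$ the residue pairing, and $\nabla_L,\nabla_R$ the $\mathfrak g[z]$-valued gradients along $g\mapsto e^{tX}g$ and $g\mapsto ge^{tX}$. For evaluation functions $\phi_u(g)=\phi(g(u))$, $\psi_v(g)=\psi(g(v))$ with $\phi,\psi\in\mathcal O(G)$ this reads $$\{\phi_u,\psi_v\}(g)=\tfrac1{u-v}\big(\kappa(\nabla_L\phi(g(u)),\nabla_L\psi(g(v)))-\kappa(\nabla_R\phi(g(u)),\nabla_R\psi(g(v)))\big).$$ *)

theory Defs
  imports "HOL-Complex_Analysis.Complex_Analysis" "HOL-Algebra.Solvable_Groups"
begin

section \<open>Polynomials and matrices\<close>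

text \<open>
  Polynomials in variables of type \<open>'v\<close> with complex coefficients, as expressions; \<open>h\<close> is
  the structure map of the complex algebra in which they are evaluated.
\<close>

datatype 'v pexpr =
    PConst complex
  | PVar 'v
  | PAdd "'v pexpr" "'v pexpr"
  | PMult "'v pexpr" "'v pexpr"

primrec peval :: "(complex \<Rightarrow> 'a::comm_ring_1) \<Rightarrow> ('v \<Rightarrow> 'a) \<Rightarrow> 'v pexpr \<Rightarrow> 'a" where
  "peval h x (PConst c) = h c"
| "peval h x (PVar v) = x v"
| "peval h x (PAdd p q) = peval h x p + peval h x q"
| "peval h x (PMult p q) = peval h x p * peval h x q"

definition meval ::
  "(complex \<Rightarrow> 'a::comm_ring_1) \<Rightarrow> 'a^'n^'n \<Rightarrow> ('n::finite \<times> 'n) pexpr \<Rightarrow> 'a" where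
  "meval h A p = peval h (\<lambda>(i, j). A $ i $ j) p"

text \<open>
  The product \<open>*\<close> of the vector type is componentwise; matrices are always multiplied by
  \<open>**\<close>, and the two operations below are the scalar multiple and the power for \<open>**\<close>.
\<close>

definition msmult :: "'a::times \<Rightarrow> 'a^'n^'m \<Rightarrow> 'a^'n^'m" where
  "msmult c A = (\<chi> i j. c * A $ i $ j)"

definition mpow :: "'a::semiring_1^'n^'n \<Rightarrow> nat \<Rightarrow> 'a^'n^'n" where
  "mpow A m = (((**) A) ^^ m) (mat 1)"

section \<open>Reductive groups, Lie algebras, dominant coweights\<close>

text \<open>Every complex affine algebraic group is a closed subgroup of some \<open>GL\<^sub>n\<close>.\<close>

definition zariski_closed :: "(complex^'n^'n) set \<Rightarrow> bool" where
  "zariski_closed Z \<longleftrightarrow> (\<exists>S. Z = {A. invertible A \<and> (\<forall>p\<in>S. meval (\<lambda>c. c) A p = 0)})"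

definition algebraic_group :: "(complex^'n^'n) set \<Rightarrow> bool" where
  "algebraic_group G \<longleftrightarrow> zariski_closed G \<and> mat 1 \<in> G \<and>
     (\<forall>A\<in>G. \<forall>B\<in>G. A ** B \<in> G) \<and> (\<forall>A\<in>G. matrix_inv A \<in> G)"

definition zariski_connected :: "(complex^'n^'n) set \<Rightarrow> bool" where
  "zariski_connected H \<longleftrightarrow>
     \<not> (\<exists>Z1 Z2. zariski_closed Z1 \<and> zariski_closed Z2 \<and> Z1 \<noteq> {} \<and> Z2 \<noteq> {} \<and>
          Z1 \<inter> Z2 = {} \<and> Z1 \<union> Z2 = H)"

definition unipotent :: "(complex^'n^'n) set \<Rightarrow> bool" where
  "unipotent U \<longleftrightarrow> (\<forall>A\<in>U. \<exists>k. mpow (A - mat 1) k = 0)"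

text \<open>The unipotent radical is trivial. Connectedness is not required.\<close>

definition reductive :: "(complex^'n^'n) set \<Rightarrow> bool" where
  "reductive G \<longleftrightarrow> algebraic_group G \<and>
     (\<forall>U. U \<subseteq> G \<and> algebraic_group U \<and> zariski_connected U \<and> unipotent U \<and>
          (\<forall>A\<in>G. \<forall>u\<in>U. A ** u ** matrix_inv A \<in> U) \<longrightarrow> U = {mat 1})"

definition vanishing_ideal :: "(complex^'n^'n) set \<Rightarrow> ('n \<times> 'n) pexpr set" where
  "vanishing_ideal G = {p. \<forall>A\<in>G. meval (\<lambda>c. c) A p = 0}"

definition lie_algebra :: "(complex^'n^'n) set \<Rightarrow> (complex^'n^'n) set" where
  "lie_algebra G = {X. \<forall>p\<in>vanishing_ideal G.
     ((\<lambda>t. meval (\<lambda>c. c) (mat 1 + msmult t X) p) has_field_derivative 0) (at 0)}"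

definition torus :: "(complex^'n^'n) set \<Rightarrow> bool" where
  "torus T \<longleftrightarrow> algebraic_group T \<and> zariski_connected T \<and>
     (\<exists>P :: complex^'n^'n. invertible P \<and> (\<forall>A\<in>T. \<forall>i j. i \<noteq> j \<longrightarrow> (P ** A ** matrix_inv P) $ i $ j = 0))"

definition maximal_torus :: "(complex^'n^'n) set \<Rightarrow> (complex^'n^'n) set \<Rightarrow> bool" where
  "maximal_torus G T \<longleftrightarrow> torus T \<and> T \<subseteq> G \<and>
     (\<forall>T'. torus T' \<and> T \<subseteq> T' \<and> T' \<subseteq> G \<longrightarrow> T' = T)"

definition connected_solvable :: "(complex^'n^'n) set \<Rightarrow> bool" where
  "connected_solvable B \<longleftrightarrow> algebraic_group B \<and> zariski_connected B \<and>
     solvable \<lparr>carrier = B, mult = (**), one = mat 1\<rparr>"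

definition borel_subgroup :: "(complex^'n^'n) set \<Rightarrow> (complex^'n^'n) set \<Rightarrow> bool" where
  "borel_subgroup G B \<longleftrightarrow> connected_solvable B \<and> B \<subseteq> G \<and>
     (\<forall>B'. connected_solvable B' \<and> B \<subseteq> B' \<and> B' \<subseteq> G \<longrightarrow> B' = B)"

definition algebraic_character ::
  "(complex^'n^'n) set \<Rightarrow> (complex^'n^'n \<Rightarrow> complex) \<Rightarrow> bool" where
  "algebraic_character T \<alpha> \<longleftrightarrow>
     (\<forall>A\<in>T. \<alpha> A \<noteq> 0) \<and> (\<forall>A\<in>T. \<forall>B\<in>T. \<alpha> (A ** B) = \<alpha> A * \<alpha> B) \<and>
     (\<exists>p N. \<forall>A\<in>T. \<alpha> A = meval (\<lambda>c. c) A p / det A ^ N)"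

text \<open>The positive roots are the roots of \<open>T\<close> in the Lie algebra of the Borel subgroup \<open>B\<close>.\<close>

definition positive_root ::
  "(complex^'n^'n) set \<Rightarrow> (complex^'n^'n) set \<Rightarrow> (complex^'n^'n \<Rightarrow> complex) \<Rightarrow> bool" where
  "positive_root T B \<alpha> \<longleftrightarrow> algebraic_character T \<alpha> \<and> (\<exists>A\<in>T. \<alpha> A \<noteq> 1) \<and>
     (\<exists>X\<in>lie_algebra B. X \<noteq> 0 \<and> (\<forall>A\<in>T. A ** X ** matrix_inv A = msmult (\<alpha> A) X))"

text \<open>
  A coweight \<open>\<mu>\<close> is a one-parameter subgroup of \<open>T\<close>, so that \<open>z\<^sup>\<mu>\<close> makes sense: it is
  \<open>\<mu> z\<close>. The value at \<open>0\<close> is irrelevant.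
\<close>

definition coweight :: "(complex^'n^'n) set \<Rightarrow> (complex \<Rightarrow> complex^'n^'n) \<Rightarrow> bool" where
  "coweight T \<mu> \<longleftrightarrow>
     (\<forall>s. s \<noteq> 0 \<longrightarrow> \<mu> s \<in> T) \<and>
     (\<forall>s s'. s \<noteq> 0 \<and> s' \<noteq> 0 \<longrightarrow> \<mu> (s * s') = \<mu> s ** \<mu> s') \<and>
     (\<forall>i j. \<exists>p N. \<forall>s. s \<noteq> 0 \<longrightarrow> \<mu> s $ i $ j = poly p s / s ^ N)"

definition dominant_coweight ::
  "(complex^'n^'n) set \<Rightarrow> (complex^'n^'n) set \<Rightarrow> (complex \<Rightarrow> complex^'n^'n) \<Rightarrow> bool" where
  "dominant_coweight T B \<mu> \<longleftrightarrow> coweight T \<mu> \<and>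
     (\<forall>\<alpha> m. positive_root T B \<alpha> \<and> (\<forall>s. s \<noteq> 0 \<longrightarrow> \<alpha> (\<mu> s) = s powi m) \<longrightarrow> m \<ge> 0)"

definition invariant_pairing ::
  "(complex^'n^'n) set \<Rightarrow> (complex^'n^'n \<Rightarrow> complex^'n^'n \<Rightarrow> complex) \<Rightarrow> bool" where
  "invariant_pairing G \<kappa> \<longleftrightarrow>
     (\<forall>X\<in>lie_algebra G. \<forall>Y\<in>lie_algebra G. \<forall>Z\<in>lie_algebra G. \<forall>c.
        \<kappa> (X + Y) Z = \<kappa> X Z + \<kappa> Y Z \<and> \<kappa> (msmult c X) Z = c * \<kappa> X Z) \<and>
     (\<forall>X\<in>lie_algebra G. \<forall>Y\<in>lie_algebra G. \<kappa> X Y = \<kappa> Y X) \<and>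
     (\<forall>A\<in>G. \<forall>X\<in>lie_algebra G. \<forall>Y\<in>lie_algebra G.
        \<kappa> (A ** X ** matrix_inv A) (A ** Y ** matrix_inv A) = \<kappa> X Y) \<and>
     (\<forall>X\<in>lie_algebra G. (\<forall>Y\<in>lie_algebra G. \<kappa> X Y = 0) \<longrightarrow> X = 0)"

section \<open>The moduli space\<close>

definition laurent_mat :: "(complex \<Rightarrow> complex^'n^'n) \<Rightarrow> complex \<Rightarrow> complex fls^'n^'n" where
  "laurent_mat g z = (\<chi> i j. laurent_expansion (\<lambda>u. g u $ i $ j) z)"

definition fls_mat :: "complex fps^'n^'n \<Rightarrow> complex fls^'n^'n" where
  "fls_mat A = (\<chi> i j. fps_to_fls (A $ i $ j))"

text \<open>The points of \<open>G\<close> over the ring of formal power series.\<close>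

definition power_series_group :: "(complex^'n^'n) set \<Rightarrow> (complex fps^'n^'n) set" where
  "power_series_group G = {A. invertible A \<and> (\<forall>p\<in>vanishing_ideal G. meval fps_const A p = 0)}"

text \<open>\<open>laurent_mat (\<lambda>u. \<mu> (inverse u)) 0\<close> is \<open>x\<^sup>-\<^sup>\<mu>\<close>, where \<open>x\<close> is the local coordinate at \<open>c\<close>.\<close>

definition singularity_type ::
  "(complex^'n^'n) set \<Rightarrow> (complex \<Rightarrow> complex^'n^'n) \<Rightarrow> complex \<Rightarrow> (complex \<Rightarrow> complex^'n^'n) \<Rightarrow> bool"
where
  "singularity_type G g c \<mu> \<longleftrightarrow>
     (\<exists>a\<in>power_series_group G. \<exists>b\<in>power_series_group G.
        laurent_mat g c = fls_mat a ** laurent_mat (\<lambda>u. \<mu> (inverse u)) 0 ** fls_mat b)"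

definition rational_regular_off :: "complex set \<Rightarrow> (complex \<Rightarrow> complex) \<Rightarrow> bool" where
  "rational_regular_off D f \<longleftrightarrow>
     (\<exists>p q. q \<noteq> 0 \<and> (\<forall>z. z \<notin> D \<longrightarrow> poly q z \<noteq> 0 \<and> f z = poly p z / poly q z))"

text \<open>
  A map on \<open>CP\<^sup>1 - D\<close> is a function on the complex plane together with its limit at infinity;
  it is given the conventional value \<open>0\<close> on \<open>D\<close>, so that equality of functions is equality of maps.
\<close>

definition mhiggs ::
  "(complex^'n^'n) set \<Rightarrow> complex set \<Rightarrow> (complex \<Rightarrow> complex \<Rightarrow> complex^'n^'n)
     \<Rightarrow> (complex \<Rightarrow> complex^'n^'n) set" where
  "mhiggs G D \<omega> = {g. (\<forall>z\<in>D. g z = 0) \<and> (\<forall>z. z \<notin> D \<longrightarrow> g z \<in> G) \<and>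
     (\<forall>i j. rational_regular_off D (\<lambda>z. g z $ i $ j)) \<and>
     (g \<longlongrightarrow> mat 1) at_infinity \<and>
     (\<forall>c\<in>D. singularity_type G g c (\<omega> c))}"

section \<open>Tangent vectors and the symplectic form\<close>

definition local_rep ::
  "(complex^'n^'n) set \<Rightarrow> complex set \<Rightarrow> (complex \<Rightarrow> complex^'n^'n) \<Rightarrow> (complex \<Rightarrow> complex^'n^'n)
     \<Rightarrow> complex set \<Rightarrow> (complex \<Rightarrow> complex^'n^'n) \<Rightarrow> (complex \<Rightarrow> complex^'n^'n) \<Rightarrow> bool" where
  "local_rep G D g \<delta> S XL XR \<longleftrightarrow>
     (\<forall>i j. (\<lambda>z. XL z $ i $ j) holomorphic_on S \<and> (\<lambda>z. XR z $ i $ j) holomorphic_on S) \<and>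
     (\<forall>z\<in>S. XL z \<in> lie_algebra G \<and> XR z \<in> lie_algebra G) \<and>
     (\<forall>z\<in>S - D. \<delta> z = XL z ** g z + g z ** XR z)"

definition local_rep_inf ::
  "(complex^'n^'n) set \<Rightarrow> complex set \<Rightarrow> (complex \<Rightarrow> complex^'n^'n) \<Rightarrow> (complex \<Rightarrow> complex^'n^'n)
     \<Rightarrow> complex set \<Rightarrow> (complex \<Rightarrow> complex^'n^'n) \<Rightarrow> (complex \<Rightarrow> complex^'n^'n) \<Rightarrow> bool" where
  "local_rep_inf G D g \<delta> S XL XR \<longleftrightarrow> local_rep G D g \<delta> S XL XR \<and>
     (XL \<longlongrightarrow> 0) at_infinity \<and> (XR \<longlongrightarrow> 0) at_infinity"

text \<open>
  Two pairs are equivalent (they differ by \<open>(Ad\<^sub>g Y, - Y)\<close>) iff they represent the same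
  \<open>\<delta>g = X\<^sup>L g + g X\<^sup>R\<close>, so a class of pairs, and hence a tangent vector, is recorded by the global
  \<open>\<delta>g\<close>, with the conventional value \<open>0\<close> on \<open>D\<close>.
\<close>

definition tangent_space ::
  "(complex^'n^'n) set \<Rightarrow> complex set \<Rightarrow> (complex \<Rightarrow> complex^'n^'n)
     \<Rightarrow> (complex \<Rightarrow> complex^'n^'n) set" where
  "tangent_space G D g = {\<delta>. (\<forall>z\<in>D. \<delta> z = 0) \<and>
     (\<forall>c. \<exists>S XL XR. open S \<and> c \<in> S \<and> local_rep G D g \<delta> S XL XR) \<and>
     (\<exists>R XL XR. local_rep_inf G D g \<delta> {z. norm z > R} XL XR)}"

text \<open>
  \<open>U\<^sub>c = ball c \<epsilon>1\<close> for \<open>c \<in> D\<close> and \<open>U\<^sub>\<infinity> = {z. norm z > R1}\<close>; the smaller closed disks have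
  radius \<open>\<epsilon>0\<close> around \<open>c\<close> and are given by \<open>norm z \<ge> R0\<close> at infinity. The contours are taken inside the
  overlaps with \<open>U\<^sub>0\<close>, as circles of radius \<open>\<epsilon>\<close> and \<open>R\<close>; the last one is reversed, since it
  is oriented as the boundary of a disk around infinity.
\<close>

definition disk_cover ::
  "complex set \<Rightarrow> real \<Rightarrow> real \<Rightarrow> real \<Rightarrow> real \<Rightarrow> real \<Rightarrow> real \<Rightarrow> bool" where
  "disk_cover D \<epsilon>0 \<epsilon> \<epsilon>1 R1 R R0 \<longleftrightarrow> 0 < \<epsilon>0 \<and> \<epsilon>0 < \<epsilon> \<and> \<epsilon> < \<epsilon>1 \<and> 0 < R1 \<and> R1 < R \<and> R < R0 \<and>
     (\<forall>c\<in>D. \<forall>d\<in>D. c \<noteq> d \<longrightarrow> ball c \<epsilon>1 \<inter> ball d \<epsilon>1 = {}) \<and>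
     (\<forall>c\<in>D. ball c \<epsilon>1 \<subseteq> ball 0 R1)"

definition symplectic_value ::
  "(complex^'n^'n) set \<Rightarrow> (complex^'n^'n \<Rightarrow> complex^'n^'n \<Rightarrow> complex) \<Rightarrow> complex set
     \<Rightarrow> (complex \<Rightarrow> complex^'n^'n) \<Rightarrow> (complex \<Rightarrow> complex^'n^'n) \<Rightarrow> (complex \<Rightarrow> complex^'n^'n)
     \<Rightarrow> complex \<Rightarrow> bool" where
  "symplectic_value G \<kappa> D g \<delta> \<delta>' v \<longleftrightarrow>
     (\<exists>\<epsilon>0 \<epsilon> \<epsilon>1 R1 R R0 XL XR XLinf XRinf YL YR.
        disk_cover D \<epsilon>0 \<epsilon> \<epsilon>1 R1 R R0 \<and>
        (\<forall>c\<in>D. local_rep G D g \<delta> (ball c \<epsilon>1) (XL c) (XR c)) \<and>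
        local_rep_inf G D g \<delta> {z. norm z > R1} XLinf XRinf \<and>
        local_rep G D g \<delta>' {z. norm z < R0 \<and> (\<forall>c\<in>D. dist c z > \<epsilon>0)} YL YR \<and>
        v = 1 / (2 * of_real pi * \<i>) *
          ((\<Sum>c\<in>D. contour_integral (circlepath c \<epsilon>)
              (\<lambda>z. \<kappa> (XL c z) (YL z) - \<kappa> (XR c z) (YR z)))
           + contour_integral (reversepath (circlepath 0 R))
              (\<lambda>z. \<kappa> (XLinf z) (YL z) - \<kappa> (XRinf z) (YR z))))"

definition symplectic_form ::
  "(complex^'n^'n) set \<Rightarrow> (complex^'n^'n \<Rightarrow> complex^'n^'n \<Rightarrow> complex) \<Rightarrow> complex set
     \<Rightarrow> (complex \<Rightarrow> complex^'n^'n) \<Rightarrow> (complex \<Rightarrow> complex^'n^'n) \<Rightarrow> (complex \<Rightarrow> complex^'n^'n)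
     \<Rightarrow> complex" where
  "symplectic_form G \<kappa> D g \<delta> \<delta>' = (THE v. symplectic_value G \<kappa> D g \<delta> \<delta>' v)"

text \<open>
  The differential \<open>d\<phi>(X)\<close>. The moduli space sits inside the group of all holomorphic maps
  \<open>CP\<^sup>1 - D \<rightarrow> G\<close> that are \<open>1\<close> at infinity, and \<open>\<phi>\<close> is a function of such maps. Its
  differential on a tangent vector \<open>\<delta>\<close> is its derivative along every family of such maps through \<open>g\<close>
  with velocity \<open>\<delta>\<close>, in particular along every such curve in the moduli space. Velocities
  are uniform on the compact subsets of \<open>CP\<^sup>1 - D\<close>, whose finite parts are the closed \<open>K\<close> below.
\<close>

definition group_maps ::
  "(complex^'n^'n) set \<Rightarrow> complex set \<Rightarrow> (complex \<Rightarrow> complex^'n^'n) set" where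
  "group_maps G D = {h. (\<forall>z\<in>D. h z = 0) \<and> (\<forall>z. z \<notin> D \<longrightarrow> h z \<in> G) \<and>
     (\<forall>i j. (\<lambda>z. h z $ i $ j) holomorphic_on (- D)) \<and> (h \<longlongrightarrow> mat 1) at_infinity}"

definition curve_with_velocity ::
  "(complex^'n^'n) set \<Rightarrow> complex set \<Rightarrow> (complex \<Rightarrow> complex^'n^'n) \<Rightarrow> (complex \<Rightarrow> complex^'n^'n)
     \<Rightarrow> (complex \<Rightarrow> complex \<Rightarrow> complex^'n^'n) \<Rightarrow> bool" where
  "curve_with_velocity G D g \<delta> \<gamma> \<longleftrightarrow> \<gamma> 0 = g \<and> (\<forall>t. \<gamma> t \<in> group_maps G D) \<and>
     (\<forall>K. closed K \<and> K \<inter> D = {} \<longrightarrow>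
        uniform_limit K (\<lambda>t z. msmult (1 / t) (\<gamma> t z - g z)) \<delta> (at 0))"

definition has_differential_value ::
  "(complex^'n^'n) set \<Rightarrow> complex set \<Rightarrow> ((complex \<Rightarrow> complex^'n^'n) \<Rightarrow> complex)
     \<Rightarrow> (complex \<Rightarrow> complex^'n^'n) \<Rightarrow> (complex \<Rightarrow> complex^'n^'n) \<Rightarrow> complex \<Rightarrow> bool" where
  "has_differential_value G D \<phi> g \<delta> v \<longleftrightarrow>
     (\<forall>\<gamma>. curve_with_velocity G D g \<delta> \<gamma> \<longrightarrow> ((\<lambda>t. \<phi> (\<gamma> t)) has_field_derivative v) (at 0))"

definition is_hamiltonian_vector ::
  "(complex^'n^'n) set \<Rightarrow> (complex^'n^'n \<Rightarrow> complex^'n^'n \<Rightarrow> complex) \<Rightarrow> complex set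
     \<Rightarrow> ((complex \<Rightarrow> complex^'n^'n) \<Rightarrow> complex) \<Rightarrow> (complex \<Rightarrow> complex^'n^'n)
     \<Rightarrow> (complex \<Rightarrow> complex^'n^'n) \<Rightarrow> bool" where
  "is_hamiltonian_vector G \<kappa> D \<phi> g \<xi> \<longleftrightarrow> \<xi> \<in> tangent_space G D g \<and>
     (\<forall>\<delta>\<in>tangent_space G D g. has_differential_value G D \<phi> g \<delta> (symplectic_form G \<kappa> D g \<delta> \<xi>))"

definition hamiltonian_vector ::
  "(complex^'n^'n) set \<Rightarrow> (complex^'n^'n \<Rightarrow> complex^'n^'n \<Rightarrow> complex) \<Rightarrow> complex set
     \<Rightarrow> ((complex \<Rightarrow> complex^'n^'n) \<Rightarrow> complex) \<Rightarrow> (complex \<Rightarrow> complex^'n^'n)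
     \<Rightarrow> (complex \<Rightarrow> complex^'n^'n)" where
  "hamiltonian_vector G \<kappa> D \<phi> g = (THE \<xi>. is_hamiltonian_vector G \<kappa> D \<phi> g \<xi>)"

definition mhiggs_bracket ::
  "(complex^'n^'n) set \<Rightarrow> (complex^'n^'n \<Rightarrow> complex^'n^'n \<Rightarrow> complex) \<Rightarrow> complex set
     \<Rightarrow> ((complex \<Rightarrow> complex^'n^'n) \<Rightarrow> complex) \<Rightarrow> ((complex \<Rightarrow> complex^'n^'n) \<Rightarrow> complex)
     \<Rightarrow> (complex \<Rightarrow> complex^'n^'n) \<Rightarrow> complex" where
  "mhiggs_bracket G \<kappa> D \<phi> \<psi> g =
     symplectic_form G \<kappa> D g (hamiltonian_vector G \<kappa> D \<psi> g) (hamiltonian_vector G \<kappa> D \<phi> g)"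

section \<open>The Poisson group of power series at infinity\<close>

text \<open>From here on the variable of power series and Laurent series is \<open>z\<^sup>-\<^sup>1\<close>.\<close>

definition G1 :: "(complex^'n^'n) set \<Rightarrow> (complex fps^'n^'n) set" where
  "G1 G = {A \<in> power_series_group G. (\<chi> i j. fps_nth (A $ i $ j) 0) = mat 1}"

definition r_inf :: "(complex \<Rightarrow> complex^'n^'n) \<Rightarrow> complex fps^'n^'n" where
  "r_inf g = (\<chi> i j. fls_regpart (laurent_expansion (\<lambda>u. g (inverse u) $ i $ j) 0))"

definition regular_functions :: "(complex^'n^'n) set \<Rightarrow> (complex fps^'n^'n \<Rightarrow> complex) set" where
  "regular_functions G = {f. \<exists>P. \<forall>A\<in>G1 G.
     f A = peval (\<lambda>c. c) (\<lambda>(k, i, j). fps_nth (A $ i $ j) k) P}"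

definition zcoeff :: "complex fls^'n^'n \<Rightarrow> int \<Rightarrow> complex^'n^'n" where
  "zcoeff a k = (\<chi> i j. fls_nth (a $ i $ j) (- k))"

definition zmonom :: "complex^'n^'n \<Rightarrow> int \<Rightarrow> complex fls^'n^'n" where
  "zmonom X k = (\<chi> i j. fls_const (X $ i $ j) * fls_X_intpow (- k))"

definition loop_algebra :: "(complex^'n^'n) set \<Rightarrow> (complex fls^'n^'n) set" where
  "loop_algebra G = {a. \<forall>k. zcoeff a k \<in> lie_algebra G}"

definition negative_loop_algebra :: "(complex^'n^'n) set \<Rightarrow> (complex fps^'n^'n) set" where
  "negative_loop_algebra G = {X. fls_mat X \<in> loop_algebra G \<and> zcoeff (fls_mat X) 0 = 0}"

text \<open>The coefficient of \<open>z\<^sup>-\<^sup>1\<close> in \<open>\<kappa>(a, b)\<close>; only finitely many terms are nonzero.\<close>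

definition residue_pairing ::
  "(complex^'n^'n \<Rightarrow> complex^'n^'n \<Rightarrow> complex) \<Rightarrow> complex fls^'n^'n \<Rightarrow> complex fls^'n^'n \<Rightarrow> complex"
where
  "residue_pairing \<kappa> a b =
     (\<Sum>k | zcoeff a k \<noteq> 0 \<and> zcoeff b (- 1 - k) \<noteq> 0. \<kappa> (zcoeff a k) (zcoeff b (- 1 - k)))"

text \<open>The quadratic Casimir is the sum of \<open>e \<alpha> \<otimes> e' \<alpha>\<close> over \<open>\<alpha> < d\<close>, for dual bases \<open>e\<close>, \<open>e'\<close>.\<close>

definition dual_bases ::
  "(complex^'n^'n) set \<Rightarrow> (complex^'n^'n \<Rightarrow> complex^'n^'n \<Rightarrow> complex)
     \<Rightarrow> nat \<Rightarrow> (nat \<Rightarrow> complex^'n^'n) \<Rightarrow> (nat \<Rightarrow> complex^'n^'n) \<Rightarrow> bool" where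
  "dual_bases G \<kappa> d e e' \<longleftrightarrow>
     (\<forall>\<alpha><d. e \<alpha> \<in> lie_algebra G \<and> e' \<alpha> \<in> lie_algebra G) \<and>
     (\<forall>\<alpha><d. \<forall>\<beta><d. \<kappa> (e \<alpha>) (e' \<beta>) = (if \<alpha> = \<beta> then 1 else 0)) \<and>
     (\<forall>X\<in>lie_algebra G. \<exists>c. X = (\<Sum>\<alpha><d. msmult (c \<alpha>) (e \<alpha>)))"

text \<open>The pairing of \<open>r\<close>, the sum of \<open>e \<alpha> z\<^sup>-\<^sup>i\<^sup>-\<^sup>1 \<otimes> e' \<alpha> w\<^sup>i\<close>, with \<open>a \<otimes> b\<close>.\<close>

definition r_pairing ::
  "(complex^'n^'n \<Rightarrow> complex^'n^'n \<Rightarrow> complex) \<Rightarrow> nat \<Rightarrow> (nat \<Rightarrow> complex^'n^'n) \<Rightarrow> (nat \<Rightarrow> complex^'n^'n)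
     \<Rightarrow> complex fls^'n^'n \<Rightarrow> complex fls^'n^'n \<Rightarrow> complex" where
  "r_pairing \<kappa> d e e' a b =
     (\<Sum>i::nat. \<Sum>\<alpha><d. residue_pairing \<kappa> (zmonom (e \<alpha>) (- int i - 1)) a *
                       residue_pairing \<kappa> (zmonom (e' \<alpha>) (int i)) b)"

text \<open>
  The exponential of a matrix with zero constant term; its \<open>m\<close>-th power does not contribute
  to the coefficients of index \<open>k < m\<close>.
\<close>

definition fps_mat_exp :: "complex fps^'n^'n \<Rightarrow> complex fps^'n^'n" where
  "fps_mat_exp X = (\<chi> i j. Abs_fps (\<lambda>k. \<Sum>m\<le>k. fps_nth (mpow X m $ i $ j) k / fact m))"

text \<open>
  The residue pairing with \<open>z\<^sup>-\<^sup>1 g[[z\<^sup>-\<^sup>1]]\<close> determines the left and right gradients of \<open>f\<close> at \<open>h\<close> as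
  elements of \<open>g((z\<^sup>-\<^sup>1)) / z\<^sup>-\<^sup>1 g[[z\<^sup>-\<^sup>1]] = g[z]\<close>. In the Sklyanin formula they have to be
  represented by elements \<open>a\<close>, \<open>b = Ad\<^sub>h\<^sup>-\<^sup>1 a\<close> of \<open>g((z\<^sup>-\<^sup>1))\<close>, as for functions on the group
  \<open>G((z\<^sup>-\<^sup>1))\<close>, because \<open>w\<^sup>i\<close> pairs to zero with polynomials. The value of the formula does not
  depend on the representatives, and it is the one with
  \<open>{\<phi>\<^sub>u, \<psi>\<^sub>v} = (\<kappa>(\<nabla>\<^sub>L\<phi>, \<nabla>\<^sub>L\<psi>) - \<kappa>(\<nabla>\<^sub>R\<phi>, \<nabla>\<^sub>R\<psi>)) / (u - v)\<close> for evaluation functions.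
\<close>

definition has_gradients ::
  "(complex^'n^'n) set \<Rightarrow> (complex^'n^'n \<Rightarrow> complex^'n^'n \<Rightarrow> complex)
     \<Rightarrow> (complex fps^'n^'n \<Rightarrow> complex) \<Rightarrow> complex fps^'n^'n
     \<Rightarrow> complex fls^'n^'n \<Rightarrow> complex fls^'n^'n \<Rightarrow> bool" where
  "has_gradients G \<kappa> f h a b \<longleftrightarrow> a \<in> loop_algebra G \<and> b \<in> loop_algebra G \<and>
     a ** fls_mat h = fls_mat h ** b \<and>
     (\<forall>X\<in>negative_loop_algebra G.
        ((\<lambda>t. f (fps_mat_exp (msmult (fps_const t) X) ** h))
           has_field_derivative residue_pairing \<kappa> a (fls_mat X)) (at 0) \<and>
        ((\<lambda>t. f (h ** fps_mat_exp (msmult (fps_const t) X)))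
           has_field_derivative residue_pairing \<kappa> b (fls_mat X)) (at 0))"

definition sklyanin_bracket ::
  "(complex^'n^'n) set \<Rightarrow> (complex^'n^'n \<Rightarrow> complex^'n^'n \<Rightarrow> complex)
     \<Rightarrow> (complex fps^'n^'n \<Rightarrow> complex) \<Rightarrow> (complex fps^'n^'n \<Rightarrow> complex)
     \<Rightarrow> complex fps^'n^'n \<Rightarrow> complex" where
  "sklyanin_bracket G \<kappa> f1 f2 h =
     (THE v. \<exists>d e e' a1 b1 a2 b2. dual_bases G \<kappa> d e e' \<and>
        has_gradients G \<kappa> f1 h a1 b1 \<and> has_gradients G \<kappa> f2 h a2 b2 \<and>
        v = r_pairing \<kappa> d e e' a1 a2 - r_pairing \<kappa> d e e' b1 b2)"

end

theory Submission
  imports Defs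
begin

text \<open>
  Write \<open>\<eta> = \<delta>g g\<^sup>-\<^sup>1\<close> for a tangent vector \<open>\<delta>g\<close>. By Cauchy's theorem \<open>\<Omega>(X, X')\<close> is the sum over \<open>D\<close> of the
  residues of \<open>\<kappa>(X\<^sup>L, \<eta>')\<close>, for any local representatives \<open>X\<^sup>L\<close>. A function of finitely many Taylor
  coefficients has as its gradient at \<open>g\<close> a polynomial loop \<open>a\<close>. Let \<open>b\<^sub>+\<close> be the polynomial part at
  infinity of \<open>b = Ad\<^sub>g\<^sup>-\<^sup>1 a\<close>. The vector \<open>g b\<^sub>+ - a g\<close> vanishes at infinity and has the representative
  \<open>(- a, b\<^sub>+)\<close> on the whole plane, so its pairings with other tangent vectors become residues at
  infinity: it is the Hamiltonian vector of the function, and such vectors separate tangent vectors.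
  For gradients \<open>a\<^sub>1\<close> and \<open>a\<^sub>2\<close> both brackets are then equal to \<open>- Res \<kappa>(b\<^sub>1\<^sub>+, b\<^sub>2)\<close>.
\<close>

text \<open>The form \<open>\<kappa>\<close> is known on the Lie algebra only, while the analysis is
  done on matrix entries. So it is first rewritten as a bilinear polynomial in the entries; this
  gives holomorphy and Laurent expansions of \<open>\<kappa> (F z) (H z)\<close> and an extension to
  loops. The definitions shape the rest. The symplectic form, Hamiltonian vectors and the Sklyanin
  bracket are definite descriptions, so that each value must be shown to exist and to be unique. A
  differential is a condition on all curves with a given velocity; it determines something only if
  every tangent vector is the velocity of some curve, and the matrix exponential supplies one. A
  regular function agrees with a polynomial only on \<open>G1 G\<close>, so deformations of the
  expansion at infinity have to stay in that group. Gradients are determined only up to loops in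
  negative powers of z, and the Sklyanin value must not see this ambiguity. What makes the algebra
  work is the Manin triple: g[z] and its complement are isotropic for the residue pairing, and the
  adjoint action of the power series at infinity preserves the complement.\<close>

no_notation fps_nth (infixl \<open>$\<close> 75)

section \<open>Matrices and polynomial calculus over a commutative ring\<close>

section \<open>Matrices over a commutative ring\<close>

lemma matrix_mult_nth: "(A ** B) $ i $ j = (\<Sum>k\<in>UNIV. A $ i $ k * B $ k $ j)"
  by (simp add: matrix_matrix_mult_def)

lemma msmult_nth [simp]: "msmult c A $ i $ j = c * A $ i $ j"
  by (simp add: msmult_def)

lemma mat_nth: "mat c $ i $ j = (if i = j then c else 0)"
  by (simp add: mat_def)

lemma matrix_eqI: "(\<And>i j. A $ i $ j = B $ i $ j) \<Longrightarrow> A = B"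
  by (simp add: vec_eq_iff)

lemma matrix_add_rdistrib: "(B + C) ** A = B ** A + (C :: 'a::comm_ring_1^'n^'m) ** A"
  by (rule matrix_eqI) (simp add: matrix_mult_nth algebra_simps sum.distrib)

lemma matrix_diff_ldistrib: "A ** (B - C) = A ** B - A ** (C :: 'a::comm_ring_1^'n^'m)"
  by (rule matrix_eqI) (simp add: matrix_mult_nth algebra_simps sum_subtractf)

lemma matrix_diff_rdistrib: "(B - C) ** A = B ** A - (C :: 'a::comm_ring_1^'n^'m) ** A"
  by (rule matrix_eqI) (simp add: matrix_mult_nth algebra_simps sum_subtractf)

lemma matrix_minus_left: "(- A) ** B = - (A ** (B :: 'a::comm_ring_1^'n^'m))"
  by (rule matrix_eqI) (simp add: matrix_mult_nth sum_negf)

lemma msmult_mult_left: "msmult c A ** B = msmult c (A ** (B :: 'a::comm_ring_1^'n^'m))"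
  by (rule matrix_eqI) (simp add: matrix_mult_nth sum_distrib_left mult.assoc)

lemma msmult_mult_right: "A ** msmult c B = msmult c (A ** (B :: 'a::comm_ring_1^'n^'m))"
  by (rule matrix_eqI) (simp add: matrix_mult_nth sum_distrib_left mult_ac)

lemma msmult_one [simp]: "msmult 1 A = (A :: 'a::comm_ring_1^'n^'m)"
  by (rule matrix_eqI) simp

lemma msmult_zero [simp]: "msmult 0 A = (0 :: 'a::comm_ring_1^'n^'m)"
  by (rule matrix_eqI) simp

lemma msmult_minus_one: "msmult (- 1) A = - (A :: 'a::comm_ring_1^'n^'m)"
  by (rule matrix_eqI) simp

lemma msmult_msmult: "msmult c (msmult d A) = msmult (c * d) (A :: 'a::comm_ring_1^'n^'m)"
  by (rule matrix_eqI) (simp add: mult.assoc)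

lemma matrix_sum_nth: "(\<Sum>x\<in>S. f x) $ i $ j = (\<Sum>x\<in>S. f x $ i $ j)"
  by simp

lemma matrix_sum_left: "(\<Sum>x\<in>S. f x) ** A = (\<Sum>x\<in>S. f x ** (A :: 'a::comm_ring_1^'n^'m))"
  by (induction S rule: infinite_finite_induct) (auto simp: matrix_add_rdistrib)

lemma matrix_sum_right: "A ** (\<Sum>x\<in>S. f x) = (\<Sum>x\<in>S. (A :: 'a::comm_ring_1^'n^'m) ** f x)"
  by (induction S rule: infinite_finite_induct) (auto simp: matrix_add_ldistrib)

lemma mpow_0 [simp]: "mpow A 0 = mat 1"
  and mpow_Suc: "mpow A (Suc m) = A ** mpow A m"
  by (simp_all add: mpow_def)

lemma mpow_msmult: "mpow (msmult c A) m = msmult (c ^ m) (mpow (A :: 'a::comm_ring_1^'n^'n) m)"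
  by (induction m) (simp_all add: mpow_Suc msmult_mult_left msmult_mult_right msmult_msmult mult.commute)

lemma mpow_commute: "mpow A m ** A = A ** mpow (A :: 'a::comm_ring_1^'n^'n) m"
  by (induction m) (simp_all add: mpow_Suc, metis matrix_mul_assoc)

lemma matrix_inv_cancel:
  assumes "invertible A"
  shows matrix_inv_right_cancel: "A ** matrix_inv A = mat 1"
    and matrix_inv_left_cancel: "matrix_inv A ** A = mat 1"
proof -
  obtain A' where "A ** A' = mat 1 \<and> A' ** A = mat 1"
    using assms by (auto simp: invertible_def)
  then have "A ** matrix_inv A = mat 1 \<and> matrix_inv A ** A = mat 1"
    unfolding matrix_inv_def by (rule someI)
  then show "A ** matrix_inv A = mat 1" "matrix_inv A ** A = mat 1" by auto
qed

text \<open>Cramer's rule for each column of the inverse. In this form holomorphy and limits of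
  \<open>matrix_inv\<close> can be checked: sums, products and one quotient by the
  determinant.\<close>

lemma matrix_inv_nth:
  fixes A :: "'a::field^'n^'n"
  assumes "invertible A"
  shows "matrix_inv A $ i $ j = det (\<chi> k l. if l = i then mat 1 $ k $ j else A $ k $ l) / det A"
proof -
  have d: "det A \<noteq> 0" using assms by (simp add: invertible_det_nz)
  let ?x = "\<chi> k. matrix_inv A $ k $ j" and ?b = "(\<chi> k. mat 1 $ k $ j) :: 'a^'n"
  have "A *v ?x = ?b"
    using matrix_inv_right_cancel[OF assms]
    by (simp add: vec_eq_iff matrix_vector_mult_def matrix_mult_nth)
  then have "?x = (\<chi> k. det (\<chi> i l. if l = k then ?b $ i else A $ i $ l) / det A)"
    using cramer[OF d, of ?x ?b] by simp
  then show ?thesis by (simp add: vec_eq_iff cong: if_cong)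
qed

section \<open>Polynomial expressions\<close>

abbreviation entries :: "'a^'n^'m \<Rightarrow> 'm \<times> 'n \<Rightarrow> 'a" where
  "entries A \<equiv> (\<lambda>(i, j). A $ i $ j)"

text \<open>The differential of a polynomial at \<open>x\<close> in the direction \<open>y\<close>.
  The target algebra is arbitrary because the rule is needed at complex points and at points over
  power series.\<close>

primrec pder :: "(complex \<Rightarrow> 'a::comm_ring_1) \<Rightarrow> ('v \<Rightarrow> 'a) \<Rightarrow> ('v \<Rightarrow> 'a) \<Rightarrow> 'v pexpr \<Rightarrow> 'a" where
  "pder h x y (PConst c) = 0"
| "pder h x y (PVar v) = y v"
| "pder h x y (PAdd p q) = pder h x y p + pder h x y q"
| "pder h x y (PMult p q) = pder h x y p * peval h x q + peval h x p * pder h x y q"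

lemma pder_zero [simp]: "pder h x (\<lambda>v. 0) p = 0"
  by (induction p) auto

lemma pder_add: "pder h x (\<lambda>v. y v + z v) p = pder h x y p + pder h x z p"
  by (induction p) (auto simp: algebra_simps)

lemma pder_cmult: "pder h x (\<lambda>v. c * y v) p = c * pder h x y p"
  by (induction p) (auto simp: algebra_simps)

lemma pder_sum: "pder h x (\<lambda>v. \<Sum>w\<in>A. y w v) p = (\<Sum>w\<in>A. pder h x (y w) p)"
  by (induction A rule: infinite_finite_induct) (simp_all add: pder_add)

text \<open>Only the variables that occur are compared. This is why the differential of a regular
  function sees finitely many Taylor coefficients.\<close>

lemma pder_cong: "(\<And>v. v \<in> set_pexpr p \<Longrightarrow> y v = z v) \<Longrightarrow> pder h x y p = pder h x z p"
  by (induction p) auto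

lemma pder_eq_sum:
  fixes p :: "'v::finite pexpr"
  shows "pder h x y p = (\<Sum>v\<in>UNIV. y v * pder h x (\<lambda>w. if w = v then 1 else 0) p)"
proof -
  have "pder h x y p = pder h x (\<lambda>w. \<Sum>v\<in>UNIV. y v * (if w = v then 1 else 0)) p"
    by (rule pder_cong) (simp add: if_distrib cong: if_cong)
  then show ?thesis by (simp add: pder_sum pder_cmult)
qed

lemma peval_has_derivative:
  assumes "\<And>v. v \<in> set_pexpr p \<Longrightarrow> ((\<lambda>t. x t v) has_field_derivative y v) (at t within S)"
  shows "((\<lambda>t. peval (\<lambda>c. c) (x t) p) has_field_derivative pder (\<lambda>c. c) (x t) y p) (at t within S)"
  using assms by (induction p) (auto intro!: derivative_eq_intros simp: algebra_simps)

lemma fps_mult_nth_has_derivative: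
  fixes F G :: "complex \<Rightarrow> complex fps"
  assumes "\<And>k. ((\<lambda>t. fps_nth (F t) k) has_field_derivative fps_nth F' k) (at t)"
    and "\<And>k. ((\<lambda>t. fps_nth (G t) k) has_field_derivative fps_nth G' k) (at t)"
  shows "((\<lambda>t. fps_nth (F t * G t) k) has_field_derivative fps_nth (F' * G t + F t * G') k) (at t)"
  unfolding fps_mult_nth fps_add_nth sum.distrib[symmetric]
  by (rule DERIV_sum) (auto intro!: derivative_eq_intros assms)

lemma peval_fps_has_derivative:
  assumes "\<And>v k. v \<in> set_pexpr p \<Longrightarrow> ((\<lambda>t. fps_nth (x t v) k) has_field_derivative fps_nth (y v) k) (at t)"
  shows "((\<lambda>t. fps_nth (peval fps_const (x t) p) k) has_field_derivative
           fps_nth (pder fps_const (x t) y p) k) (at t)"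
  using assms
proof (induction p arbitrary: k)
  case (PMult p q)
  show ?case
    unfolding pder.simps peval.simps
    by (rule fps_mult_nth_has_derivative; rule PMult; rule PMult) auto
qed (auto intro!: derivative_eq_intros)

text \<open>\<open>pexpr\<close> has binary sums only, so a linear form needs its finitely many
  variables in a list.\<close>

definition univ_list :: "'v::finite list" where
  "univ_list = (SOME vs. distinct vs \<and> set vs = UNIV)"

lemma univ_list: "distinct (univ_list :: 'v::finite list) \<and> set (univ_list :: 'v list) = UNIV"
proof -
  obtain us :: "'v list" where "distinct us \<and> set us = UNIV"
    using finite_distinct_list[of "UNIV :: 'v set"] by auto
  then show ?thesis
    unfolding univ_list_def by (rule someI[where P = "\<lambda>vs. distinct vs \<and> set vs = UNIV"])
qed

lemma sum_list_univ_list: "(\<Sum>v\<leftarrow>univ_list. f v) = (\<Sum>v\<in>(UNIV :: 'v::finite set). f v)"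
  using sum.distinct_set_conv_list[of "univ_list :: 'v list" f] univ_list[where 'v = 'v] by simp

definition plin :: "('v::finite \<Rightarrow> complex) \<Rightarrow> 'v pexpr" where
  "plin c = foldr (\<lambda>v. PAdd (PMult (PConst (c v)) (PVar v))) univ_list (PConst 0)"

lemma
  fixes c :: "'v::finite \<Rightarrow> complex" and h :: "complex \<Rightarrow> 'a::comm_ring_1"
  assumes "h 0 = 0"
  shows peval_plin: "peval h x (plin c) = (\<Sum>v\<in>UNIV. h (c v) * x v)"
    and pder_plin: "pder h x y (plin c) = (\<Sum>v\<in>UNIV. h (c v) * y v)"
proof -
  have "peval h x (foldr (\<lambda>v. PAdd (PMult (PConst (c v)) (PVar v))) vs (PConst 0)) =
      (\<Sum>v\<leftarrow>vs. h (c v) * x v)"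
    "pder h x y (foldr (\<lambda>v. PAdd (PMult (PConst (c v)) (PVar v))) vs (PConst 0)) =
      (\<Sum>v\<leftarrow>vs. h (c v) * y v)" for vs
    by (induction vs) (use assms in auto)
  then show "peval h x (plin c) = (\<Sum>v\<in>UNIV. h (c v) * x v)"
    "pder h x y (plin c) = (\<Sum>v\<in>UNIV. h (c v) * y v)"
    by (simp_all add: plin_def sum_list_univ_list)
qed

primrec psubst :: "('v \<Rightarrow> 'w pexpr) \<Rightarrow> 'v pexpr \<Rightarrow> 'w pexpr" where
  "psubst s (PConst c) = PConst c"
| "psubst s (PVar v) = s v"
| "psubst s (PAdd p q) = PAdd (psubst s p) (psubst s q)"
| "psubst s (PMult p q) = PMult (psubst s p) (psubst s q)"

lemma peval_psubst: "peval h x (psubst s p) = peval h (\<lambda>v. peval h x (s v)) p"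
  by (induction p) auto

lemma pder_psubst:
  "pder h x y (psubst s p) = pder h (\<lambda>v. peval h x (s v)) (\<lambda>v. pder h x y (s v)) p"
  by (induction p) (auto simp: peval_psubst)

text \<open>The derivation of the polynomial ring that sends the variable \<open>v\<close> to
  \<open>s v\<close>. Unlike \<open>pder\<close> it returns an expression, so it can be iterated and
  tested for membership in a vanishing ideal.\<close>

primrec pdir :: "('v \<Rightarrow> 'v pexpr) \<Rightarrow> 'v pexpr \<Rightarrow> 'v pexpr" where
  "pdir s (PConst c) = PConst 0"
| "pdir s (PVar v) = s v"
| "pdir s (PAdd p q) = PAdd (pdir s p) (pdir s q)"
| "pdir s (PMult p q) = PAdd (PMult (pdir s p) q) (PMult p (pdir s q))"

lemma peval_pdir:
  assumes "h 0 = 0"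
  shows "peval h x (pdir s p) = pder h x (\<lambda>v. peval h x (s v)) p"
  using assms by (induction p) auto

lemma peval_hom:
  assumes "\<And>a b. f (a + b) = f a + f b" "\<And>a b. f (a * b) = f a * f b" "\<And>c. f (h c) = h' c"
  shows "peval h' (\<lambda>v. f (x v)) p = f (peval h x p)"
  using assms by (induction p) auto

text \<open>Left multiplication, right multiplication and conjugation are all of the form \<open>X \<mapsto> A X B\<close>.\<close>

definition pmul :: "complex^'n^'n \<Rightarrow> complex^'n^'n \<Rightarrow> 'n \<times> 'n \<Rightarrow> ('n \<times> 'n) pexpr" where
  "pmul A B = (\<lambda>(i, j). plin (\<lambda>(k, l). A $ i $ k * B $ l $ j))"

definition cmat :: "(complex \<Rightarrow> 'a) \<Rightarrow> complex^'n^'n \<Rightarrow> 'a^'n^'n" where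
  "cmat h A = (\<chi> i j. h (A $ i $ j))"

lemma cmat_nth [simp]: "cmat h A $ i $ j = h (A $ i $ j)"
  by (simp add: cmat_def)

lemma cmat_id [simp]: "cmat (\<lambda>c. c) A = A"
  by (simp add: cmat_def vec_eq_iff)

lemma triple_product_nth:
  "(A ** X ** B) $ i $ j = (\<Sum>(k, l)\<in>UNIV. A $ i $ k * B $ l $ j * X $ k $ (l::'n::finite) :: 'a::comm_ring_1)"
proof -
  have "(A ** X ** B) $ i $ j = (\<Sum>l\<in>UNIV. \<Sum>k\<in>UNIV. A $ i $ k * X $ k $ l * B $ l $ j)"
    by (simp add: matrix_mult_nth sum_distrib_right)
  also have "\<dots> = (\<Sum>k\<in>UNIV. \<Sum>l\<in>UNIV. A $ i $ k * B $ l $ j * X $ k $ l)"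
    by (subst sum.swap) (simp add: mult_ac)
  finally show ?thesis by (simp add: sum.cartesian_product UNIV_Times_UNIV)
qed

lemma
  assumes "h 0 = 0" "\<And>a b. h (a * b) = h a * h b"
  shows peval_pmul: "peval h (entries X) (pmul A B v) = entries (cmat h A ** X ** cmat h B) v"
    and pder_pmul: "pder h x (entries X) (pmul A B v) = entries (cmat h A ** X ** cmat h B) v"
  using assms
  by (cases v; simp add: pmul_def peval_plin pder_plin triple_product_nth split_beta)+

lemma cmat_mat_one: "h 0 = 0 \<Longrightarrow> h 1 = 1 \<Longrightarrow> cmat h (mat 1) = mat 1"
  by (rule matrix_eqI) (simp add: mat_nth)

section \<open>Lie algebras of algebraic groups and invariant forms on them\<close>

section \<open>Algebraic groups and their Lie algebras\<close>

lemma algebraic_groupD: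
  assumes "algebraic_group G"
  shows "mat 1 \<in> G" "A \<in> G \<Longrightarrow> B \<in> G \<Longrightarrow> A ** B \<in> G" "A \<in> G \<Longrightarrow> matrix_inv A \<in> G"
    "A \<in> G \<Longrightarrow> invertible A"
  using assms by (auto simp: algebraic_group_def zariski_closed_def)

text \<open>Any set of equations that defines \<open>G\<close> lies in the vanishing ideal, so the
  ideal detects membership among invertible matrices.\<close>

lemma algebraic_group_memI:
  assumes "algebraic_group G" "invertible A" "\<And>p. p \<in> vanishing_ideal G \<Longrightarrow> meval (\<lambda>c. c) A p = 0"
  shows "A \<in> G"
proof -
  obtain S where S: "G = {A. invertible A \<and> (\<forall>p\<in>S. meval (\<lambda>c. c) A p = 0)}"
    using assms(1) by (auto simp: algebraic_group_def zariski_closed_def)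
  then have "S \<subseteq> vanishing_ideal G" by (auto simp: vanishing_ideal_def)
  with assms(2,3) S show ?thesis by blast
qed

lemma vanishing_ideal_pmul:
  assumes "p \<in> vanishing_ideal G" "\<And>C. C \<in> G \<Longrightarrow> A ** C ** B \<in> G"
  shows "psubst (pmul A B) p \<in> vanishing_ideal G"
  using assms by (simp add: vanishing_ideal_def meval_def peval_psubst peval_pmul)

text \<open>The partial derivatives of \<open>p\<close> at the identity. With the Lie algebra
  written as the common kernel of these linear forms, the same equations can be read over Laurent
  series, where they cut out the loop algebra.\<close>

definition lie_form :: "('n::finite \<times> 'n) pexpr \<Rightarrow> 'n \<times> 'n \<Rightarrow> complex" where
  "lie_form p v = pder (\<lambda>c. c) (entries (mat 1)) (\<lambda>w. if w = v then 1 else 0) p"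

lemma lie_algebra_iff_pder:
  "X \<in> lie_algebra G \<longleftrightarrow>
    (\<forall>p\<in>vanishing_ideal G. pder (\<lambda>c. c) (entries (mat 1)) (entries X) p = 0)"
proof -
  have "((\<lambda>t. meval (\<lambda>c. c) (mat 1 + msmult t X) p) has_field_derivative
      pder (\<lambda>c. c) (entries (mat 1)) (entries X) p) (at 0)" for p
  proof -
    have "((\<lambda>t. meval (\<lambda>c. c) (mat 1 + msmult t X) p) has_field_derivative
      pder (\<lambda>c. c) (entries (mat 1 + msmult 0 X)) (entries X) p) (at 0)"
      unfolding meval_def by (rule peval_has_derivative) (auto intro!: derivative_eq_intros)
    then show ?thesis by simp
  qed
  then have "((\<lambda>t. meval (\<lambda>c. c) (mat 1 + msmult t X) p) has_field_derivative 0) (at 0) \<longleftrightarrow>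
      pder (\<lambda>c. c) (entries (mat 1)) (entries X) p = 0" for p
    using DERIV_unique by metis
  then show ?thesis unfolding lie_algebra_def by simp
qed

lemma lie_algebra_iff:
  "X \<in> lie_algebra G \<longleftrightarrow>
    (\<forall>p\<in>vanishing_ideal G. (\<Sum>v\<in>UNIV. lie_form p v * entries X v) = 0)"
proof -
  have "pder (\<lambda>c. c) (entries (mat 1)) (entries X) p = (\<Sum>v\<in>UNIV. lie_form p v * entries X v)" for p
    by (subst pder_eq_sum) (simp add: lie_form_def mult.commute)
  then show ?thesis by (simp add: lie_algebra_iff_pder)
qed

lemma lie_algebra_zero [simp]: "0 \<in> lie_algebra G"
  by (simp add: lie_algebra_iff split_beta)

lemma lie_algebra_add: "X \<in> lie_algebra G \<Longrightarrow> Y \<in> lie_algebra G \<Longrightarrow> X + Y \<in> lie_algebra G"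
  by (simp add: lie_algebra_iff split_beta distrib_left sum.distrib)

lemma entries_msmult: "entries (msmult c X) v = c * entries X v"
  by (cases v) simp

lemma lie_algebra_msmult: "X \<in> lie_algebra G \<Longrightarrow> msmult c X \<in> lie_algebra G"
  by (simp only: lie_algebra_iff entries_msmult mult.left_commute sum_distrib_left[symmetric])
     simp

lemma lie_algebra_minus: "X \<in> lie_algebra G \<Longrightarrow> - X \<in> lie_algebra G"
  using lie_algebra_msmult[of X G "-1"] by (simp add: msmult_minus_one)

lemma lie_algebra_diff: "X \<in> lie_algebra G \<Longrightarrow> Y \<in> lie_algebra G \<Longrightarrow> X - Y \<in> lie_algebra G"
  using lie_algebra_add[of X G "-Y"] lie_algebra_minus[of Y G] by simp

lemma lie_algebra_sum: "(\<And>x. x \<in> S \<Longrightarrow> f x \<in> lie_algebra G) \<Longrightarrow> (\<Sum>x\<in>S. f x) \<in> lie_algebra G"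
  by (induction S rule: infinite_finite_induct) (auto intro: lie_algebra_add)

text \<open>Conjugation fixes the identity and pulls the vanishing ideal back into itself, so the
  chain rule for \<open>psubst\<close> carries the equations of the Lie algebra along.\<close>

lemma lie_algebra_conj:
  assumes "algebraic_group G" "A \<in> G" "X \<in> lie_algebra G"
  shows "A ** X ** matrix_inv A \<in> lie_algebra G"
  unfolding lie_algebra_iff_pder
proof
  fix p assume p: "p \<in> vanishing_ideal G"
  note gr = algebraic_groupD[OF assms(1)]
  have "psubst (pmul A (matrix_inv A)) p \<in> vanishing_ideal G"
    using p by (rule vanishing_ideal_pmul) (use gr assms(2) in auto)
  then have "pder (\<lambda>c. c) (entries (mat 1)) (entries X) (psubst (pmul A (matrix_inv A)) p) = 0"
    using assms(3) by (simp add: lie_algebra_iff_pder)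
  then show "pder (\<lambda>c. c) (entries (mat 1)) (entries (A ** X ** matrix_inv A)) p = 0"
    using matrix_inv_cancel[OF gr(4)[OF assms(2)]]
    by (simp add: pder_psubst peval_pmul pder_pmul)
qed

lemma lie_algebra_conj':
  assumes "algebraic_group G" "A \<in> G" "X \<in> lie_algebra G"
  shows "matrix_inv A ** X ** A \<in> lie_algebra G"
proof -
  have "matrix_inv (matrix_inv A) = A"
    using matrix_inv_cancel[of A] matrix_inv_cancel[of "matrix_inv A"] algebraic_groupD(3,4)[OF assms(1)] assms(2)
    by (metis matrix_mul_assoc matrix_mul_lid matrix_mul_rid)
  then show ?thesis
    using lie_algebra_conj[OF assms(1) algebraic_groupD(3)[OF assms(1,2)] assms(3)] by simp
qed

text \<open>The derivation of the coordinate ring given by the vector field \<open>A \<mapsto> X A\<close>.\<close>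

abbreviation lie_deriv :: "complex^'n^'n \<Rightarrow> ('n \<times> 'n) pexpr \<Rightarrow> ('n \<times> 'n) pexpr" where
  "lie_deriv X \<equiv> pdir (pmul X (mat 1))"

lemma meval_lie_deriv:
  assumes "h 0 = 0" "h 1 = 1" "\<And>a b. h (a * b) = h a * h b"
  shows "meval h A (lie_deriv X p) = pder h (entries A) (entries (cmat h X ** A)) p"
  using assms by (simp add: meval_def peval_pdir peval_pmul cmat_mat_one)

text \<open>The vector field is tangent to \<open>G\<close> at each point \<open>A\<close>, because
  right translation by \<open>A\<close> moves the claim to the identity, where it is the definition
  of the Lie algebra.\<close>

lemma vanishing_ideal_lie_deriv:
  assumes "algebraic_group G" "X \<in> lie_algebra G" "p \<in> vanishing_ideal G"
  shows "lie_deriv X p \<in> vanishing_ideal G"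
  unfolding vanishing_ideal_def
proof safe
  fix A assume A: "A \<in> G"
  have "psubst (pmul (mat 1) A) p \<in> vanishing_ideal G"
    using assms(3) by (rule vanishing_ideal_pmul) (use A algebraic_groupD[OF assms(1)] in auto)
  then have "pder (\<lambda>c. c) (entries (mat 1)) (entries X) (psubst (pmul (mat 1) A) p) = 0"
    using assms(2) by (simp add: lie_algebra_iff_pder)
  then show "meval (\<lambda>c. c) A (lie_deriv X p) = 0"
    by (simp add: pder_psubst peval_pmul pder_pmul meval_lie_deriv)
qed

section \<open>Invariant pairings\<close>

lemma invariant_pairingD:
  assumes "invariant_pairing G \<kappa>"
  shows "X \<in> lie_algebra G \<Longrightarrow> Y \<in> lie_algebra G \<Longrightarrow> Z \<in> lie_algebra G \<Longrightarrow> \<kappa> (X + Y) Z = \<kappa> X Z + \<kappa> Y Z"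
    and "X \<in> lie_algebra G \<Longrightarrow> Z \<in> lie_algebra G \<Longrightarrow> \<kappa> (msmult c X) Z = c * \<kappa> X Z"
    and "X \<in> lie_algebra G \<Longrightarrow> Y \<in> lie_algebra G \<Longrightarrow> \<kappa> X Y = \<kappa> Y X"
    and "A \<in> G \<Longrightarrow> X \<in> lie_algebra G \<Longrightarrow> Y \<in> lie_algebra G \<Longrightarrow>
        \<kappa> (A ** X ** matrix_inv A) (A ** Y ** matrix_inv A) = \<kappa> X Y"
    and "X \<in> lie_algebra G \<Longrightarrow> (\<And>Y. Y \<in> lie_algebra G \<Longrightarrow> \<kappa> X Y = 0) \<Longrightarrow> X = 0"
  using assms lie_algebra_zero unfolding invariant_pairing_def by blast+

lemma pairing_zero:
  assumes "invariant_pairing G \<kappa>" "Z \<in> lie_algebra G"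
  shows "\<kappa> 0 Z = 0" "\<kappa> Z 0 = 0"
  using invariant_pairingD(2)[OF assms(1), of 0 Z 0] invariant_pairingD(3)[OF assms(1), of 0 Z] assms(2)
  by auto

lemma pairing_sum_left:
  assumes "invariant_pairing G \<kappa>" "\<And>i. i \<in> S \<Longrightarrow> f i \<in> lie_algebra G" "Z \<in> lie_algebra G"
  shows "\<kappa> (\<Sum>i\<in>S. f i) Z = (\<Sum>i\<in>S. \<kappa> (f i) Z)"
  using assms(2)
  by (induction S rule: infinite_finite_induct)
     (auto simp: pairing_zero[OF assms(1,3)] invariant_pairingD(1)[OF assms(1) _ _ assms(3)] lie_algebra_sum)

lemma pairing_sum_right:
  assumes "invariant_pairing G \<kappa>" "\<And>i. i \<in> S \<Longrightarrow> f i \<in> lie_algebra G" "Z \<in> lie_algebra G"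
  shows "\<kappa> Z (\<Sum>i\<in>S. f i) = (\<Sum>i\<in>S. \<kappa> Z (f i))"
proof -
  have "\<kappa> Z (\<Sum>i\<in>S. f i) = \<kappa> (\<Sum>i\<in>S. f i) Z"
    using assms by (intro invariant_pairingD(3)[OF assms(1)] lie_algebra_sum)
  also have "\<dots> = (\<Sum>i\<in>S. \<kappa> (f i) Z)" by (rule pairing_sum_left[OF assms])
  also have "\<dots> = (\<Sum>i\<in>S. \<kappa> Z (f i))"
    using assms by (intro sum.cong invariant_pairingD(3)[OF assms(1)]) auto
  finally show ?thesis .
qed

lemma pairing_msmult_right:
  assumes "invariant_pairing G \<kappa>" "X \<in> lie_algebra G" "Z \<in> lie_algebra G"
  shows "\<kappa> Z (msmult c X) = c * \<kappa> Z X"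
  using invariant_pairingD(2)[OF assms, of c] invariant_pairingD(3)[OF assms(1)] assms
  by (metis lie_algebra_msmult)

lemma pairing_diff_left:
  assumes "invariant_pairing G \<kappa>" "X \<in> lie_algebra G" "Y \<in> lie_algebra G" "Z \<in> lie_algebra G"
  shows "\<kappa> (X - Y) Z = \<kappa> X Z - \<kappa> Y Z"
  using invariant_pairingD(1)[OF assms(1,2) lie_algebra_minus[OF assms(3)] assms(4)]
    invariant_pairingD(2)[OF assms(1,3,4), of "-1"]
  by (simp add: msmult_minus_one)

text \<open>Dual bases without the spanning condition. Dual bases will be found as a dual system of
  maximal length.\<close>

definition dual_system ::
  "(complex^'n^'n) set \<Rightarrow> (complex^'n^'n \<Rightarrow> complex^'n^'n \<Rightarrow> complex)
     \<Rightarrow> nat \<Rightarrow> (nat \<Rightarrow> complex^'n^'n) \<Rightarrow> (nat \<Rightarrow> complex^'n^'n) \<Rightarrow> bool" where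
  "dual_system G \<kappa> d e e' \<longleftrightarrow>
     (\<forall>\<alpha><d. e \<alpha> \<in> lie_algebra G \<and> e' \<alpha> \<in> lie_algebra G) \<and>
     (\<forall>\<alpha><d. \<forall>\<beta><d. \<kappa> (e \<alpha>) (e' \<beta>) = (if \<alpha> = \<beta> then 1 else 0))"

lemma pairing_dual_system:
  assumes "invariant_pairing G \<kappa>" "dual_system G \<kappa> d e e'" "\<beta> < d"
  shows "\<kappa> (\<Sum>\<alpha><d. msmult (c \<alpha>) (e \<alpha>)) (e' \<beta>) = c \<beta>"
    and "\<kappa> (e \<beta>) (\<Sum>\<alpha><d. msmult (c \<alpha>) (e' \<alpha>)) = c \<beta>"
proof -
  have L: "e \<alpha> \<in> lie_algebra G" "e' \<alpha> \<in> lie_algebra G" if "\<alpha> < d" for \<alpha>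
    using assms(2) that by (auto simp: dual_system_def)
  have "\<kappa> (\<Sum>\<alpha><d. msmult (c \<alpha>) (e \<alpha>)) (e' \<beta>) = (\<Sum>\<alpha><d. c \<alpha> * \<kappa> (e \<alpha>) (e' \<beta>))"
    using L assms(3)
    by (subst pairing_sum_left[OF assms(1)]) (auto intro: lie_algebra_msmult simp: invariant_pairingD(2)[OF assms(1)])
  also have "\<dots> = (\<Sum>\<alpha><d. if \<alpha> = \<beta> then c \<alpha> else 0)"
    using assms(2,3) by (intro sum.cong) (auto simp: dual_system_def)
  finally show "\<kappa> (\<Sum>\<alpha><d. msmult (c \<alpha>) (e \<alpha>)) (e' \<beta>) = c \<beta>" using assms(3) by simp
  have "\<kappa> (e \<beta>) (\<Sum>\<alpha><d. msmult (c \<alpha>) (e' \<alpha>)) = (\<Sum>\<alpha><d. c \<alpha> * \<kappa> (e \<beta>) (e' \<alpha>))"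
    using L assms(3)
    by (subst pairing_sum_right[OF assms(1)]) (auto intro: lie_algebra_msmult simp: pairing_msmult_right[OF assms(1)])
  also have "\<dots> = (\<Sum>\<alpha><d. if \<alpha> = \<beta> then c \<alpha> else 0)"
    using assms(2,3) by (intro sum.cong) (auto simp: dual_system_def)
  finally show "\<kappa> (e \<beta>) (\<Sum>\<alpha><d. msmult (c \<alpha>) (e' \<alpha>)) = c \<beta>" using assms(3) by simp
qed

text \<open>Pairing with \<open>e' \<beta>\<close> isolates the coefficient of
  \<open>e \<beta>\<close>, so the \<open>e \<alpha>\<close> are independent. The real dimension is
  a crude bound, but any bound makes a maximal system exist.\<close>

lemma dual_system_bound:
  fixes G :: "(complex^'n^'n) set"
  assumes "invariant_pairing G \<kappa>" "dual_system G \<kappa> d e e'"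
  shows "d \<le> DIM(complex^'n^'n)"
proof -
  have L: "e \<alpha> \<in> lie_algebra G" "e' \<alpha> \<in> lie_algebra G" if "\<alpha> < d" for \<alpha>
    using assms(2) that by (auto simp: dual_system_def)
  have inj: "inj_on e {..<d}"
  proof (rule inj_onI)
    fix \<alpha> \<beta> assume *: "\<alpha> \<in> {..<d}" "\<beta> \<in> {..<d}" "e \<alpha> = e \<beta>"
    then have "\<kappa> (e \<beta>) (e' \<alpha>) = 1" using assms(2) unfolding dual_system_def by (metis lessThan_iff)
    then show "\<alpha> = \<beta>" using assms(2) * unfolding dual_system_def by (metis lessThan_iff zero_neq_one)
  qed
  have "independent (e ` {..<d})"
  proof (subst independent_explicit, intro conjI allI impI ballI)
    fix u v assume u: "(\<Sum>v\<in>e ` {..<d}. u v *\<^sub>R v) = 0" and v: "v \<in> e ` {..<d}"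
    then obtain \<beta> where \<beta>: "\<beta> < d" "v = e \<beta>" by auto
    have "0 = (\<Sum>\<alpha><d. u (e \<alpha>) *\<^sub>R e \<alpha>)"
      using u by (simp add: sum.reindex[OF inj])
    also have "\<dots> = (\<Sum>\<alpha><d. msmult (of_real (u (e \<alpha>))) (e \<alpha>))"
      by (intro sum.cong refl matrix_eqI) (simp add: scaleR_conv_of_real[where 'a = complex])
    finally have "\<kappa> 0 (e' \<beta>) = of_real (u v)"
      using pairing_dual_system(1)[OF assms \<beta>(1), of "\<lambda>\<alpha>. of_real (u (e \<alpha>))"] \<beta>(2) by simp
    then show "u v = 0" using pairing_zero[OF assms(1) L(2)[OF \<beta>(1)]] by simp
  qed auto
  then have "card (e ` {..<d}) \<le> DIM(complex^'n^'n)" by (rule independent_card_le)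
  then show ?thesis by (simp add: card_image[OF inj])
qed

text \<open>A vector outside the span of a maximal system, made orthogonal to all \<open>e'\<close>,
  has a partner by non-degeneracy; together they would give a longer system.\<close>

lemma dual_bases_exist:
  fixes G :: "(complex^'n^'n) set"
  assumes \<kappa>: "invariant_pairing G \<kappa>"
  obtains d e e' where "dual_bases G \<kappa> d e e'"
proof -
  have "\<exists>d e e'. dual_system G \<kappa> d e e' \<and> (\<nexists>e e'. dual_system G \<kappa> (Suc d) e e')"
  proof (rule ccontr)
    assume *: "\<not> ?thesis"
    have "\<exists>e e'. dual_system G \<kappa> d e e'" for d
    proof (induction d)
      case (Suc d)
      then show ?case using * by blast
    qed (simp add: dual_system_def)
    then show False using dual_system_bound[OF \<kappa>] by (metis Suc_n_not_le_n)
  qed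
  then obtain d e e' where ds: "dual_system G \<kappa> d e e'"
    and max: "\<And>e e'. \<not> dual_system G \<kappa> (Suc d) e e'" by blast
  have L: "e \<alpha> \<in> lie_algebra G" "e' \<alpha> \<in> lie_algebra G" if "\<alpha> < d" for \<alpha>
    using ds that by (auto simp: dual_system_def)
  have "\<exists>c. X = (\<Sum>\<alpha><d. msmult (c \<alpha>) (e \<alpha>))" if X: "X \<in> lie_algebra G" for X
  proof (rule ccontr)
    assume neq: "\<not> ?thesis"
    define X' where "X' = X - (\<Sum>\<alpha><d. msmult (\<kappa> X (e' \<alpha>)) (e \<alpha>))"
    have S1: "(\<Sum>\<alpha><d. msmult (\<kappa> X (e' \<alpha>)) (e \<alpha>)) \<in> lie_algebra G"
      using L by (auto intro!: lie_algebra_sum lie_algebra_msmult)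
    have X': "X' \<in> lie_algebra G" "X' \<noteq> 0"
      using X S1 neq by (auto simp: X'_def intro: lie_algebra_diff)
    have X'0: "\<kappa> X' (e' \<alpha>) = 0" if "\<alpha> < d" for \<alpha>
      using pairing_diff_left[OF \<kappa> X S1 L(2)[OF that]] pairing_dual_system(1)[OF \<kappa> ds that]
      by (simp add: X'_def)
    obtain Y0 where Y0: "Y0 \<in> lie_algebra G" "\<kappa> X' Y0 \<noteq> 0"
      using invariant_pairingD(5)[OF \<kappa> X'(1)] X'(2) by blast
    define Y where "Y = msmult (1 / \<kappa> X' Y0) Y0"
    have Y: "Y \<in> lie_algebra G" "\<kappa> X' Y = 1"
      using Y0 X'(1) by (auto simp: Y_def lie_algebra_msmult pairing_msmult_right[OF \<kappa>])
    \<comment> \<open>The partner \<open>Y\<close> is made orthogonal to all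
      \<open>e \<alpha>\<close>. Since \<open>X'\<close> is orthogonal to all
      \<open>e' \<alpha>\<close>, this correction leaves its pairing with \<open>X'\<close> equal to
      1.\<close>
    define S2 where "S2 = (\<Sum>\<alpha><d. msmult (\<kappa> (e \<alpha>) Y) (e' \<alpha>))"
    have S2: "S2 \<in> lie_algebra G"
      unfolding S2_def using L by (auto intro!: lie_algebra_sum lie_algebra_msmult)
    have diff_right: "\<kappa> Z (Y - S2) = \<kappa> Z Y - \<kappa> Z S2" if "Z \<in> lie_algebra G" for Z
      using pairing_diff_left[OF \<kappa> Y(1) S2 that] invariant_pairingD(3)[OF \<kappa>] that Y(1) S2 lie_algebra_diff
      by metis
    have "\<kappa> X' S2 = 0"
      unfolding S2_def using L X'(1) X'0
      by (subst pairing_sum_right[OF \<kappa>])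
         (auto intro!: lie_algebra_msmult sum.neutral simp: pairing_msmult_right[OF \<kappa>])
    then have 1: "\<kappa> X' (Y - S2) = 1" using diff_right[OF X'(1)] Y(2) by simp
    have 2: "\<kappa> (e \<alpha>) (Y - S2) = 0" if "\<alpha> < d" for \<alpha>
      using diff_right[OF L(1)[OF that]] pairing_dual_system(2)[OF \<kappa> ds that] by (simp add: S2_def)
    have "dual_system G \<kappa> (Suc d) (e(d := X')) (e'(d := Y - S2))"
      using ds 1 2 X'0 X'(1) Y(1) S2 unfolding dual_system_def
      by (auto simp: less_Suc_eq intro: lie_algebra_diff)
    then show False using max by blast
  qed
  then have "dual_bases G \<kappa> d e e'" using ds by (auto simp: dual_bases_def dual_system_def)
  then show ?thesis by (rule that)
qed

lemma dual_bases_expand: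
  assumes "invariant_pairing G \<kappa>" "dual_bases G \<kappa> d e e'" "X \<in> lie_algebra G"
  shows "X = (\<Sum>\<alpha><d. msmult (\<kappa> X (e' \<alpha>)) (e \<alpha>))"
proof -
  have ds: "dual_system G \<kappa> d e e'" using assms(2) by (auto simp: dual_bases_def dual_system_def)
  obtain c where c: "X = (\<Sum>\<alpha><d. msmult (c \<alpha>) (e \<alpha>))" using assms(2,3) by (auto simp: dual_bases_def)
  then have "\<kappa> X (e' \<alpha>) = c \<alpha>" if "\<alpha> < d" for \<alpha>
    using pairing_dual_system(1)[OF assms(1) ds that] by simp
  then show ?thesis using c by simp
qed

lemma pairing_dual_bases:
  assumes "invariant_pairing G \<kappa>" "dual_bases G \<kappa> d e e'" "X \<in> lie_algebra G" "Y \<in> lie_algebra G"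
  shows "\<kappa> X Y = (\<Sum>\<alpha><d. \<kappa> X (e' \<alpha>) * \<kappa> (e \<alpha>) Y)"
proof -
  have "e \<alpha> \<in> lie_algebra G" if "\<alpha> < d" for \<alpha> using assms(2) that by (auto simp: dual_bases_def)
  then have "\<kappa> (\<Sum>\<alpha><d. msmult (\<kappa> X (e' \<alpha>)) (e \<alpha>)) Y = (\<Sum>\<alpha><d. \<kappa> X (e' \<alpha>) * \<kappa> (e \<alpha>) Y)"
    using assms(4)
    by (subst pairing_sum_left[OF assms(1)]) (auto intro: lie_algebra_msmult simp: invariant_pairingD(2)[OF assms(1)])
  then show ?thesis using dual_bases_expand[OF assms(1-3)] by simp
qed

text \<open>Nothing is known about \<open>l\<close> off the Lie algebra, so its restriction to a
  basis is extended linearly to all matrices. The coefficients are the values of the extension on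
  the matrix units.\<close>

lemma linear_functional_coeffs:
  fixes G :: "(complex^'n^'n) set"
  assumes add: "\<And>X Y. X \<in> lie_algebra G \<Longrightarrow> Y \<in> lie_algebra G \<Longrightarrow> l (X + Y) = l X + l Y"
    and smult: "\<And>c X. X \<in> lie_algebra G \<Longrightarrow> l (msmult c X) = c * l X"
  obtains c where "\<And>X. X \<in> lie_algebra G \<Longrightarrow> l X = (\<Sum>v\<in>UNIV. c v * entries X v)"
proof -
  interpret V: vector_space "msmult :: complex \<Rightarrow> complex^'n^'n \<Rightarrow> complex^'n^'n"
    by unfold_locales (auto simp: vec_eq_iff algebra_simps)
  interpret P: vector_space_pair "msmult :: complex \<Rightarrow> complex^'n^'n \<Rightarrow> complex^'n^'n" "(*) :: complex \<Rightarrow> _"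
    by unfold_locales (auto simp: algebra_simps)
  obtain B where B: "B \<subseteq> lie_algebra G" "V.independent B" "lie_algebra G \<subseteq> V.span B"
    using V.maximal_independent_subset by blast
  obtain g where g: "Vector_Spaces.linear msmult (*) g" "\<And>x. x \<in> B \<Longrightarrow> g x = l x"
    using P.linear_independent_extend[OF B(2), of l] by auto
  interpret g: Vector_Spaces.linear "msmult :: complex \<Rightarrow> complex^'n^'n \<Rightarrow> complex^'n^'n" "(*)" g by (rule g(1))
  have l0: "l 0 = 0" using smult[of 0 0] by simp
  \<comment> \<open>Membership is carried through the induction because \<open>l\<close> is known to
    be additive only on the Lie algebra.\<close>
  have "X \<in> lie_algebra G \<and> g X = l X" if "X \<in> V.span B" for X
    using that
  proof (induction rule: V.span_induct_alt)
    case base show ?case using g.zero l0 by simp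
  next
    case (step c x y)
    then have "msmult c x \<in> lie_algebra G" "x \<in> lie_algebra G" using B(1) lie_algebra_msmult by blast+
    then show ?case
      using step g(2) by (simp add: g.add g.scale add smult lie_algebra_add)
  qed
  then have gl: "g X = l X" if "X \<in> lie_algebra G" for X using that B(3) by blast
  define E :: "'n \<times> 'n \<Rightarrow> complex^'n^'n" where
    "E = (\<lambda>(i, j). \<chi> k m. if k = i \<and> m = j then 1 else 0)"
  have E: "X = (\<Sum>v\<in>UNIV. msmult (entries X v) (E v))" for X :: "complex^'n^'n"
  proof (rule matrix_eqI)
    fix i j
    have "(\<Sum>v\<in>UNIV. msmult (entries X v) (E v)) $ i $ j = (\<Sum>v\<in>UNIV. if v = (i, j) then entries X v else 0)"
      unfolding matrix_sum_nth by (intro sum.cong) (auto simp: E_def split: if_splits)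
    then show "X $ i $ j = (\<Sum>v\<in>UNIV. msmult (entries X v) (E v)) $ i $ j" by simp
  qed
  have gE: "g X = (\<Sum>v\<in>UNIV. g (E v) * entries X v)" for X
  proof -
    have "g X = g (\<Sum>v\<in>UNIV. msmult (entries X v) (E v))" using E by (rule arg_cong)
    also have "\<dots> = (\<Sum>v\<in>UNIV. g (E v) * entries X v)" by (simp only: g.sum g.scale mult.commute)
    finally show ?thesis .
  qed
  show ?thesis
    by (rule that[of "\<lambda>v. g (E v)"]) (simp only: gl[symmetric] gE[symmetric])
qed

text \<open>Makes \<open>\<kappa>\<close> a polynomial in matrix entries, so that it can be applied
  to holomorphic functions and to Laurent series.\<close>

lemma pairing_coeffs:
  fixes G :: "(complex^'n^'n) set"
  assumes \<kappa>: "invariant_pairing G \<kappa>"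
  obtains K where "\<And>X Y. X \<in> lie_algebra G \<Longrightarrow> Y \<in> lie_algebra G \<Longrightarrow>
    \<kappa> X Y = (\<Sum>v\<in>UNIV. \<Sum>w\<in>UNIV. K v w * (entries X v * entries Y w))"
proof -
  obtain d e e' where db: "dual_bases G \<kappa> d e e'" using dual_bases_exist[OF \<kappa>] .
  have L: "e \<alpha> \<in> lie_algebra G" "e' \<alpha> \<in> lie_algebra G" if "\<alpha> < d" for \<alpha>
    using db that by (auto simp: dual_bases_def)
  have "\<exists>c. \<forall>X\<in>lie_algebra G. \<kappa> X Z = (\<Sum>v\<in>UNIV. c v * entries X v)" if Z: "Z \<in> lie_algebra G" for Z
    by (rule linear_functional_coeffs[where G = G and l = "\<lambda>X. \<kappa> X Z"])
       (use Z in \<open>auto simp: invariant_pairingD(1,2)[OF \<kappa>]\<close>)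
  then obtain c where c: "\<And>Z X. Z \<in> lie_algebra G \<Longrightarrow> X \<in> lie_algebra G \<Longrightarrow>
      \<kappa> X Z = (\<Sum>v\<in>UNIV. c Z v * entries X v)" by metis
  define K where "K = (\<lambda>v w. \<Sum>\<alpha><d. c (e' \<alpha>) v * c (e \<alpha>) w)"
  show ?thesis
  proof (rule that)
    fix X Y assume XY: "X \<in> lie_algebra G" "Y \<in> lie_algebra G"
    have "\<kappa> X Y = (\<Sum>\<alpha><d. \<kappa> X (e' \<alpha>) * \<kappa> Y (e \<alpha>))"
      using pairing_dual_bases[OF \<kappa> db XY] invariant_pairingD(3)[OF \<kappa> _ XY(2)] L by simp
    also have "\<dots> = (\<Sum>\<alpha><d. \<Sum>v\<in>UNIV. \<Sum>w\<in>UNIV. c (e' \<alpha>) v * entries X v * (c (e \<alpha>) w * entries Y w))"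
      using L XY by (intro sum.cong refl) (simp add: c sum_product)
    also have "\<dots> = (\<Sum>v\<in>UNIV. \<Sum>w\<in>UNIV. \<Sum>\<alpha><d. c (e' \<alpha>) v * entries X v * (c (e \<alpha>) w * entries Y w))"
      by (subst sum.swap) (intro sum.cong refl sum.swap)
    also have "\<dots> = (\<Sum>v\<in>UNIV. \<Sum>w\<in>UNIV. K v w * (entries X v * entries Y w))"
      unfolding K_def sum_distrib_right by (intro sum.cong refl) (simp only: mult_ac)
    finally show "\<kappa> X Y = (\<Sum>v\<in>UNIV. \<Sum>w\<in>UNIV. K v w * (entries X v * entries Y w))" .
  qed
qed

section \<open>The group of power series: inverses, exponentials and flows\<close>

section \<open>Matrices of formal power series\<close>

definition fcoeff :: "complex fps^'n^'n \<Rightarrow> nat \<Rightarrow> complex^'n^'n" where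
  "fcoeff A k = (\<chi> i j. fps_nth (A $ i $ j) k)"

lemma fcoeff_nth [simp]: "fcoeff A k $ i $ j = fps_nth (A $ i $ j) k"
  by (simp add: fcoeff_def)

lemma fps_matrix_eqI: "(\<And>k. fcoeff A k = fcoeff B k) \<Longrightarrow> A = B"
  by (simp add: vec_eq_iff fps_eq_iff)

lemma fcoeff_add [simp]: "fcoeff (A + B) k = fcoeff A k + fcoeff B k"
  and fcoeff_diff [simp]: "fcoeff (A - B) k = fcoeff A k - fcoeff B k"
  and fcoeff_msmult_const [simp]: "fcoeff (msmult (fps_const c) A) k = msmult c (fcoeff A k)"
  by (rule matrix_eqI; simp)+

lemma fcoeff_sum [simp]: "fcoeff (\<Sum>x\<in>S. f x) k = (\<Sum>x\<in>S. fcoeff (f x) k)"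
  by (rule matrix_eqI) (simp add: fps_sum_nth)

lemma fcoeff_mat: "fcoeff (mat 1) k = (if k = 0 then mat 1 else 0)"
  by (rule matrix_eqI) (auto simp: mat_nth)

lemma fcoeff_mult: "fcoeff (A ** B) k = (\<Sum>a\<le>k. fcoeff A a ** fcoeff B (k - a))"
proof (rule matrix_eqI)
  fix i j
  have "fcoeff (A ** B) k $ i $ j =
      (\<Sum>l\<in>UNIV. \<Sum>a\<le>k. fps_nth (A $ i $ l) a * fps_nth (B $ l $ j) (k - a))"
    by (simp add: matrix_mult_nth fps_sum_nth fps_mult_nth atLeast0AtMost)
  also have "\<dots> = (\<Sum>a\<le>k. \<Sum>l\<in>UNIV. fps_nth (A $ i $ l) a * fps_nth (B $ l $ j) (k - a))"
    by (rule sum.swap)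
  finally show "fcoeff (A ** B) k $ i $ j = (\<Sum>a\<le>k. fcoeff A a ** fcoeff B (k - a)) $ i $ j"
    by (simp add: matrix_mult_nth)
qed

lemma fcoeff_mult_cong:
  assumes "\<And>a. a \<le> k \<Longrightarrow> fcoeff B a = fcoeff B' a"
  shows "fcoeff (A ** B) k = fcoeff (A ** B') k" "fcoeff (B ** A) k = fcoeff (B' ** A) k"
  using assms by (auto simp: fcoeff_mult)

lemma fcoeff_mpow_eq_0:
  assumes "fcoeff A 0 = 0" "k < m"
  shows "fcoeff (mpow A m) k = 0"
  using assms(2)
proof (induction m arbitrary: k)
  case (Suc m)
  have "fcoeff A a ** fcoeff (mpow A m) (k - a) = 0" if "a \<le> k" for a
    using assms(1) Suc that by (cases a) auto
  then show ?case by (simp add: mpow_Suc fcoeff_mult)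
qed simp

text \<open>The series of \<open>c m\<close> times \<open>mpow A m\<close>. If \<open>A\<close> has
  zero constant term, its \<open>m\<close>-th power starts at index \<open>m\<close>, so the cut at
  \<open>m \<le> k\<close> loses nothing. Constant \<open>c\<close> gives the geometric series,
  \<open>t ^ m / fact m\<close> the exponential.\<close>

definition series_mat :: "(nat \<Rightarrow> complex) \<Rightarrow> complex fps^'n^'n \<Rightarrow> complex fps^'n^'n" where
  "series_mat c A = (\<chi> i j. Abs_fps (\<lambda>k. \<Sum>m\<le>k. c m * fps_nth (mpow A m $ i $ j) k))"

lemma fcoeff_series_mat: "fcoeff (series_mat c A) k = (\<Sum>m\<le>k. msmult (c m) (fcoeff (mpow A m) k))"
  by (rule matrix_eqI) (simp add: series_mat_def)

lemma fcoeff_series_mat_le: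
  assumes "fcoeff A 0 = 0" "k \<le> N"
  shows "fcoeff (series_mat c A) k = fcoeff (\<Sum>m\<le>N. msmult (fps_const (c m)) (mpow A m)) k"
proof -
  have "(\<Sum>m\<le>N. msmult (c m) (fcoeff (mpow A m) k)) = (\<Sum>m\<le>k. msmult (c m) (fcoeff (mpow A m) k))"
    using assms by (intro sum.mono_neutral_right) (auto simp: fcoeff_mpow_eq_0 vec_eq_iff)
  then show ?thesis by (simp add: fcoeff_series_mat)
qed

lemma fcoeff_mult_series_mat:
  assumes "fcoeff A 0 = 0"
  shows "fcoeff (A ** series_mat c A) k = (\<Sum>m\<le>k. msmult (c m) (fcoeff (mpow A (Suc m)) k))"
    and "fcoeff (series_mat c A ** A) k = (\<Sum>m\<le>k. msmult (c m) (fcoeff (mpow A (Suc m)) k))"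
proof -
  let ?S = "\<Sum>m\<le>k. msmult (fps_const (c m)) (mpow A m)"
  note eq = fcoeff_series_mat_le[OF assms, where N = k and c = c]
  have "fcoeff (A ** series_mat c A) k = fcoeff (A ** ?S) k"
    "fcoeff (series_mat c A ** A) k = fcoeff (?S ** A) k"
    by (rule fcoeff_mult_cong[OF eq]; simp)+
  then show "fcoeff (A ** series_mat c A) k = (\<Sum>m\<le>k. msmult (c m) (fcoeff (mpow A (Suc m)) k))"
    "fcoeff (series_mat c A ** A) k = (\<Sum>m\<le>k. msmult (c m) (fcoeff (mpow A (Suc m)) k))"
    by (simp_all add: matrix_sum_left matrix_sum_right msmult_mult_left msmult_mult_right mpow_Suc mpow_commute)
qed

lemma invertible_fps_matrix:
  fixes A :: "complex fps^'n^'n"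
  assumes "fcoeff A 0 = mat 1"
  shows "invertible A"
proof -
  define N where "N = mat 1 - A"
  have N0: "fcoeff N 0 = 0" using assms by (simp add: N_def fcoeff_mat)
  let ?S = "series_mat (\<lambda>_. 1) N"
  \<comment> \<open>The geometric series telescopes: the shift drops the term \<open>m = 0\<close>,
    and the new term \<open>m = Suc k\<close> has no coefficient at index \<open>k\<close>.\<close>
  have "(\<Sum>m\<le>k. fcoeff (mpow N (Suc m)) k) = (\<Sum>m\<le>k. fcoeff (mpow N m) k) - fcoeff (mat 1) k" for k
  proof -
    have "(\<Sum>m\<le>Suc k. fcoeff (mpow N m) k) = fcoeff (mpow N 0) k + (\<Sum>m\<le>k. fcoeff (mpow N (Suc m)) k)"
      by (rule sum.atMost_Suc_shift)
    moreover have "fcoeff (mpow N (Suc k)) k = 0" using fcoeff_mpow_eq_0[OF N0] by blast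
    ultimately show ?thesis by simp
  qed
  then have "N ** ?S = ?S - mat 1" "?S ** N = ?S - mat 1"
    by (auto intro!: fps_matrix_eqI simp: fcoeff_mult_series_mat[OF N0] fcoeff_series_mat)
  then have "A ** ?S = mat 1" "?S ** A = mat 1"
    by (auto simp: N_def matrix_diff_ldistrib matrix_diff_rdistrib)
  then show ?thesis unfolding invertible_def by blast
qed

lemma fps_mat_exp_msmult:
  "fps_mat_exp (msmult (fps_const t) X) = series_mat (\<lambda>m. t ^ m / fact m) X"
  by (simp add: fps_mat_exp_def series_mat_def mpow_msmult fps_const_power)

lemma fcoeff_fps_mat_exp_0: "fcoeff (fps_mat_exp X) 0 = mat 1"
  by (rule matrix_eqI) (simp add: fps_mat_exp_def mat_nth)

lemma fps_mat_exp_zero: "fps_mat_exp (msmult (fps_const 0) X) = mat 1"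
proof (rule fps_matrix_eqI)
  fix k
  have "(\<Sum>m\<le>k. msmult (0 ^ m / fact m) (fcoeff (mpow X m) k)) =
      (\<Sum>m\<le>k. if m = 0 then fcoeff (mat 1) k else 0)"
    by (intro sum.cong) (auto simp: power_0_left)
  then show "fcoeff (fps_mat_exp (msmult (fps_const 0) X)) k = fcoeff (mat 1) k"
    unfolding fps_mat_exp_msmult fcoeff_series_mat by simp
qed

lemma fps_mat_exp_has_derivative:
  assumes "fcoeff X 0 = 0"
  shows "((\<lambda>t. fcoeff (fps_mat_exp (msmult (fps_const t) X)) k $ i $ j) has_field_derivative
     fcoeff (X ** fps_mat_exp (msmult (fps_const t) X)) k $ i $ j) (at t)"
proof -
  let ?c = "\<lambda>m. fcoeff (mpow X m) k $ i $ j"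
  have "((\<lambda>t. \<Sum>m\<le>k. t ^ m / fact m * ?c m) has_field_derivative
      (\<Sum>m\<le>k. of_nat m * t ^ (m - 1) / fact m * ?c m)) (at t)"
    by (rule DERIV_sum) (auto intro!: derivative_eq_intros simp: field_simps)
  \<comment> \<open>Differentiation lowers the exponent. The sum is first extended by
    \<open>m = Suc k\<close>, whose coefficient at index \<open>k\<close> is zero, and then shifted
    down.\<close>
  moreover have "(\<Sum>m\<le>k. of_nat m * t ^ (m - 1) / fact m * ?c m) = (\<Sum>m\<le>k. t ^ m / fact m * ?c (Suc m))"
  proof -
    let ?f = "\<lambda>m. of_nat m * t ^ (m - 1) / fact m * ?c m"
    have c: "of_nat (Suc m) * t ^ (Suc m - 1) / fact (Suc m) = t ^ m / fact m" for m
      by (simp del: of_nat_Suc add: fact_Suc)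
    have "?f (Suc k) = 0" using fcoeff_mpow_eq_0[OF assms, of k "Suc k"] by simp
    then have "(\<Sum>m\<le>k. ?f m) = (\<Sum>m\<le>Suc k. ?f m)" by (simp only: sum.atMost_Suc add_0_right)
    also have "\<dots> = ?f 0 + (\<Sum>m\<le>k. ?f (Suc m))" by (rule sum.atMost_Suc_shift)
    also have "?f 0 = 0" by simp
    finally show ?thesis by (simp only: c add_0)
  qed
  ultimately show ?thesis
    by (simp add: fps_mat_exp_msmult fcoeff_mult_series_mat[OF assms] fcoeff_series_mat del: fcoeff_nth)
qed

lemma fcoeff_mult_const_has_derivative:
  fixes A B :: "complex fps^'n^'n" and M :: "complex \<Rightarrow> complex fps^'n^'n"
  assumes "\<And>k i j. ((\<lambda>t. fcoeff (M t) k $ i $ j) has_field_derivative fcoeff M' k $ i $ j) (at t)"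
  shows "((\<lambda>t. fcoeff (A ** M t ** B) k $ i $ j) has_field_derivative fcoeff (A ** M' ** B) k $ i $ j) (at t)"
proof -
  have 1: "((\<lambda>t. fcoeff (A ** M t) k $ i $ j) has_field_derivative fcoeff (A ** M') k $ i $ j) (at t)" for k i j
    unfolding fcoeff_mult matrix_sum_nth matrix_mult_nth
    by (intro DERIV_sum DERIV_cmult assms)
  show ?thesis
    unfolding fcoeff_mult[of "A ** M _"] fcoeff_mult[of "A ** M'"] matrix_sum_nth matrix_mult_nth[of "fcoeff (A ** M _) _"]
      matrix_mult_nth[of "fcoeff (A ** M') _"]
    by (intro DERIV_sum DERIV_cmult_right 1)
qed

lemma negative_loop_algebra_iff:
  "X \<in> negative_loop_algebra G \<longleftrightarrow> (\<forall>k. fcoeff X k \<in> lie_algebra G) \<and> fcoeff X 0 = 0"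
proof -
  have *: "zcoeff (fls_mat X) k = (if k \<le> 0 then fcoeff X (nat (- k)) else 0)" for k
    by (rule matrix_eqI) (simp add: zcoeff_def fls_mat_def)
  have "(\<forall>k. zcoeff (fls_mat X) k \<in> lie_algebra G) \<longleftrightarrow> (\<forall>k. fcoeff X k \<in> lie_algebra G)"
  proof
    assume a: "\<forall>k. zcoeff (fls_mat X) k \<in> lie_algebra G"
    show "\<forall>k. fcoeff X k \<in> lie_algebra G"
    proof
      fix k show "fcoeff X k \<in> lie_algebra G" using a[rule_format, of "- int k"] by (simp add: *)
    qed
  qed (simp add: *)
  then show ?thesis by (simp add: negative_loop_algebra_def loop_algebra_def *[of 0])
qed

text \<open>
  Along the flow \<open>A' = Y A\<close> a coefficient of an equation \<open>p\<close> of \<open>G\<close> has as its derivative a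
  combination of coefficients of smaller index of other equations of \<open>G\<close>.
\<close>

lemma flow_in_power_series_group:
  fixes A :: "complex \<Rightarrow> complex fps^'n^'n"
  assumes G: "algebraic_group G" and \<kappa>: "invariant_pairing G \<kappa>"
    and Y: "Y \<in> negative_loop_algebra G"
    and deriv: "\<And>t k i j. ((\<lambda>t. fcoeff (A t) k $ i $ j) has_field_derivative fcoeff (Y ** A t) k $ i $ j) (at t)"
    and A0: "\<And>p. p \<in> vanishing_ideal G \<Longrightarrow> meval fps_const (A 0) p = 0"
    and p: "p \<in> vanishing_ideal G"
  shows "meval fps_const (A t) p = 0"
proof -
  obtain d e e' where db: "dual_bases G \<kappa> d e e'" using dual_bases_exist[OF \<kappa>] .
  have L: "e \<alpha> \<in> lie_algebra G" "e' \<alpha> \<in> lie_algebra G" if "\<alpha> < d" for \<alpha>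
    using db that by (auto simp: dual_bases_def)
  have YL: "fcoeff Y k \<in> lie_algebra G" "fcoeff Y 0 = 0" for k
    using Y by (auto simp: negative_loop_algebra_iff)
  \<comment> \<open>The coordinates of \<open>Y\<close> are power series without constant term,
    while the \<open>e \<alpha>\<close> are constant matrices: the flow is a combination of the
    vector fields of \<open>lie_deriv\<close> with such coefficients.\<close>
  define y where "y = (\<lambda>\<alpha>. Abs_fps (\<lambda>k. \<kappa> (fcoeff Y k) (e' \<alpha>)))"
  have Ysum: "Y = (\<Sum>\<alpha><d. msmult (y \<alpha>) (cmat fps_const (e \<alpha>)))"
  proof (rule fps_matrix_eqI)
    fix k
    have "fcoeff (msmult (y \<alpha>) (cmat fps_const (e \<alpha>))) k = msmult (fps_nth (y \<alpha>) k) (e \<alpha>)" for \<alpha>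
      by (rule matrix_eqI) simp
    then show "fcoeff Y k = fcoeff (\<Sum>\<alpha><d. msmult (y \<alpha>) (cmat fps_const (e \<alpha>))) k"
      using dual_bases_expand[OF \<kappa> db YL(1)] by (simp add: y_def)
  qed
  have der: "((\<lambda>t. fps_nth (meval fps_const (A t) p) k) has_field_derivative
      (\<Sum>\<alpha><d. fps_nth (y \<alpha> * meval fps_const (A t) (lie_deriv (e \<alpha>) p)) k)) (at t)" for p k t
  proof -
    have ent: "((\<lambda>t. fps_nth (entries (A t) v) k) has_field_derivative fps_nth (entries (Y ** A t) v) k) (at t)" for v k
      using deriv[where t = t and k = k] by (cases v) simp
    have "((\<lambda>t. fps_nth (meval fps_const (A t) p) k) has_field_derivative
        fps_nth (pder fps_const (entries (A t)) (entries (Y ** A t)) p) k) (at t)"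
      unfolding meval_def using ent by (intro peval_fps_has_derivative) auto
    moreover have "entries (Y ** A t) = (\<lambda>v. \<Sum>\<alpha><d. y \<alpha> * entries (cmat fps_const (e \<alpha>) ** A t) v)"
      by (rule ext) (simp add: Ysum matrix_sum_left msmult_mult_left split_beta)
    ultimately show ?thesis
      by (simp add: pder_sum pder_cmult meval_lie_deriv fps_sum_nth)
  qed
  have "fps_nth (meval fps_const (A t) p) k = 0" if "p \<in> vanishing_ideal G" for k t p
    using that
  proof (induction k arbitrary: p t rule: less_induct)
    case (less k)
    have "fps_nth (y \<alpha> * meval fps_const (A t) (lie_deriv (e \<alpha>) p)) k = 0" if "\<alpha> < d" for \<alpha> t
    proof -
      have "fps_nth (y \<alpha>) a * fps_nth (meval fps_const (A t) (lie_deriv (e \<alpha>) p)) (k - a) = 0" if "a \<le> k" for a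
      proof (cases "a = 0")
        case True
        then show ?thesis using YL(2) pairing_zero[OF \<kappa> L(2)[OF \<open>\<alpha> < d\<close>]] by (simp add: y_def)
      next
        case False
        then show ?thesis
          using less.IH[of "k - a"] vanishing_ideal_lie_deriv[OF G L(1)[OF \<open>\<alpha> < d\<close>] less.prems] that by simp
      qed
      then show ?thesis unfolding fps_mult_nth by (intro sum.neutral) auto
    qed
    then have "((\<lambda>t. fps_nth (meval fps_const (A t) p) k) has_field_derivative 0) (at t)" for t
      using der[of p k t] by simp
    then obtain c where "\<And>t. fps_nth (meval fps_const (A t) p) k = c"
      using has_field_derivative_zero_constant[of UNIV "\<lambda>t. fps_nth (meval fps_const (A t) p) k"] by auto
    then show ?case using A0[OF less.prems] by (metis fps_zero_nth)
  qed
  then show ?thesis using p by (simp add: fps_eq_iff)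
qed

lemma G1_iff: "A \<in> G1 G \<longleftrightarrow> fcoeff A 0 = mat 1 \<and> (\<forall>p\<in>vanishing_ideal G. meval fps_const A p = 0)"
  using invertible_fps_matrix[of A]
  by (auto simp: G1_def power_series_group_def fcoeff_def)

lemma fcoeff_mult_0: "fcoeff (A ** B) 0 = fcoeff A 0 ** fcoeff B 0"
  by (simp add: fcoeff_mult)

text \<open>Right multiplication by the exponential of \<open>X\<close> is the left flow of the
  conjugate \<open>h ** X ** h'\<close>, hence the inverse \<open>h'\<close> in the second claim.
  Both claims allow a regular function to be replaced by its polynomial along exponential
  curves.\<close>

lemma fps_mat_exp_in_G1:
  assumes G: "algebraic_group G" and \<kappa>: "invariant_pairing G \<kappa>"
    and X: "X \<in> negative_loop_algebra G" and h: "h \<in> G1 G"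
  shows "fps_mat_exp (msmult (fps_const t) X) ** h \<in> G1 G"
    and "h ** h' = mat 1 \<Longrightarrow> h' ** h = mat 1 \<Longrightarrow> h ** X ** h' \<in> negative_loop_algebra G \<Longrightarrow>
      h ** fps_mat_exp (msmult (fps_const t) X) \<in> G1 G"
proof -
  let ?E = "\<lambda>t. fps_mat_exp (msmult (fps_const t) X)"
  have X0: "fcoeff X 0 = 0" using X by (simp add: negative_loop_algebra_iff)
  note dE = fps_mat_exp_has_derivative[OF X0]
  have "((\<lambda>t. fcoeff (mat 1 ** ?E t ** h) k $ i $ j) has_field_derivative
      fcoeff (mat 1 ** (X ** ?E t) ** h) k $ i $ j) (at t)" for t k i j
    by (rule fcoeff_mult_const_has_derivative[OF dE])
  then have d: "((\<lambda>t. fcoeff (?E t ** h) k $ i $ j) has_field_derivative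
      fcoeff (X ** (?E t ** h)) k $ i $ j) (at t)" for t k i j
    by (simp add: matrix_mul_assoc)
  have "meval fps_const (?E t ** h) p = 0" if "p \<in> vanishing_ideal G" for p
    by (rule flow_in_power_series_group[OF G \<kappa> X d _ that])
       (use h in \<open>simp add: fps_mat_exp_zero[simplified] G1_iff\<close>)
  then show "?E t ** h \<in> G1 G"
    using h by (simp add: G1_iff fcoeff_mult_0 fcoeff_fps_mat_exp_0)
  assume inv: "h ** h' = mat 1" "h' ** h = mat 1" and neg: "h ** X ** h' \<in> negative_loop_algebra G"
  have "((\<lambda>t. fcoeff (h ** ?E t ** mat 1) k $ i $ j) has_field_derivative
      fcoeff (h ** (X ** ?E t) ** mat 1) k $ i $ j) (at t)" for t k i j
    by (rule fcoeff_mult_const_has_derivative[OF dE])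
  moreover have "h ** (X ** ?E t) ** mat 1 = h ** X ** h' ** (h ** ?E t)" for t
    using inv(2) by (metis matrix_mul_assoc matrix_mul_lid matrix_mul_rid)
  ultimately have d: "((\<lambda>t. fcoeff (h ** ?E t) k $ i $ j) has_field_derivative
      fcoeff (h ** X ** h' ** (h ** ?E t)) k $ i $ j) (at t)" for t k i j
    by simp
  have "meval fps_const (h ** ?E t) p = 0" if "p \<in> vanishing_ideal G" for p
    by (rule flow_in_power_series_group[OF G \<kappa> neg d _ that])
       (use h in \<open>simp add: fps_mat_exp_zero[simplified] G1_iff\<close>)
  then show "h ** ?E t \<in> G1 G"
    using h by (simp add: G1_iff fcoeff_mult_0 fcoeff_fps_mat_exp_0)
qed

section \<open>Holomorphic matrix functions, the exponential, and curves of group-valued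
  maps\<close>

section \<open>Matrix-valued functions\<close>

definition mat_holo :: "(complex \<Rightarrow> complex^'n^'m) \<Rightarrow> complex set \<Rightarrow> bool" where
  "mat_holo F S \<longleftrightarrow> (\<forall>i j. (\<lambda>z. F z $ i $ j) holomorphic_on S)"

lemma mat_holoD: "mat_holo F S \<Longrightarrow> (\<lambda>z. F z $ i $ j) holomorphic_on S"
  by (simp add: mat_holo_def)

lemma mat_holo_entries: "mat_holo F S \<Longrightarrow> (\<lambda>z. entries (F z) v) holomorphic_on S"
  by (cases v) (simp add: mat_holo_def)

lemma mat_holo_const: "mat_holo (\<lambda>z. A) S"
  by (simp add: mat_holo_def)

lemma mat_holo_add: "mat_holo F S \<Longrightarrow> mat_holo H S \<Longrightarrow> mat_holo (\<lambda>z. F z + H z) S"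
  and mat_holo_diff: "mat_holo F S \<Longrightarrow> mat_holo H S \<Longrightarrow> mat_holo (\<lambda>z. F z - H z) S"
  and mat_holo_minus: "mat_holo F S \<Longrightarrow> mat_holo (\<lambda>z. - F z) S"
  by (auto simp: mat_holo_def intro!: holomorphic_intros)

lemma mat_holo_msmult: "f holomorphic_on S \<Longrightarrow> mat_holo F S \<Longrightarrow> mat_holo (\<lambda>z. msmult (f z) (F z)) S"
  by (auto simp: mat_holo_def intro!: holomorphic_intros)

lemma mat_holo_sum: "(\<And>x. x \<in> A \<Longrightarrow> mat_holo (F x) S) \<Longrightarrow> mat_holo (\<lambda>z. \<Sum>x\<in>A. F x z) S"
  by (auto simp: mat_holo_def intro!: holomorphic_intros)

lemma mat_holo_mult: "mat_holo F S \<Longrightarrow> mat_holo H S \<Longrightarrow> mat_holo (\<lambda>z. F z ** H z) S"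
  by (auto simp: mat_holo_def matrix_mult_nth intro!: holomorphic_intros)

lemma mat_holo_subset: "mat_holo F S \<Longrightarrow> T \<subseteq> S \<Longrightarrow> mat_holo F T"
  by (auto simp: mat_holo_def intro: holomorphic_on_subset)

lemma mat_holo_cong: "(\<And>z. z \<in> S \<Longrightarrow> F z = H z) \<Longrightarrow> mat_holo F S \<longleftrightarrow> mat_holo H S"
  by (simp add: mat_holo_def cong: holomorphic_cong)

lemma mat_holo_inv:
  fixes F :: "complex \<Rightarrow> complex^'n^'n"
  assumes "mat_holo F S" "\<And>z. z \<in> S \<Longrightarrow> invertible (F z)"
  shows "mat_holo (\<lambda>z. matrix_inv (F z)) S"
  unfolding mat_holo_def
proof (intro allI)
  fix i j
  have "(\<lambda>z. if l = i then mat 1 $ k $ j else F z $ k $ l) holomorphic_on S" for k l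
    by (cases "l = i") (auto intro: mat_holoD[OF assms(1)])
  then have "(\<lambda>z. det (\<chi> k l. if l = i then mat 1 $ k $ j else F z $ k $ l) / det (F z)) holomorphic_on S"
    unfolding det_def using assms(2)
    by (intro holomorphic_intros)
       (auto simp: det_def[symmetric] invertible_det_nz[symmetric] intro: mat_holoD[OF assms(1)])
  also have "?this \<longleftrightarrow> (\<lambda>z. matrix_inv (F z) $ i $ j) holomorphic_on S"
    by (intro holomorphic_cong refl) (simp add: matrix_inv_nth assms(2))
  finally show "(\<lambda>z. matrix_inv (F z) $ i $ j) holomorphic_on S" .
qed

lemma entry_le_norm: "norm (A $ i $ j) \<le> norm A"
  using Finite_Cartesian_Product.norm_nth_le[of "A $ i" j] Finite_Cartesian_Product.norm_nth_le[of A i] by linarith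

lemma norm_le_entries:
  fixes A :: "complex^'n^'m"
  assumes "\<And>i j. norm (A $ i $ j) \<le> M"
  shows "norm A \<le> of_nat (CARD('m) * CARD('n)) * M"
proof -
  have "norm (A $ i) \<le> of_nat CARD('n) * M" for i
  proof -
    have "norm (A $ i) \<le> (\<Sum>j\<in>UNIV. norm (A $ i $ j))" unfolding norm_vec_def by (rule L2_set_le_sum) simp
    also have "\<dots> \<le> (\<Sum>j\<in>(UNIV :: 'n set). M)" by (rule sum_mono) (rule assms)
    finally show ?thesis by simp
  qed
  note row = this
  have "norm A \<le> (\<Sum>i\<in>UNIV. norm (A $ i))" unfolding norm_vec_def[of A] by (rule L2_set_le_sum) simp
  also have "\<dots> \<le> (\<Sum>i\<in>(UNIV :: 'm set). of_nat CARD('n) * M)" by (rule sum_mono) (rule row)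
  finally show ?thesis by simp
qed

lemma mat_tendsto_iff: "(F \<longlongrightarrow> A) net \<longleftrightarrow> (\<forall>i j. ((\<lambda>z. F z $ i $ j) \<longlongrightarrow> A $ i $ j) net)"
proof
  assume "(F \<longlongrightarrow> A) net"
  then show "\<forall>i j. ((\<lambda>z. F z $ i $ j) \<longlongrightarrow> A $ i $ j) net"
    by (intro allI) (rule tendsto_vec_nth[OF tendsto_vec_nth])
next
  assume "\<forall>i j. ((\<lambda>z. F z $ i $ j) \<longlongrightarrow> A $ i $ j) net"
  then show "(F \<longlongrightarrow> A) net" by (intro vec_tendstoI) auto
qed

lemma continuous_on_componentwise_mat:
  "continuous_on S F \<longleftrightarrow> (\<forall>i j. continuous_on S (\<lambda>z. F z $ i $ j))"
  by (auto simp: continuous_on_def mat_tendsto_iff)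

lemma mat_tendsto_mult:
  fixes F :: "_ \<Rightarrow> complex^'n^'m" and H :: "_ \<Rightarrow> complex^'k^'n"
  assumes "(F \<longlongrightarrow> A) net" "(H \<longlongrightarrow> B) net"
  shows "((\<lambda>z. F z ** H z) \<longlongrightarrow> A ** B) net"
  using assms unfolding mat_tendsto_iff matrix_mult_nth by (intro allI tendsto_sum tendsto_mult) auto

lemma mat_tendsto_inv:
  fixes F :: "_ \<Rightarrow> complex^'n^'n"
  assumes "(F \<longlongrightarrow> A) net" "invertible A" "eventually (\<lambda>z. invertible (F z)) net"
  shows "((\<lambda>z. matrix_inv (F z)) \<longlongrightarrow> matrix_inv A) net"
  unfolding mat_tendsto_iff
proof (intro allI)
  fix i j
  have F: "((\<lambda>z. F z $ k $ l) \<longlongrightarrow> A $ k $ l) net" for k l using assms(1) by (simp add: mat_tendsto_iff)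
  have "((\<lambda>z. if l = i then mat 1 $ k $ j else F z $ k $ l) \<longlongrightarrow> (if l = i then mat 1 $ k $ j else A $ k $ l)) net" for k l
    using F by simp
  then have "((\<lambda>z. det (\<chi> k l. if l = i then mat 1 $ k $ j else F z $ k $ l) / det (F z)) \<longlongrightarrow>
      det (\<chi> k l. if l = i then mat 1 $ k $ j else A $ k $ l) / det A) net"
    using assms(2) unfolding det_def
    by (intro tendsto_divide tendsto_sum tendsto_mult tendsto_prod tendsto_const)
       (auto simp: det_def[symmetric] invertible_det_nz[symmetric] intro!: F)
  then have "((\<lambda>z. det (\<chi> k l. if l = i then mat 1 $ k $ j else F z $ k $ l) / det (F z)) \<longlongrightarrow>
      matrix_inv A $ i $ j) net"
    by (simp add: matrix_inv_nth assms(2))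
  then show "((\<lambda>z. matrix_inv (F z) $ i $ j) \<longlongrightarrow> matrix_inv A $ i $ j) net"
    by (rule Lim_transform_eventually) (use assms(3) in eventually_elim, simp add: matrix_inv_nth)
qed

section \<open>The matrix exponential\<close>

definition mexp :: "complex^'n^'n \<Rightarrow> complex^'n^'n" where
  "mexp X = (\<chi> i j. \<Sum>m. mpow X m $ i $ j / fact m)"

lemma norm_mpow_le:
  fixes X :: "complex^'n^'n"
  shows "norm (mpow X m $ i $ j) \<le> (CARD('n) * norm X) ^ m"
proof (induction m arbitrary: i j)
  case (Suc m)
  have "norm (mpow X (Suc m) $ i $ j) \<le> (\<Sum>k\<in>UNIV. norm (X $ i $ k * mpow X m $ k $ j))"
    unfolding mpow_Suc matrix_mult_nth by (rule norm_sum)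
  also have "\<dots> \<le> (\<Sum>k\<in>(UNIV :: 'n set). norm X * (CARD('n) * norm X) ^ m)"
    unfolding norm_mult by (intro sum_mono mult_mono entry_le_norm Suc) auto
  finally show ?case by simp
qed (simp add: mat_nth)

lemma norm_mexp_term_le:
  fixes X :: "complex^'n^'n"
  shows "norm (mpow X m $ i $ j / fact m) \<le> (CARD('n) * norm X) ^ m / fact m"
  by (simp add: norm_divide divide_right_mono norm_mpow_le)

lemma summable_mexp: "summable (\<lambda>m. mpow X m $ i $ j / fact m)" for X :: "complex^'n^'n"
proof (rule summable_comparison_test')
  show "summable (\<lambda>m. (CARD('n) * norm X) ^ m / fact m)"
    using summable_exp[of "CARD('n) * norm X"] by (simp add: field_simps)
qed (rule norm_mexp_term_le)

lemma mexp_nth: "mexp X $ i $ j = (\<Sum>m. mpow X m $ i $ j / fact m)"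
  by (simp add: mexp_def)

lemma mult_mexp_nth:
  fixes X :: "complex^'n^'n"
  shows "(A ** mexp X) $ i $ j = (\<Sum>m. (A ** mpow X m) $ i $ j / fact m)"
    and "(mexp X ** A) $ i $ j = (\<Sum>m. (mpow X m ** A) $ i $ j / fact m)"
proof -
  have "(\<Sum>m. (A ** mpow X m) $ i $ j / fact m) = (\<Sum>m. \<Sum>k\<in>UNIV. A $ i $ k * (mpow X m $ k $ j / fact m))"
    by (simp add: matrix_mult_nth sum_divide_distrib)
  also have "\<dots> = (\<Sum>k\<in>UNIV. \<Sum>m. A $ i $ k * (mpow X m $ k $ j / fact m))"
    by (rule suminf_sum) (intro summable_mult summable_mexp)
  also have "\<dots> = (A ** mexp X) $ i $ j"
    by (simp only: matrix_mult_nth mexp_nth suminf_mult[OF summable_mexp])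
  finally show "(A ** mexp X) $ i $ j = (\<Sum>m. (A ** mpow X m) $ i $ j / fact m)" by simp
  have "(\<Sum>m. (mpow X m ** A) $ i $ j / fact m) = (\<Sum>m. \<Sum>k\<in>UNIV. mpow X m $ i $ k / fact m * A $ k $ j)"
    by (simp add: matrix_mult_nth sum_divide_distrib)
  also have "\<dots> = (\<Sum>k\<in>UNIV. \<Sum>m. mpow X m $ i $ k / fact m * A $ k $ j)"
    by (rule suminf_sum) (intro summable_mult2 summable_mexp)
  also have "\<dots> = (mexp X ** A) $ i $ j"
    by (simp only: matrix_mult_nth mexp_nth suminf_mult2[OF summable_mexp, symmetric])
  finally show "(mexp X ** A) $ i $ j = (\<Sum>m. (mpow X m ** A) $ i $ j / fact m)" by simp
qed

lemma mexp_msmult_commute: "X ** mexp (msmult t X) = mexp (msmult t X) ** X"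
  by (rule matrix_eqI)
     (simp only: mult_mexp_nth mpow_msmult msmult_mult_left msmult_mult_right mpow_commute)

lemma mexp_zero [simp]: "mexp (0 :: complex^'n^'n) = mat 1"
proof (rule matrix_eqI)
  fix i j :: 'n
  have "mpow (0 :: complex^'n^'n) m $ i $ j / fact m = (if m = 0 then mat 1 $ i $ j else 0)" for m
    by (cases m) (simp_all add: mpow_Suc)
  then show "mexp (0 :: complex^'n^'n) $ i $ j = mat 1 $ i $ j"
    using suminf_finite[of "{0}" "\<lambda>m. mpow (0 :: complex^'n^'n) m $ i $ j / fact m"] by (simp add: mexp_nth)
qed

lemma mexp_has_derivative:
  fixes X :: "complex^'n^'n"
  shows "((\<lambda>t. mexp (msmult t X) $ i $ j) has_field_derivative (X ** mexp (msmult t X)) $ i $ j) (at t)"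
proof -
  let ?c = "\<lambda>m. mpow X m $ i $ j / fact m"
  have eq: "mpow (msmult t X) m $ i $ j / fact m = ?c m * t ^ m" for m t
    by (simp add: mpow_msmult)
  have "summable (\<lambda>m. ?c m * t ^ m)" for t
    using summable_mexp[of "msmult t X" i j] by (simp only: eq)
  then have "((\<lambda>t. \<Sum>m. ?c m * t ^ m) has_field_derivative (\<Sum>m. diffs ?c m * t ^ m)) (at t)"
    by (rule termdiffs_strong_converges_everywhere)
  moreover have "diffs ?c m * t ^ m = (X ** mpow (msmult t X) m) $ i $ j / fact m" for m
    by (simp add: diffs_def mpow_msmult msmult_mult_right mpow_Suc fact_Suc del: of_nat_Suc)
  ultimately show ?thesis by (simp add: mult_mexp_nth(1)) (simp add: mexp_nth eq)
qed

text \<open>\<open>X\<close> commutes with its exponential, so the product has derivative zero in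
  \<open>t\<close> and keeps its value at 0; no product of series has to be formed.\<close>

lemma mexp_minus: "mexp (msmult (- t) X) ** mexp (msmult t X) = mat 1"
proof (rule matrix_eqI)
  fix i j
  let ?f = "\<lambda>t. (mexp (msmult (- t) X) ** mexp (msmult t X)) $ i $ j"
  have minus: "((\<lambda>t. mexp (msmult (- t) X) $ i $ k) has_field_derivative
      - (X ** mexp (msmult (- t) X)) $ i $ k) (at t)" for t k
  proof -
    have "((\<lambda>t. mexp (msmult (- t) X) $ i $ k) has_field_derivative
        (X ** mexp (msmult (- t) X)) $ i $ k * (- 1)) (at t)"
      by (rule DERIV_chain2[where f = "\<lambda>s. mexp (msmult s X) $ i $ k" and g = uminus])
         (auto intro!: derivative_eq_intros mexp_has_derivative)
    then show ?thesis by simp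
  qed
  have "(?f has_field_derivative (\<Sum>k\<in>UNIV.
      - (X ** mexp (msmult (- t) X)) $ i $ k * mexp (msmult t X) $ k $ j +
      mexp (msmult (- t) X) $ i $ k * (X ** mexp (msmult t X)) $ k $ j)) (at t)" for t
    unfolding matrix_mult_nth[of "mexp _" "mexp _"]
    by (rule DERIV_sum)
       (rule DERIV_cong[OF DERIV_mult[OF minus mexp_has_derivative]], simp)
  moreover have "(\<Sum>k\<in>UNIV.
      - (X ** mexp (msmult (- t) X)) $ i $ k * mexp (msmult t X) $ k $ j +
      mexp (msmult (- t) X) $ i $ k * (X ** mexp (msmult t X)) $ k $ j) =
      - (X ** mexp (msmult (- t) X) ** mexp (msmult t X)) $ i $ j
      + (mexp (msmult (- t) X) ** (X ** mexp (msmult t X))) $ i $ j" for t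
    by (simp only: matrix_mult_nth[of "X ** mexp _"] matrix_mult_nth[of "mexp _" "X ** mexp _"]
      sum.distrib mult_minus_left sum_negf)
  moreover have "X ** mexp (msmult (- t) X) ** mexp (msmult t X) =
      mexp (msmult (- t) X) ** (X ** mexp (msmult t X))" for t
    by (simp only: mexp_msmult_commute[of X "- t"] matrix_mul_assoc)
  ultimately have "(?f has_field_derivative 0) (at t)" for t by simp
  then obtain c where c: "\<And>t. ?f t = c"
    using has_field_derivative_zero_constant[of UNIV ?f] by auto
  then show "?f t = mat 1 $ i $ j" using c[of 0] by simp
qed

lemma invertible_mexp: "invertible (mexp X)"
  using mexp_minus[of 1 X] mexp_minus[of "-1" X] unfolding invertible_def by auto

text \<open>The left side is the sum of the terms with \<open>m \<ge> 2\<close>, where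
  \<open>norm t ^ m \<le> (norm t)\<^sup>2\<close>. The bound depends on \<open>X\<close> only
  through \<open>b\<close>, which gives uniform difference quotients where the norm of
  \<open>X\<close> is bounded.\<close>

lemma mexp_tail_bound:
  fixes X :: "complex^'n^'n"
  assumes "CARD('n) * norm X \<le> b" "norm t \<le> 1"
  shows "norm (mexp (msmult t X) $ i $ j - mat 1 $ i $ j - t * X $ i $ j) \<le> (norm t)\<^sup>2 * exp b"
proof -
  let ?f = "\<lambda>m. mpow (msmult t X) m $ i $ j / fact m"
  let ?g = "\<lambda>m. (norm t)\<^sup>2 * (b ^ m / fact m)"
  have b: "0 \<le> b" using assms(1) by (meson mult_nonneg_nonneg norm_ge_zero of_nat_0_le_iff order_trans)
  have sb: "(\<lambda>m. b ^ m / fact m) sums exp b"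
    using exp_converges[of b] by (simp add: field_simps)
  have "mexp (msmult t X) $ i $ j = (\<Sum>m. ?f (m + 2)) + (\<Sum>m<2. ?f m)"
    unfolding mexp_nth by (rule suminf_split_initial_segment[OF summable_mexp])
  then have eq: "mexp (msmult t X) $ i $ j - mat 1 $ i $ j - t * X $ i $ j = (\<Sum>m. ?f (m + 2))"
    by (simp add: numeral_2_eq_2 mpow_Suc)
  have le: "norm (?f (m + 2)) \<le> (norm t)\<^sup>2 * (b ^ (m + 2) / fact (m + 2))" for m
  proof -
    have "norm (?f (m + 2)) = norm t ^ (m + 2) * (norm (mpow X (m + 2) $ i $ j) / fact (m + 2))"
      by (simp only: mpow_msmult msmult_nth norm_divide norm_mult norm_power norm_fact times_divide_eq_right)
    also have "\<dots> \<le> (norm t)\<^sup>2 * (b ^ (m + 2) / fact (m + 2))"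
    proof (intro mult_mono divide_right_mono)
      show "norm t ^ (m + 2) \<le> (norm t)\<^sup>2" using assms(2) by (intro power_decreasing) auto
      have "norm (mpow X (m + 2) $ i $ j) \<le> (CARD('n) * norm X) ^ (m + 2)" by (rule norm_mpow_le)
      also have "\<dots> \<le> b ^ (m + 2)" using assms(1) by (intro power_mono) auto
      finally show "norm (mpow X (m + 2) $ i $ j) \<le> b ^ (m + 2)" .
    qed auto
    finally show ?thesis .
  qed
  have sg: "summable (\<lambda>m. b ^ (m + 2) / fact (m + 2))"
    using sums_summable[OF sb] by (rule summable_ignore_initial_segment)
  have "norm (\<Sum>m. ?f (m + 2)) \<le> (\<Sum>m. (norm t)\<^sup>2 * (b ^ (m + 2) / fact (m + 2)))"
    by (rule norm_suminf_le[OF le]) (intro summable_mult sg)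
  also have "\<dots> = (norm t)\<^sup>2 * (\<Sum>m. b ^ (m + 2) / fact (m + 2))" by (rule suminf_mult[OF sg])
  also have "\<dots> \<le> (norm t)\<^sup>2 * exp b"
  proof (rule mult_left_mono)
    have "exp b = (\<Sum>m. b ^ (m + 2) / fact (m + 2)) + (\<Sum>m<2. b ^ m / fact m)"
      using suminf_split_initial_segment[OF sums_summable[OF sb], of 2] sums_unique[OF sb] by simp
    moreover have "0 \<le> (\<Sum>m<2. b ^ m / fact m)" using b by (intro sum_nonneg) auto
    ultimately show "(\<Sum>m. b ^ (m + 2) / fact (m + 2)) \<le> exp b" by simp
  qed auto
  finally show ?thesis by (simp only: eq)
qed

lemma mexp_holo:
  fixes X :: "complex \<Rightarrow> complex^'n^'n"
  assumes "open S" "mat_holo X S"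
  shows "mat_holo (\<lambda>z. mexp (X z)) S"
  unfolding mat_holo_def mexp_nth
proof (intro allI)
  fix i j
  have pow: "mat_holo (\<lambda>z. mpow (X z) m) S" for m
    by (induction m) (auto simp: mpow_Suc intro: mat_holo_const mat_holo_mult assms)
  show "(\<lambda>z. \<Sum>m. mpow (X z) m $ i $ j / fact m) holomorphic_on S"
  proof (rule holomorphic_uniform_sequence[OF assms(1)])
    show "(\<lambda>z. \<Sum>m<N. mpow (X z) m $ i $ j / fact m) holomorphic_on S" for N
      by (intro holomorphic_intros mat_holoD[OF pow]) auto
    fix x assume "x \<in> S"
    then obtain d where d: "0 < d" "cball x d \<subseteq> S" using assms(1) open_contains_cball by blast
    have "continuous_on (cball x d) X"
      unfolding continuous_on_componentwise_mat
      by (intro allI holomorphic_on_imp_continuous_on holomorphic_on_subset[OF mat_holoD[OF assms(2)] d(2)])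
    then have "bounded (X ` cball x d)" by (intro compact_imp_bounded compact_continuous_image) auto
    then obtain M where M: "\<And>z. z \<in> cball x d \<Longrightarrow> norm (X z) \<le> M" unfolding bounded_iff by blast
    have "uniform_limit (cball x d) (\<lambda>N z. \<Sum>m<N. mpow (X z) m $ i $ j / fact m)
       (\<lambda>z. \<Sum>m. mpow (X z) m $ i $ j / fact m) sequentially"
    proof (rule Weierstrass_m_test)
      show "summable (\<lambda>m. (CARD('n) * M) ^ m / fact m)"
        using summable_exp[of "CARD('n) * M"] by (simp add: field_simps)
      fix m z assume z: "z \<in> cball x d"
      have "norm (mpow (X z) m $ i $ j / fact m) \<le> (CARD('n) * norm (X z)) ^ m / fact m"
        by (rule norm_mexp_term_le)
      also have "\<dots> \<le> (CARD('n) * M) ^ m / fact m"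
        using M[OF z] by (intro divide_right_mono power_mono mult_left_mono) auto
      finally show "norm (mpow (X z) m $ i $ j / fact m) \<le> (CARD('n) * M) ^ m / fact m" .
    qed
    then show "\<exists>d>0. cball x d \<subseteq> S \<and> uniform_limit (cball x d)
        (\<lambda>N z. \<Sum>m<N. mpow (X z) m $ i $ j / fact m) (\<lambda>z. \<Sum>m. mpow (X z) m $ i $ j / fact m) sequentially"
      using d by blast
  qed
qed

text \<open>For an equation \<open>p\<close> of \<open>G\<close> the function
  \<open>p(exp(t X))\<close> is entire. Its derivatives at 0 are the values at the identity of
  iterated Lie derivatives of \<open>p\<close>, which are again equations of \<open>G\<close>. So it
  vanishes identically, in particular at \<open>t = 1\<close>.\<close>

lemma mexp_in_group:
  assumes G: "algebraic_group G" and X: "X \<in> lie_algebra G"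
  shows "mexp X \<in> G"
proof (rule algebraic_group_memI[OF G invertible_mexp])
  let ?F = "\<lambda>p t. meval (\<lambda>c. c) (mexp (msmult t X)) p"
  have der: "(?F p has_field_derivative ?F (lie_deriv X p) t) (at t)" for p t
  proof -
    have "((\<lambda>t. entries (mexp (msmult t X)) v) has_field_derivative
        entries (X ** mexp (msmult t X)) v) (at t)" for v
      using mexp_has_derivative by (cases v) simp
    then have "(?F p has_field_derivative
        pder (\<lambda>c. c) (entries (mexp (msmult t X))) (entries (X ** mexp (msmult t X))) p) (at t)"
      unfolding meval_def by (intro peval_has_derivative)
    then show ?thesis by (simp add: meval_lie_deriv)
  qed
  have hol: "?F p holomorphic_on UNIV" for p
    using der by (intro holomorphic_onI) (auto simp: field_differentiable_def field_differentiable_at_within)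
  have dn: "(deriv ^^ n) (?F p) = ?F ((lie_deriv X ^^ n) p)" for n p
  proof (induction n)
    case (Suc n)
    have "deriv (?F q) = ?F (lie_deriv X q)" for q
      by (rule ext) (rule DERIV_imp_deriv[OF der])
    then show ?case using Suc by simp
  qed simp
  fix p assume p: "p \<in> vanishing_ideal G"
  have "(lie_deriv X ^^ n) p \<in> vanishing_ideal G" for n
    by (induction n) (auto intro: vanishing_ideal_lie_deriv[OF G X] p)
  then have "(deriv ^^ n) (?F p) 0 = 0" for n
    unfolding dn using algebraic_groupD(1)[OF G] by (simp add: vanishing_ideal_def)
  then have "?F p 1 = 0"
    by (intro holomorphic_fun_eq_0_on_connected[OF hol, where z = 0 and w = 1]) auto
  then show "meval (\<lambda>c. c) (mexp X) p = 0" by simp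
qed

section \<open>Group-valued maps and their infinitesimal deformations\<close>

lemma group_mapsD:
  assumes "g \<in> group_maps G D"
  shows "z \<in> D \<Longrightarrow> g z = 0" "z \<notin> D \<Longrightarrow> g z \<in> G" "mat_holo g (- D)" "(g \<longlongrightarrow> mat 1) at_infinity"
  using assms by (auto simp: group_maps_def mat_holo_def)

text \<open>Velocities are uniform on all closed sets off \<open>D\<close>, which may be unbounded:
  near infinity the limit bounds \<open>f\<close>, and the rest of \<open>K\<close> is
  compact.\<close>

lemma bounded_off_poles:
  fixes f :: "complex \<Rightarrow> complex^'n^'n"
  assumes "mat_holo f (- D)" "(f \<longlongrightarrow> l) at_infinity" "closed K" "K \<inter> D = {}"
  obtains M where "0 < M" "\<And>z. z \<in> K \<Longrightarrow> norm (f z) \<le> M"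
proof -
  have "eventually (\<lambda>z. dist (f z) l < 1) at_infinity" using assms(2) by (rule tendstoD) simp
  then obtain R where R: "\<And>z. R \<le> norm z \<Longrightarrow> dist (f z) l < 1" by (auto simp: eventually_at_infinity)
  have "continuous_on (K \<inter> cball 0 R) f"
    unfolding continuous_on_componentwise_mat using assms(4)
    by (intro allI holomorphic_on_imp_continuous_on holomorphic_on_subset[OF mat_holoD[OF assms(1)]]) auto
  then have "bounded (f ` (K \<inter> cball 0 R))"
    using assms(3) by (intro compact_imp_bounded compact_continuous_image closed_Int_compact) auto
  then obtain M where M: "\<And>z. z \<in> K \<inter> cball 0 R \<Longrightarrow> norm (f z) \<le> M" unfolding bounded_iff by blast
  have "norm (f z) \<le> \<bar>M\<bar> + norm l + 1" if "z \<in> K" for z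
  proof (cases "norm z \<le> R")
    case True
    then have "norm (f z) \<le> M" using M[of z] that by simp
    then show ?thesis using norm_ge_zero[of l] by linarith
  next
    case False
    then have "dist (f z) l < 1" using R[of z] by simp
    then show ?thesis using norm_triangle_ineq2[of "f z" l] by (simp add: dist_norm)
  qed
  then show ?thesis by (intro that[of "\<bar>M\<bar> + norm l + 1"]) (auto simp: add_nonneg_pos)
qed

definition lie_maps ::
  "(complex^'n^'n) set \<Rightarrow> complex set \<Rightarrow> (complex \<Rightarrow> complex^'n^'n) \<Rightarrow> bool" where
  "lie_maps G D \<eta> \<longleftrightarrow> mat_holo \<eta> (- D) \<and> (\<forall>z. z \<notin> D \<longrightarrow> \<eta> z \<in> lie_algebra G) \<and> (\<eta> \<longlongrightarrow> 0) at_infinity"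

text \<open>The curve is \<open>exp(t \<eta>) g\<close>. At a pole of \<open>\<eta>\<close> it may
  acquire an essential singularity, which \<open>group_maps\<close> permits. Its existence keeps the
  condition in \<open>has_differential_value\<close> from being vacuous.\<close>

lemma curve_with_velocity_exists:
  fixes g :: "complex \<Rightarrow> complex^'n^'n"
  assumes G: "algebraic_group G" and D: "finite D" and g: "g \<in> group_maps G D"
    and \<eta>: "lie_maps G D \<eta>" and \<delta>: "\<And>z. z \<in> D \<Longrightarrow> \<delta> z = 0" "\<And>z. z \<notin> D \<Longrightarrow> \<delta> z = \<eta> z ** g z"
  obtains \<gamma> where "curve_with_velocity G D g \<delta> \<gamma>"
proof -
  have \<eta>': "mat_holo \<eta> (- D)" "\<And>z. z \<notin> D \<Longrightarrow> \<eta> z \<in> lie_algebra G" "(\<eta> \<longlongrightarrow> 0) at_infinity"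
    using \<eta> by (auto simp: lie_maps_def)
  note g' = group_mapsD[OF g]
  have op: "open (- D)" using D by (simp add: finite_imp_closed open_Compl)
  define \<gamma> where "\<gamma> = (\<lambda>t z. if z \<in> D then 0 else mexp (msmult t (\<eta> z)) ** g z)"
  have lim: "((\<lambda>z. mexp (msmult t (\<eta> z))) \<longlongrightarrow> mat 1) at_infinity" for t
    unfolding mat_tendsto_iff
  proof (intro allI)
    fix i j :: 'n
    let ?X = "\<lambda>z. msmult t (\<eta> z)"
    let ?b = "of_nat CARD('n) :: real"
    have X: "(?X \<longlongrightarrow> 0) at_infinity"
    proof -
      have "((\<lambda>z. t * \<eta> z $ i $ j) \<longlongrightarrow> t * 0) at_infinity" for i j
        using \<eta>'(3) unfolding mat_tendsto_iff by (intro tendsto_intros) simp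
      then show ?thesis by (simp add: mat_tendsto_iff)
    qed
    have bound: "norm (mexp Y $ i $ j - mat 1 $ i $ j) \<le> norm Y + norm Y * ?b * exp 1" if "?b * norm Y \<le> 1" for Y :: "complex^'n^'n"
    proof (cases "Y = 0")
      case False
      \<comment> \<open>\<open>mexp_tail_bound\<close> is quadratic in the scalar. Writing
        \<open>Y\<close> as \<open>s\<close> times a matrix \<open>Z\<close> with
        \<open>?b * norm Z = 1\<close> turns it into a bound that tends to zero with
        \<open>Y\<close>.\<close>
      define s where "s = ?b * norm Y"
      have s: "0 < s" "s \<le> 1" using False that by (simp_all add: s_def)
      define Z where "Z = msmult (of_real (1 / s)) Y"
      have "Z = (1 / s) *\<^sub>R Y"
        unfolding Z_def by (rule matrix_eqI) (simp add: scaleR_conv_of_real[where 'a = complex])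
      then have "?b * norm Z \<le> 1" using s by (simp add: s_def)
      moreover have "norm (of_real s :: complex) \<le> 1" using s by simp
      ultimately have "norm (mexp (msmult (of_real s) Z) $ i $ j - mat 1 $ i $ j - of_real s * Z $ i $ j)
          \<le> (norm (of_real s :: complex))\<^sup>2 * exp 1"
        by (rule mexp_tail_bound)
      moreover have "msmult (of_real s) Z = Y" "of_real s * Z $ i $ j = Y $ i $ j"
        using s by (simp_all add: Z_def msmult_msmult)
      ultimately have "norm (mexp Y $ i $ j - mat 1 $ i $ j - Y $ i $ j) \<le> s\<^sup>2 * exp 1" using s by simp
      also have "\<dots> \<le> s * exp 1"
        using s by (intro mult_right_mono) (auto simp: power2_eq_square mult_left_le)
      also have "\<dots> = norm Y * ?b * exp 1" by (simp add: s_def)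
      finally show ?thesis
        using norm_triangle_ineq[of "mexp Y $ i $ j - mat 1 $ i $ j - Y $ i $ j" "Y $ i $ j"] entry_le_norm[of Y i j]
        by simp
    qed simp
    have nX: "((\<lambda>z. norm (?X z)) \<longlongrightarrow> 0) at_infinity" using tendsto_norm[OF X] by simp
    have "((\<lambda>z. ?b * norm (?X z)) \<longlongrightarrow> ?b * 0) at_infinity" using nX by (intro tendsto_intros)
    then have "eventually (\<lambda>z. ?b * norm (?X z) < 1) at_infinity" by (rule order_tendstoD) simp
    then have ev: "eventually (\<lambda>z. norm (mexp (?X z) $ i $ j - mat 1 $ i $ j) \<le> norm (?X z) + norm (?X z) * ?b * exp 1) at_infinity"
      by eventually_elim (rule bound, simp)
    have "((\<lambda>z. norm (?X z) + norm (?X z) * ?b * exp 1) \<longlongrightarrow> 0 + 0 * ?b * exp 1) at_infinity"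
      using nX by (intro tendsto_intros)
    then have "((\<lambda>z. mexp (?X z) $ i $ j - mat 1 $ i $ j) \<longlongrightarrow> 0) at_infinity"
      by (intro Lim_null_comparison[OF ev]) simp
    then show "((\<lambda>z. mexp (?X z) $ i $ j) \<longlongrightarrow> mat 1 $ i $ j) at_infinity"
      by (rule LIM_zero_cancel)
  qed
  have Dinf: "eventually (\<lambda>z. z \<notin> D) at_infinity"
  proof -
    obtain R where "\<And>z. z \<in> D \<Longrightarrow> norm z \<le> R" using finite_imp_bounded[OF D] by (auto simp: bounded_iff)
    then show ?thesis unfolding eventually_at_infinity by (intro exI[of _ "R + 1"]) force
  qed
  have "\<gamma> t \<in> group_maps G D" for t
    unfolding group_maps_def
  proof (intro CollectI conjI ballI allI impI)
    show "\<gamma> t z = 0" if "z \<in> D" for z using that by (simp add: \<gamma>_def)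
    show "\<gamma> t z \<in> G" if "z \<notin> D" for z
      using that \<eta>'(2) g'(2)
      by (auto simp: \<gamma>_def intro!: algebraic_groupD(2)[OF G] mexp_in_group[OF G] lie_algebra_msmult)
    show "(\<lambda>z. \<gamma> t z $ i $ j) holomorphic_on - D" for i j
    proof -
      have "mat_holo (\<lambda>z. mexp (msmult t (\<eta> z)) ** g z) (- D)"
        using g'(3) \<eta>'(1) op by (intro mat_holo_mult mexp_holo mat_holo_msmult) auto
      then show ?thesis 
        using mat_holo_cong[of "- D" "\<gamma> t" "\<lambda>z. mexp (msmult t (\<eta> z)) ** g z"]
        by (simp add: \<gamma>_def mat_holo_def)
    qed
    have "((\<lambda>z. mexp (msmult t (\<eta> z)) ** g z) \<longlongrightarrow> mat 1 ** mat 1) at_infinity"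
      by (rule mat_tendsto_mult[OF lim g'(4)])
    then have "((\<lambda>z. mexp (msmult t (\<eta> z)) ** g z) \<longlongrightarrow> mat 1) at_infinity" by simp
    then show "(\<gamma> t \<longlongrightarrow> mat 1) at_infinity"
      by (rule Lim_transform_eventually) (use Dinf in eventually_elim, simp add: \<gamma>_def)
  qed
  moreover have "\<gamma> 0 = g" using g'(1) by (auto simp: \<gamma>_def)
  moreover have "uniform_limit K (\<lambda>t z. msmult (1 / t) (\<gamma> t z - g z)) \<delta> (at 0)"
    if K: "closed K" "K \<inter> D = {}" for K
    unfolding uniform_limit_iff
  proof (intro allI impI)
    fix \<epsilon> :: real assume \<epsilon>: "0 < \<epsilon>"
    let ?n = "of_nat CARD('n) :: real"
    obtain M where M: "0 < M" "\<And>z. z \<in> K \<Longrightarrow> norm (\<eta> z) \<le> M" using bounded_off_poles[OF \<eta>'(1,3) K] by blast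
    obtain N where N: "0 < N" "\<And>z. z \<in> K \<Longrightarrow> norm (g z) \<le> N" using bounded_off_poles[OF g'(3,4) K] by blast
    \<comment> \<open>The first two factors pass from entries to the norm, the third comes from the
      sum in the product with \<open>g z\<close>, and \<open>N\<close> bounds the entries of
      \<open>g z\<close>.\<close>
    define C where "C = ?n * ?n * (?n * (exp (?n * M) * N))"
    have C: "0 < C" using N(1) by (simp add: C_def)
    have est: "norm (msmult (1 / t) (\<gamma> t z - g z) - \<delta> z) \<le> norm t * C" if t: "t \<noteq> 0" "norm t \<le> 1" and z: "z \<in> K" for t z
    proof -
      let ?E = "mexp (msmult t (\<eta> z))"
      have zD: "z \<notin> D" using z K by auto
      have eq: "(msmult (1 / t) (\<gamma> t z - g z) - \<delta> z) $ i $ j =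
          (\<Sum>k\<in>UNIV. (?E $ i $ k - mat 1 $ i $ k - t * \<eta> z $ i $ k) / t * g z $ k $ j)" for i j
      proof -
        have "msmult (1 / t) (\<gamma> t z - g z) - \<delta> z = msmult (1 / t) (?E - mat 1 - msmult t (\<eta> z)) ** g z"
          using t(1) zD
          by (simp add: \<gamma>_def \<delta>(2) msmult_mult_left matrix_diff_rdistrib)
             (rule matrix_eqI, simp add: msmult_mult_left field_simps)
        then show ?thesis by (simp add: matrix_mult_nth)
      qed
      have "norm ((msmult (1 / t) (\<gamma> t z - g z) - \<delta> z) $ i $ j) \<le> ?n * (norm t * exp (?n * M) * N)" for i j
      proof -
        have "norm ((?E $ i $ k - mat 1 $ i $ k - t * \<eta> z $ i $ k) / t * g z $ k $ j) \<le> norm t * exp (?n * M) * N" for k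
        proof -
          have "norm (?E $ i $ k - mat 1 $ i $ k - t * \<eta> z $ i $ k) \<le> (norm t)\<^sup>2 * exp (?n * M)"
            using M(2)[OF z] t(2) by (intro mexp_tail_bound) auto
          then have "norm ((?E $ i $ k - mat 1 $ i $ k - t * \<eta> z $ i $ k) / t) \<le> norm t * exp (?n * M)"
            using t(1) by (simp add: norm_divide divide_simps power2_eq_square mult_ac)
          moreover have "norm (g z $ k $ j) \<le> N" using entry_le_norm[of "g z" k j] N(2)[OF z] by linarith
          ultimately show ?thesis unfolding norm_mult by (intro mult_mono) auto
        qed
        then have "norm (\<Sum>k\<in>UNIV. (?E $ i $ k - mat 1 $ i $ k - t * \<eta> z $ i $ k) / t * g z $ k $ j)
            \<le> (\<Sum>k\<in>(UNIV :: 'n set). norm t * exp (?n * M) * N)" by (intro sum_norm_le)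
        then show ?thesis unfolding eq by simp
      qed
      then have "norm (msmult (1 / t) (\<gamma> t z - g z) - \<delta> z) \<le> of_nat (CARD('n) * CARD('n)) * (?n * (norm t * exp (?n * M) * N))"
        by (rule norm_le_entries)
      then show ?thesis by (simp add: C_def mult_ac)
    qed
    have "eventually (\<lambda>t. t \<noteq> 0 \<and> norm t < min 1 (\<epsilon> / C)) (at (0::complex))"
      unfolding eventually_at using \<epsilon> C by (intro exI[of _ "min 1 (\<epsilon> / C)"]) (auto simp: dist_norm)
    then show "eventually (\<lambda>t. \<forall>z\<in>K. dist (msmult (1 / t) (\<gamma> t z - g z)) (\<delta> z) < \<epsilon>) (at 0)"
    proof eventually_elim
      case (elim t)
      then have "norm t * C < \<epsilon>" using C by (simp add: pos_less_divide_eq)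
      then show ?case using est[of t] elim by (auto simp: dist_norm intro: le_less_trans)
    qed
  qed
  ultimately have "curve_with_velocity G D g \<delta> \<gamma>" by (simp add: curve_with_velocity_def)
  then show ?thesis by (rule that)
qed

section \<open>Contour integrals: circles at infinity, around poles, and around the holes of a
  disk\<close>

section \<open>Residues\<close>

text \<open>In \<open>u = 1 / z\<close> the coefficient of \<open>1 / z\<close> has index 1. The
  minus sign in dz = - u^(-2) du is absorbed by the orientation, which inversion reverses.\<close>

lemma has_contour_integral_circle_at_infinity:
  assumes hol: "F holomorphic_on {z. R1 < norm z}" and R: "0 < R1" "R1 < R"
    and exp: "(\<lambda>u. F (inverse u)) has_laurent_expansion A"
  shows "(F has_contour_integral (2 * of_real pi * \<i> * fls_nth A 1)) (circlepath 0 R)"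
proof -
  let ?I = "2 * of_real pi * \<i> * fls_nth A 1"
  have "F \<circ> inverse holomorphic_on (ball 0 (1 / R1) - {0})"
  proof (rule holomorphic_on_compose_gen)
    show "inverse holomorphic_on ball 0 (1 / R1) - {0}" by (intro holomorphic_intros) auto
    show "F holomorphic_on {z. R1 < norm z}" by (rule hol)
    have "R1 < inverse (norm u)" if "norm u < 1 / R1" "u \<noteq> 0" for u :: complex
      using that R by (simp add: inverse_eq_divide pos_less_divide_eq mult.commute)
    then show "inverse ` (ball 0 (1 / R1) - {0}) \<subseteq> {z :: complex. R1 < norm z}"
      by (auto simp: norm_inverse)
  qed
  then have "((\<lambda>u. F (inverse u) * u powi (- (1 + 1))) has_contour_integral ?I) (circlepath 0 (1 / R))"
    using fls_nth_as_contour_integral[OF exp, of "1 / R1" "1 / R" 1] R by (simp add: o_def field_simps)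
  then have "((\<lambda>t. F (inverse (of_real (1 / R) * cis t)) * (of_real (1 / R) * cis t) powi (- 2)
      * of_real (1 / R) * \<i> * cis t) has_integral ?I) {0..2 * pi}"
    unfolding circlepath_def by (subst (asm) has_contour_integral_part_circlepath_iff) auto
  moreover have "F (inverse (of_real (1 / R) * cis t)) * (of_real (1 / R) * cis t) powi (- 2)
      * of_real (1 / R) * \<i> * cis t = F (of_real R * cis (- t)) * of_real R * \<i> * cis (- t)" for t
  proof -
    define e where "e = cis t"
    have e: "e \<noteq> 0" "cis (- t) = inverse e" by (simp_all add: e_def cis_inverse cis_neq_zero)
    have "(of_real (1 / R) * e) powi (- 2) = inverse ((of_real (1 / R) * e) * (of_real (1 / R) * e))"
      by (simp add: power_int_minus power2_eq_square)
    then have "(of_real (1 / R) * e) powi (- 2) * of_real (1 / R) * \<i> * e = of_real R * \<i> * inverse e"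
      using R e by (simp add: field_simps)
    moreover have "inverse (of_real (1 / R) * e) = of_real R * inverse e"
      using R by (simp add: field_simps)
    ultimately show ?thesis unfolding e(2) e_def[symmetric] by (metis mult.assoc)
  qed
  ultimately have "((\<lambda>t. F (of_real R * cis (- t)) * of_real R * \<i> * cis (- t)) has_integral ?I) (cbox 0 (2 * pi))"
    by simp
  \<comment> \<open>The substitution of \<open>2 * pi - t\<close> for \<open>t\<close> makes the
    clockwise circle counterclockwise.\<close>
  from has_integral_affinity[OF this, of "-1" "2 * pi"]
  have "((\<lambda>t. F (of_real R * cis (t - 2 * pi)) * of_real R * \<i> * cis (t - 2 * pi)) has_integral ?I)
      ((\<lambda>x. 2 * pi - x) ` {0..2 * pi})"
    by simp
  moreover have "(\<lambda>x. 2 * pi - x) ` {0..2 * pi} = {0..2 * pi}" by simp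
  moreover have "cis (t - 2 * pi) = cis t" for t by (simp add: cis.ctr cos_diff sin_diff)
  ultimately have "((\<lambda>t. F (0 + of_real R * cis t) * of_real R * \<i> * cis t) has_integral ?I) {0..2 * pi}"
    by simp
  then show ?thesis
    unfolding circlepath_def by (subst has_contour_integral_part_circlepath_iff) auto
qed

lemma finite_subset_ball:
  fixes D :: "complex set"
  assumes "finite D"
  obtains R where "0 < R" "D \<subseteq> ball 0 R"
  using finite_imp_bounded[OF assms] bounded_subset_ballD by blast

text \<open>Both sides, times 2 pi i, are the integral over one circle that encloses
  \<open>D\<close>.\<close>

lemma sum_residues:
  assumes D: "finite D" and hol: "F holomorphic_on - D"
    and exp: "(\<lambda>u. F (inverse u)) has_laurent_expansion A"
  shows "(\<Sum>c\<in>D. residue F c) = fls_nth A 1"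
proof -
  obtain R where R: "0 < R" "D \<subseteq> ball 0 R" using finite_subset_ball[OF D] .
  have "contour_integral (circlepath 0 (R + 1)) F =
      2 * pi * \<i> * (\<Sum>c\<in>D. winding_number (circlepath 0 (R + 1)) c * residue F c)"
    using R hol by (intro Residue_theorem[of UNIV]) (auto simp: D Compl_eq_Diff_UNIV)
  also have "(\<Sum>c\<in>D. winding_number (circlepath 0 (R + 1)) c * residue F c) = (\<Sum>c\<in>D. residue F c)"
    using R(2) by (intro sum.cong) (auto simp: winding_number_circlepath)
  finally have 1: "contour_integral (circlepath 0 (R + 1)) F = 2 * of_real pi * \<i> * (\<Sum>c\<in>D. residue F c)"
    by simp
  have "(F has_contour_integral (2 * of_real pi * \<i> * fls_nth A 1)) (circlepath 0 (R + 1))"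
    using R by (intro has_contour_integral_circle_at_infinity[OF holomorphic_on_subset[OF hol] R(1) _ exp]) auto
  then have "contour_integral (circlepath 0 (R + 1)) F = 2 * of_real pi * \<i> * fls_nth A 1"
    by (rule contour_integral_unique)
  with 1 show ?thesis by simp
qed

text \<open>The homology form of Cauchy's theorem is available for loops only, not for cycles.\<close>

lemma circles_as_loop:
  assumes U: "open U" "connected U" "p \<in> U" and A: "finite A"
    and r: "\<And>c. c \<in> A \<Longrightarrow> 0 < r c \<and> sphere c (r c) \<subseteq> U"
  obtains L where "valid_path L" "pathstart L = p" "pathfinish L = p" "path_image L \<subseteq> U"
    "\<And>w. w \<notin> U \<Longrightarrow> winding_number L w = (\<Sum>c\<in>A. winding_number (circlepath c (r c)) w)"
    "\<And>F. F holomorphic_on U \<Longrightarrow>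
      contour_integral L F = (\<Sum>c\<in>A. contour_integral (circlepath c (r c)) F)"
proof -
  have "\<exists>L. valid_path L \<and> pathstart L = p \<and> pathfinish L = p \<and> path_image L \<subseteq> U \<and>
     (\<forall>w. w \<notin> U \<longrightarrow> winding_number L w = (\<Sum>c\<in>A. winding_number (circlepath c (r c)) w)) \<and>
     (\<forall>F. F holomorphic_on U \<longrightarrow>
        contour_integral L F = (\<Sum>c\<in>A. contour_integral (circlepath c (r c)) F))"
    using A r
  proof (induction A)
    case empty
    have "winding_number (linepath p p) w = 0" if "w \<notin> U" for w
      using that U(3) by (intro winding_number_trivial) auto
    moreover have "valid_path (linepath p p)" "pathstart (linepath p p) = p" "pathfinish (linepath p p) = p"
      "path_image (linepath p p) \<subseteq> U" "contour_integral (linepath p p) F = 0" for F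
      using U(3) by simp_all
    ultimately show ?case unfolding sum.empty by blast
  next
    case (insert c A)
    then obtain L where L: "valid_path L" "pathstart L = p" "pathfinish L = p" "path_image L \<subseteq> U"
      "\<And>w. w \<notin> U \<Longrightarrow> winding_number L w = (\<Sum>c\<in>A. winding_number (circlepath c (r c)) w)"
      "\<And>F. F holomorphic_on U \<Longrightarrow> contour_integral L F = (\<Sum>c\<in>A. contour_integral (circlepath c (r c)) F)"
      using insert.IH[OF insert.prems[OF insertI2]] by auto
    let ?C = "circlepath c (r c)"
    have rc: "0 < r c" "path_image ?C \<subseteq> U" using insert.prems[of c] by auto
    then have "c + of_real (r c) \<in> U" using insert.prems[of c] by (auto simp: dist_norm)
    then obtain q where q: "polynomial_function q" "path_image q \<subseteq> U" "pathstart q = p" "pathfinish q = c + of_real (r c)"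
      using connected_open_polynomial_connected[OF U(1,2,3)] by blast
    have vq: "valid_path q" using q(1) by (rule valid_path_polynomial_function)
    \<comment> \<open>Out along \<open>q\<close>, once around the new circle, back along
      \<open>q\<close>, then the old loop: the two passes along \<open>q\<close> cancel in integrals
      and in winding numbers.\<close>
    define M where "M = q +++ (?C +++ (reversepath q +++ L))"
    note paths = vq valid_path_imp_path[OF vq] L(1) valid_path_imp_path[OF L(1)]
    have "valid_path M" unfolding M_def using q(3,4) L(2)
      by (intro valid_path_join) (auto simp: paths)
    moreover have "pathstart M = p" "pathfinish M = p" using q(3) L(3) by (auto simp: M_def)
    moreover have "path_image M \<subseteq> U"
      unfolding M_def using q(2) rc(2) L(4) by (intro subset_path_image_join) auto
    moreover have "winding_number M w = (\<Sum>c\<in>insert c A. winding_number (circlepath c (r c)) w)" if w: "w \<notin> U" for w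
    proof -
      have wn: "w \<notin> path_image q" "w \<notin> path_image ?C" "w \<notin> path_image L" using w q(2) rc(2) L(4) by auto
      then have "winding_number M w = winding_number q w + (winding_number ?C w + (winding_number (reversepath q) w + winding_number L w))"
        unfolding M_def using q(3,4) L(2) paths
        by (simp add: winding_number_join not_in_path_image_join)
      then show ?thesis using wn paths L(5)[OF w] insert.hyps by (simp add: winding_number_reversepath)
    qed
    moreover have "contour_integral M F = (\<Sum>c\<in>insert c A. contour_integral (circlepath c (r c)) F)"
      if F: "F holomorphic_on U" for F
    proof -
      have int: "F contour_integrable_on q" "F contour_integrable_on ?C" "F contour_integrable_on L"
        using contour_integrable_holomorphic_simple[OF F U(1)] q(2) rc(2) L(1,4) vq by auto
      then have "contour_integral M F = contour_integral q F + (contour_integral ?C F +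
          (contour_integral (reversepath q) F + contour_integral L F))"
        unfolding M_def using q(3,4) L(2) paths
        by (simp add: contour_integrable_join valid_path_join contour_integrable_reversepath)
      then show ?thesis using paths L(6)[OF F] insert.hyps by (simp add: contour_integral_reversepath)
    qed
    ultimately show ?case by blast
  qed
  then show ?thesis using that by blast
qed

definition holed_disk :: "complex set \<Rightarrow> real \<Rightarrow> real \<Rightarrow> complex set" where
  "holed_disk D \<epsilon> R = {z. norm z < R \<and> (\<forall>c\<in>D. \<epsilon> < dist c z)}"

lemma open_holed_disk: "finite D \<Longrightarrow> open (holed_disk D \<epsilon> R)"
proof -
  assume "finite D"
  moreover have "holed_disk D \<epsilon> R = ball 0 R - (\<Union>c\<in>D. cball c \<epsilon>)"
    by (auto simp: holed_disk_def not_le)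
  ultimately show ?thesis by (simp add: open_Diff closed_UN)
qed

text \<open>The balls are removed one at a time; disjointness of the larger balls keeps the next
  closed ball inside what is left.\<close>

lemma connected_disk_minus_balls:
  assumes "finite A" "A \<subseteq> D" "0 < \<epsilon>" "\<epsilon> < \<epsilon>1" "\<And>c d. c \<in> D \<Longrightarrow> d \<in> D \<Longrightarrow> c \<noteq> d \<Longrightarrow> ball c \<epsilon>1 \<inter> ball d \<epsilon>1 = {}"
    "\<And>c. c \<in> D \<Longrightarrow> ball c \<epsilon>1 \<subseteq> ball (0::complex) R"
  shows "connected (ball 0 R - (\<Union>c\<in>A. ball c \<epsilon>))"
  using assms(1,2)
proof (induction A)
  case (insert c A)
  have "connected ((ball 0 R - (\<Union>c\<in>A. ball c \<epsilon>)) - ball c \<epsilon>)"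
  proof (rule connected_diff_ball)
    have "cball c \<epsilon> \<inter> ball d \<epsilon> = {}" if "d \<in> A" for d
    proof -
      have "cball c \<epsilon> \<subseteq> ball c \<epsilon>1" "ball d \<epsilon> \<subseteq> ball d \<epsilon>1" using assms(4) by auto
      moreover have "ball c \<epsilon>1 \<inter> ball d \<epsilon>1 = {}" using assms(5)[of c d] that insert by auto
      ultimately show ?thesis by blast
    qed
    moreover have "cball c \<epsilon> \<subseteq> ball 0 R" using assms(4) assms(6)[of c] insert.prems by fastforce
    ultimately show "cball c \<epsilon> \<subseteq> ball 0 R - (\<Union>c\<in>A. ball c \<epsilon>)" by blast
  qed (use insert in auto)
  moreover have "ball 0 R - (\<Union>c\<in>insert c A. ball c \<epsilon>) = (ball 0 R - (\<Union>c\<in>A. ball c \<epsilon>)) - ball c \<epsilon>" by auto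
  ultimately show ?case by simp
qed simp

text \<open>Here the holes are closed disks, whereas the previous lemma removes open ones. So the
  region is exhausted by the sets with open holes of radius \<open>s > \<epsilon>0\<close>, which
  are connected and share the point \<open>R\<close>.\<close>

lemma connected_holed_disk:
  assumes cov: "disk_cover D \<epsilon>0 \<epsilon> \<epsilon>1 R1 R R0" and D: "finite D"
  shows "connected (holed_disk D \<epsilon>0 R0)"
proof -
  have c: "0 < \<epsilon>0" "\<epsilon>0 < \<epsilon>" "\<epsilon> < \<epsilon>1" "0 < R1" "R1 < R" "R < R0"
    "\<And>c d. c \<in> D \<Longrightarrow> d \<in> D \<Longrightarrow> c \<noteq> d \<Longrightarrow> ball c \<epsilon>1 \<inter> ball d \<epsilon>1 = {}" "\<And>c. c \<in> D \<Longrightarrow> ball c \<epsilon>1 \<subseteq> ball 0 R1"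
    using cov by (auto simp: disk_cover_def)
  let ?V = "\<lambda>s. ball 0 R0 - (\<Union>c\<in>D. ball c s)"
  have "holed_disk D \<epsilon>0 R0 = (\<Union>s\<in>{\<epsilon>0<..<\<epsilon>1}. ?V s)"
  proof
    show "holed_disk D \<epsilon>0 R0 \<subseteq> (\<Union>s\<in>{\<epsilon>0<..<\<epsilon>1}. ?V s)"
    proof
      fix z assume z: "z \<in> holed_disk D \<epsilon>0 R0"
      have "finite (insert \<epsilon> ((\<lambda>c. dist c z) ` D))" using D by simp
      \<comment> \<open>A radius above \<open>\<epsilon>0\<close> whose open balls all miss
        \<open>z\<close>; the entry \<open>\<epsilon>\<close> keeps it below
        \<open>\<epsilon>1\<close>.\<close>
      define s where "s = Min (insert \<epsilon> ((\<lambda>c. dist c z) ` D))"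
      have "s \<in> insert \<epsilon> ((\<lambda>c. dist c z) ` D)" unfolding s_def by (rule Min_in) (use D in auto)
      then have "\<epsilon>0 < s" using z c by (auto simp: holed_disk_def)
      moreover have "s \<le> \<epsilon>" unfolding s_def by (rule Min_le) (use D in auto)
      moreover have "s \<le> dist c z" if "c \<in> D" for c unfolding s_def by (rule Min_le) (use D that in auto)
      ultimately show "z \<in> (\<Union>s\<in>{\<epsilon>0<..<\<epsilon>1}. ?V s)"
        using z c by (intro UN_I[of s]) (auto simp: holed_disk_def not_less)
    qed
    show "(\<Union>s\<in>{\<epsilon>0<..<\<epsilon>1}. ?V s) \<subseteq> holed_disk D \<epsilon>0 R0"
      by (auto simp: holed_disk_def not_less intro: less_le_trans)
  qed
  moreover have "connected (\<Union>s\<in>{\<epsilon>0<..<\<epsilon>1}. ?V s)"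
  proof (rule connected_Union)
    have "connected (?V s)" if s: "\<epsilon>0 < s" "s < \<epsilon>1" for s
    proof (rule connected_disk_minus_balls[OF D order_refl _ s(2) c(7)])
      show "ball d \<epsilon>1 \<subseteq> ball 0 R0" if "d \<in> D" for d
        by (rule order_trans[OF c(8)[OF that]]) (use c(5,6) in \<open>simp add: subset_ball\<close>)
    qed (use c s in auto)
    then show "connected S" if "S \<in> ?V ` {\<epsilon>0<..<\<epsilon>1}" for S using that by auto
    have "of_real R \<in> ?V s" if "\<epsilon>0 < s" "s < \<epsilon>1" for s
    proof -
      have "complex_of_real R \<notin> ball d s" if "d \<in> D" for d
      proof
        assume "complex_of_real R \<in> ball d s"
        then have "complex_of_real R \<in> ball d \<epsilon>1" using \<open>s < \<epsilon>1\<close> by simp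
        then have "complex_of_real R \<in> ball 0 R1" using c(8)[OF that] by blast
        then show False using c by simp
      qed
      then show ?thesis using c by auto
    qed
    then have "complex_of_real R \<in> \<Inter> (?V ` {\<epsilon>0<..<\<epsilon>1})"
      by (intro INT_I) (simp only: greaterThanLessThan_iff)
    then show "\<Inter> (?V ` {\<epsilon>0<..<\<epsilon>1}) \<noteq> {}" by (metis empty_iff)
  qed
  ultimately show ?thesis by simp
qed

text \<open>The small circles, joined to a loop, and the large circle wind equally often around
  every point outside the region: not at all around points beyond \<open>R0\<close>, once around
  points in a hole. Cauchy's theorem applies to the large circle followed by the reversed
  loop.\<close>

lemma sum_circles_holed_disk:
  assumes cov: "disk_cover D \<epsilon>0 \<epsilon> \<epsilon>1 R1 R R0" and D: "finite D"
    and F: "F holomorphic_on holed_disk D \<epsilon>0 R0"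
  shows "(\<Sum>c\<in>D. contour_integral (circlepath c \<epsilon>) F) = contour_integral (circlepath 0 R) F"
proof -
  let ?U = "holed_disk D \<epsilon>0 R0"
  have c: "0 < \<epsilon>0" "\<epsilon>0 < \<epsilon>" "\<epsilon> < \<epsilon>1" "0 < R1" "R1 < R" "R < R0"
    "\<And>c d. c \<in> D \<Longrightarrow> d \<in> D \<Longrightarrow> c \<noteq> d \<Longrightarrow> ball c \<epsilon>1 \<inter> ball d \<epsilon>1 = {}" "\<And>c. c \<in> D \<Longrightarrow> ball c \<epsilon>1 \<subseteq> ball 0 R1"
    using cov by (auto simp: disk_cover_def)
  have small: "norm z < R1" if "d \<in> D" "dist d z \<le> \<epsilon>" for d z
    using c(8)[OF that(1)] that c(3) by (auto simp: subset_iff)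
  have far: "\<epsilon>0 < dist d z" if "d \<in> D" "c' \<in> D" "c' \<noteq> d" "dist c' z \<le> \<epsilon>" for c' d z
  proof (rule ccontr)
    assume "\<not> \<epsilon>0 < dist d z"
    then have "z \<in> ball d \<epsilon>1" "z \<in> ball c' \<epsilon>1" using c that by auto
    then show False using c(7)[OF that(1,2)] that(3) by blast
  qed
  have sph: "sphere d \<epsilon> \<subseteq> ?U" if "d \<in> D" for d
  proof
    fix z assume "z \<in> sphere d \<epsilon>"
    then have z: "dist d z = \<epsilon>" by simp
    have "\<epsilon>0 < dist d' z" if "d' \<in> D" for d'
      using far[OF that \<open>d \<in> D\<close>, of z] z c(2) by (cases "d = d'") auto
    moreover have "norm z < R0" using small[OF that, of z] z c(5,6) by linarith
    ultimately show "z \<in> ?U" by (auto simp: holed_disk_def)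
  qed
  have big: "sphere 0 R \<subseteq> ?U"
  proof
    fix z :: complex assume z: "z \<in> sphere 0 R"
    have "\<epsilon>0 < dist d z" if "d \<in> D" for d
      using small[OF that, of z] z c by (cases "dist d z \<le> \<epsilon>") auto
    then show "z \<in> ?U" using z c by (auto simp: holed_disk_def)
  qed
  \<comment> \<open>The base point of the loop is the starting point of the large circle, so that
    the two can be joined.\<close>
  have p: "of_real R \<in> ?U" using big c by auto
  obtain L where L: "valid_path L" "pathstart L = of_real R" "pathfinish L = of_real R" "path_image L \<subseteq> ?U"
    and LW: "\<And>w. w \<notin> ?U \<Longrightarrow> winding_number L w = (\<Sum>c\<in>D. winding_number (circlepath c \<epsilon>) w)"
    and LI: "\<And>F. F holomorphic_on ?U \<Longrightarrow>
      contour_integral L F = (\<Sum>c\<in>D. contour_integral (circlepath c \<epsilon>) F)"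
    by (rule circles_as_loop[OF open_holed_disk[OF D] connected_holed_disk[OF cov D] p D, where r = "\<lambda>_. \<epsilon>"])
       (use sph c in auto)
  let ?B = "circlepath 0 R"
  have B: "path_image ?B \<subseteq> ?U" using big c by simp
  have wind: "winding_number L w = winding_number ?B w" if w: "w \<notin> ?U" for w
  proof (cases "R0 \<le> norm w")
    case True
    have "winding_number (circlepath d \<epsilon>) w = 0" if "d \<in> D" for d
    proof (rule winding_number_zero_outside[where s = "cball d \<epsilon>"])
      show "w \<notin> cball d \<epsilon>" using small[OF that, of w] True c by auto
    qed (use c in auto)
    moreover have "winding_number ?B w = 0"
      by (rule winding_number_zero_outside[where s = "cball 0 R"]) (use True c in auto)
    ultimately show ?thesis using LW[OF w] by simp
  next
    case False
    then obtain d where d: "d \<in> D" "dist d w \<le> \<epsilon>0" using w by (auto simp: holed_disk_def not_less)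
    have "winding_number (circlepath e \<epsilon>) w = (if e = d then 1 else 0)" if "e \<in> D" for e
    proof (cases "e = d")
      case True
      then show ?thesis using d c by (simp add: winding_number_circlepath dist_norm norm_minus_commute)
    next
      case False
      have "winding_number (circlepath e \<epsilon>) w = 0"
      proof (rule winding_number_zero_outside[where s = "cball e \<epsilon>"])
        show "w \<notin> cball e \<epsilon>" using far[OF d(1) that False, of w] d(2) by auto
      qed (use c in auto)
      then show ?thesis using False by simp
    qed
    then have "winding_number L w = (\<Sum>e\<in>D. if e = d then 1 else 0)" using LW[OF w] by simp
    also have "\<dots> = 1" using d(1) D by simp
    also have "\<dots> = winding_number ?B w" using small[OF d(1), of w] d(2) c by (simp add: winding_number_circlepath)
    finally show ?thesis .
  qed
  have "(F has_contour_integral 0) (?B +++ reversepath L)"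
  proof (rule Cauchy_theorem_global[OF open_holed_disk[OF D] F])
    show "winding_number (?B +++ reversepath L) w = 0" if "w \<notin> ?U" for w
    proof -
      have "w \<notin> path_image ?B" "w \<notin> path_image L" using that B L(4) by auto
      then show ?thesis
        using wind[OF that] L valid_path_imp_path[OF L(1)]
        by (simp add: winding_number_join winding_number_reversepath)
    qed
    show "path_image (?B +++ reversepath L) \<subseteq> ?U" using B L(4) by (intro subset_path_image_join) auto
  qed (use L in auto)
  then have "contour_integral (?B +++ reversepath L) F = 0" by (rule contour_integral_unique)
  moreover have "F contour_integrable_on ?B" "F contour_integrable_on L"
    using contour_integrable_holomorphic_simple[OF F open_holed_disk[OF D]] B L by auto
  ultimately have "contour_integral ?B F = contour_integral L F"
    using L(1) by (simp add: contour_integral_reversepath contour_integrable_reversepath)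
  then show ?thesis using LI[OF F] by simp
qed

section \<open>Germs at infinity, loops in the Lie algebra, and their pairing\<close>

section \<open>Expansions at infinity\<close>

lemma has_laurent_expansion_transform:
  "f has_laurent_expansion F \<Longrightarrow> eventually (\<lambda>u. f u = g u) (at 0) \<Longrightarrow> g has_laurent_expansion F"
  using has_laurent_expansion_cong[of f g F F] by simp

text \<open>The germ of \<open>F\<close> at infinity as a series in \<open>u = 1 / z\<close>:
  positive indices are negative powers of \<open>z\<close>.\<close>

definition at_inf :: "(complex \<Rightarrow> complex^'n^'m) \<Rightarrow> complex fls^'n^'m \<Rightarrow> bool" where
  "at_inf F A \<longleftrightarrow> (\<forall>i j. (\<lambda>u. F (inverse u) $ i $ j) has_laurent_expansion A $ i $ j)"

lemma at_inf_entries: "at_inf F A \<Longrightarrow> (\<lambda>u. entries (F (inverse u)) v) has_laurent_expansion entries A v"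
  by (cases v) (simp add: at_inf_def)

lemma at_inf_const: "at_inf (\<lambda>z. X) (cmat fls_const X)"
  by (simp add: at_inf_def)

lemma at_inf_diff: "at_inf F A \<Longrightarrow> at_inf H B \<Longrightarrow> at_inf (\<lambda>z. F z - H z) (A - B)"
  and at_inf_minus: "at_inf F A \<Longrightarrow> at_inf (\<lambda>z. - F z) (- A)"
  by (auto simp: at_inf_def intro: has_laurent_expansion_diff has_laurent_expansion_minus)

lemma at_inf_mult: "at_inf F A \<Longrightarrow> at_inf H B \<Longrightarrow> at_inf (\<lambda>z. F z ** H z) (A ** B)"
  by (auto simp: at_inf_def matrix_mult_nth intro!: has_laurent_expansion_sum has_laurent_expansion_mult)

lemma at_inf_sum: "(\<And>x. x \<in> S \<Longrightarrow> at_inf (F x) (A x)) \<Longrightarrow> at_inf (\<lambda>z. \<Sum>x\<in>S. F x z) (\<Sum>x\<in>S. A x)"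
  by (auto simp: at_inf_def intro!: has_laurent_expansion_sum)

lemma at_inf_unique: "at_inf F A \<Longrightarrow> at_inf F B \<Longrightarrow> A = B"
  unfolding at_inf_def by (rule matrix_eqI) (metis has_laurent_expansion_unique)

lemma eventually_at_inf: "eventually P at_infinity \<Longrightarrow> eventually (\<lambda>u. P (inverse u)) (at (0::complex))"
  using filterlim_inverse_at_infinity[where 'a = complex] by (simp add: filterlim_iff)

lemma at_inf_cong: "eventually (\<lambda>z. F z = H z) at_infinity \<Longrightarrow> at_inf F A \<Longrightarrow> at_inf H A"
proof -
  assume ev: "eventually (\<lambda>z. F z = H z) at_infinity" and F: "at_inf F A"
  have "eventually (\<lambda>u. F (inverse u) $ i $ j = H (inverse u) $ i $ j) (at 0)" for i j
    using eventually_at_inf[OF ev] by eventually_elim simp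
  then show "at_inf H A"
    using F unfolding at_inf_def by (blast intro: has_laurent_expansion_transform)
qed

text \<open>The limit makes \<open>u = 0\<close> a removable singularity, so the expansion is a
  power series.\<close>

lemma at_inf_fps_exists:
  fixes F :: "complex \<Rightarrow> complex^'n^'n"
  assumes hol: "mat_holo F {z. R < norm z}" and lim: "(F \<longlongrightarrow> L) at_infinity"
  obtains A where "at_inf F (fls_mat A)" "fcoeff A 0 = L"
proof -
  have "\<exists>a. (\<lambda>u. F (inverse u) $ i $ j) has_laurent_expansion fps_to_fls a \<and> fps_nth a 0 = L $ i $ j" for i j
  proof -
    define R' where "R' = max R 1"
    let ?f = "\<lambda>u. F (inverse u) $ i $ j" and ?r = "1 / R'"
    have R': "R \<le> R'" "1 \<le> R'" by (auto simp: R'_def)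
    have inv: "R < inverse (norm u)" if "norm u < 1 / R'" "u \<noteq> 0" for u :: complex
    proof -
      have "R' < inverse (norm u)"
        using that R' by (simp add: inverse_eq_divide pos_less_divide_eq mult.commute)
      then show ?thesis using R' by simp
    qed
    have "(\<lambda>z. F z $ i $ j) \<circ> inverse holomorphic_on (ball 0 ?r - {0})"
    proof (rule holomorphic_on_compose_gen)
      show "inverse holomorphic_on ball 0 ?r - {0}" by (intro holomorphic_intros) auto
      show "(\<lambda>z. F z $ i $ j) holomorphic_on {z. R < norm z}" by (rule mat_holoD[OF hol])
      show "inverse ` (ball 0 ?r - {0}) \<subseteq> {z :: complex. R < norm z}"
        using inv by (auto simp: norm_inverse)
    qed
    then have fh: "?f holomorphic_on (ball 0 ?r - {0})" by (simp add: o_def)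
    have "((\<lambda>z. F z $ i $ j) \<longlongrightarrow> L $ i $ j) at_infinity" using lim by (simp add: mat_tendsto_iff)
    then have lim0: "(?f \<longlongrightarrow> L $ i $ j) (at 0)"
      by (rule filterlim_compose[OF _ filterlim_inverse_at_infinity])
    define h where "h = (\<lambda>u. if u = 0 then L $ i $ j else ?f u)"
    have "h holomorphic_on ball 0 ?r"
      unfolding h_def by (rule removable_singularity[OF fh]) (use lim0 in auto)
    moreover have "0 < ?r" using R' by simp
    ultimately have "h analytic_on {0}"
      by (intro holomorphic_on_imp_analytic_at[of h "ball 0 ?r"]) auto
    then have h: "h has_fps_expansion fps_expansion h 0" by (rule analytic_at_imp_has_fps_expansion_0)
    have "fps_nth (fps_expansion h 0) 0 = L $ i $ j"
      by (simp add: fps_expansion_def h_def)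
    moreover have "?f has_laurent_expansion fps_to_fls (fps_expansion h 0)"
    proof -
      have "eventually (\<lambda>u. h u = ?f u) (at 0)" by (auto simp: eventually_at_filter h_def)
      then show ?thesis by (rule has_laurent_expansion_transform[OF has_laurent_expansion_fps[OF h]])
    qed
    ultimately show ?thesis by blast
  qed
  then obtain a where a: "\<And>i j. (\<lambda>u. F (inverse u) $ i $ j) has_laurent_expansion fps_to_fls (a i j)"
    "\<And>i j. fps_nth (a i j) 0 = L $ i $ j" by metis
  show ?thesis
    by (rule that[of "\<chi> i j. a i j"]) (auto simp: at_inf_def fls_mat_def a intro: matrix_eqI)
qed

section \<open>Loop algebras\<close>

lemma fls_mat_nth [simp]: "fls_mat A $ i $ j = fps_to_fls (A $ i $ j)"
  by (simp add: fls_mat_def)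

lemma fps_to_fls_sum': "fps_to_fls (\<Sum>x\<in>S. f x) = (\<Sum>x\<in>S. fps_to_fls (f x))"
  by (induction S rule: infinite_finite_induct) auto

lemma fls_mat_mult: "fls_mat (A ** B) = fls_mat A ** fls_mat B"
  by (rule matrix_eqI) (simp add: matrix_mult_nth fps_to_fls_sum' fls_times_fps_to_fls)

lemma fls_mat_one: "fls_mat (mat 1) = mat 1"
  by (rule matrix_eqI) (simp add: mat_nth)

lemma fls_mat_inject: "fls_mat A = fls_mat B \<longleftrightarrow> A = B"
  by (auto simp: vec_eq_iff)

lemma zcoeff_nth [simp]: "zcoeff a k $ i $ j = fls_nth (a $ i $ j) (- k)"
  by (simp add: zcoeff_def)

lemma zcoeff_add [simp]: "zcoeff (a + b) k = zcoeff a k + zcoeff b k"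
  and zcoeff_diff [simp]: "zcoeff (a - b) k = zcoeff a k - zcoeff b k"
  and zcoeff_minus [simp]: "zcoeff (- a) k = - zcoeff a k"
  by (rule matrix_eqI; simp)+

lemma zcoeff_eqI: "(\<And>k. zcoeff a k = zcoeff b k) \<Longrightarrow> a = b"
proof (rule matrix_eqI, rule fls_eqI)
  fix i j k assume "\<And>k. zcoeff a k = zcoeff b k"
  then have "zcoeff a (- k) $ i $ j = zcoeff b (- k) $ i $ j" by simp
  then show "fls_nth (a $ i $ j) k = fls_nth (b $ i $ j) k" by simp
qed

lemma zcoeff_fls_mat: "zcoeff (fls_mat X) k = (if k \<le> 0 then fcoeff X (nat (- k)) else 0)"
  by (rule matrix_eqI) simp

text \<open>The equations of the Lie algebra, read over the field of Laurent series. In this form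
  closure under multiplication by series is clear, and so is membership of the expansion of a
  function with values in the Lie algebra.\<close>

lemma loop_algebra_iff:
  "a \<in> loop_algebra G \<longleftrightarrow> (\<forall>p\<in>vanishing_ideal G. (\<Sum>v\<in>UNIV. fls_const (lie_form p v) * entries a v) = 0)"
proof -
  have "fls_nth (\<Sum>v\<in>UNIV. fls_const (lie_form p v) * entries a v) k =
      (\<Sum>v\<in>UNIV. lie_form p v * entries (zcoeff a (- k)) v)" for p k
    by (simp add: fls_nth_sum split_beta)
  then have eq: "(\<Sum>v\<in>UNIV. fls_const (lie_form p v) * entries a v) = 0 \<longleftrightarrow>
      (\<forall>k. (\<Sum>v\<in>UNIV. lie_form p v * entries (zcoeff a (- k)) v) = 0)" for p
    by (simp add: fls_eq_iff)
  have "(\<forall>k. P k) \<longleftrightarrow> (\<forall>k. P (- k))" for P :: "int \<Rightarrow> bool" by (metis minus_minus)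
  then have "a \<in> loop_algebra G \<longleftrightarrow> (\<forall>k. zcoeff a (- k) \<in> lie_algebra G)"
    unfolding loop_algebra_def mem_Collect_eq .
  then show ?thesis unfolding eq by (simp only: lie_algebra_iff) blast
qed

lemma loop_algebra_at_inf:
  assumes "at_inf F a" "eventually (\<lambda>z. F z \<in> lie_algebra G) at_infinity"
  shows "a \<in> loop_algebra G"
  unfolding loop_algebra_iff
proof
  fix p assume p: "p \<in> vanishing_ideal G"
  have "(\<lambda>u. \<Sum>v\<in>UNIV. lie_form p v * entries (F (inverse u)) v) has_laurent_expansion
      (\<Sum>v\<in>UNIV. fls_const (lie_form p v) * entries a v)"
    by (intro has_laurent_expansion_sum has_laurent_expansion_mult has_laurent_expansion_const at_inf_entries assms)
  moreover have "eventually (\<lambda>u. (\<Sum>v\<in>UNIV. lie_form p v * entries (F (inverse u)) v) = 0) (at 0)"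
    using eventually_at_inf[OF assms(2)] by eventually_elim (use p in \<open>auto simp: lie_algebra_iff\<close>)
  ultimately have "(\<lambda>u. 0) has_laurent_expansion (\<Sum>v\<in>UNIV. fls_const (lie_form p v) * entries a v)"
    by (rule has_laurent_expansion_transform)
  then show "(\<Sum>v\<in>UNIV. fls_const (lie_form p v) * entries a v) = 0"
    by (rule zero_has_laurent_expansion_imp_eq_0)
qed

lemma loop_algebra_add: "a \<in> loop_algebra G \<Longrightarrow> b \<in> loop_algebra G \<Longrightarrow> a + b \<in> loop_algebra G"
  and loop_algebra_diff: "a \<in> loop_algebra G \<Longrightarrow> b \<in> loop_algebra G \<Longrightarrow> a - b \<in> loop_algebra G"
  and loop_algebra_minus: "a \<in> loop_algebra G \<Longrightarrow> - a \<in> loop_algebra G"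
  by (auto simp: loop_algebra_def lie_algebra_add lie_algebra_diff lie_algebra_minus)

lemma loop_algebra_zero: "(0 :: complex fls^'n^'n) \<in> loop_algebra G"
proof -
  have "zcoeff (0 :: complex fls^'n^'n) k = 0" for k by (rule matrix_eqI) simp
  then show ?thesis by (simp add: loop_algebra_def)
qed

lemma loop_algebra_sum: "(\<And>x. x \<in> S \<Longrightarrow> f x \<in> loop_algebra G) \<Longrightarrow> (\<Sum>x\<in>S. f x) \<in> loop_algebra G"
  by (induction S rule: infinite_finite_induct) (auto intro: loop_algebra_add loop_algebra_zero)

lemma loop_algebra_msmult:
  assumes "a \<in> loop_algebra G"
  shows "msmult x a \<in> loop_algebra G"
proof -
  have "(\<Sum>v\<in>UNIV. fls_const (lie_form p v) * entries (msmult x a) v) =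
      x * (\<Sum>v\<in>UNIV. fls_const (lie_form p v) * entries a v)" for p
    by (simp only: entries_msmult sum_distrib_left mult.left_commute)
  then show ?thesis using assms by (simp only: loop_algebra_iff) simp
qed

lemma loop_algebra_expand:
  assumes \<kappa>: "invariant_pairing G \<kappa>" and db: "dual_bases G \<kappa> d e e'" and a: "a \<in> loop_algebra G"
  obtains x where "a = (\<Sum>\<alpha><d. msmult (x \<alpha>) (cmat fls_const (e \<alpha>)))"
proof -
  have L: "e' \<alpha> \<in> lie_algebra G" if "\<alpha> < d" for \<alpha> using db that by (auto simp: dual_bases_def)
  have "\<exists>c. \<forall>X\<in>lie_algebra G. \<kappa> X (e' \<alpha>) = (\<Sum>v\<in>UNIV. c v * entries X v)" if "\<alpha> < d" for \<alpha>
    by (rule linear_functional_coeffs[where G = G and l = "\<lambda>X. \<kappa> X (e' \<alpha>)"])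
       (use L[OF that] in \<open>auto simp: invariant_pairingD(1,2)[OF \<kappa>]\<close>)
  then obtain c where c: "\<And>\<alpha> X. \<alpha> < d \<Longrightarrow> X \<in> lie_algebra G \<Longrightarrow>
      \<kappa> X (e' \<alpha>) = (\<Sum>v\<in>UNIV. c \<alpha> v * entries X v)" by metis
  \<comment> \<open>The functional \<open>\<kappa> X (e' \<alpha>)\<close> has been written with
    constant coefficients in the entries of \<open>X\<close>, so it can be applied to a matrix of
    Laurent series.\<close>
  define x where "x = (\<lambda>\<alpha>. \<Sum>v\<in>UNIV. fls_const (c \<alpha> v) * entries a v)"
  have zc: "zcoeff (\<Sum>\<alpha><d. msmult (x \<alpha>) (cmat fls_const (e \<alpha>))) k = (\<Sum>\<alpha><d. msmult (fls_nth (x \<alpha>) (- k)) (e \<alpha>))" for k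
    by (rule matrix_eqI) (simp add: fls_nth_sum)
  have "fls_nth (x \<alpha>) (- k) = \<kappa> (zcoeff a k) (e' \<alpha>)" if "\<alpha> < d" for \<alpha> k
    using c[OF that, of "zcoeff a k"] a by (simp add: x_def fls_nth_sum loop_algebra_def split_beta)
  then have "a = (\<Sum>\<alpha><d. msmult (x \<alpha>) (cmat fls_const (e \<alpha>)))"
    using a by (intro zcoeff_eqI) (simp add: zc dual_bases_expand[OF \<kappa> db, symmetric] loop_algebra_def)
  then show ?thesis by (rule that)
qed

section \<open>The pairing of Laurent series\<close>

text \<open>The coefficients in \<open>pairing_coeffs\<close> need not be unique. Fixing one choice
  makes \<open>fls_pairing\<close> bilinear on all Laurent matrices, without side
  conditions.\<close>

definition pairing_matrix ::
  "(complex^'n^'n) set \<Rightarrow> (complex^'n^'n \<Rightarrow> complex^'n^'n \<Rightarrow> complex) \<Rightarrow> 'n \<times> 'n \<Rightarrow> 'n \<times> 'n \<Rightarrow> complex" where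
  "pairing_matrix G \<kappa> = (SOME K. \<forall>X\<in>lie_algebra G. \<forall>Y\<in>lie_algebra G.
     \<kappa> X Y = (\<Sum>v\<in>UNIV. \<Sum>w\<in>UNIV. K v w * (entries X v * entries Y w)))"

lemma pairing_eq:
  assumes "invariant_pairing G \<kappa>" "X \<in> lie_algebra G" "Y \<in> lie_algebra G"
  shows "\<kappa> X Y = (\<Sum>v\<in>UNIV. \<Sum>w\<in>UNIV. pairing_matrix G \<kappa> v w * (entries X v * entries Y w))"
proof -
  let ?P = "\<lambda>K. \<forall>X\<in>lie_algebra G. \<forall>Y\<in>lie_algebra G.
     \<kappa> X Y = (\<Sum>v\<in>UNIV. \<Sum>w\<in>UNIV. K v w * (entries X v * entries Y w))"
  have "\<exists>K. ?P K" by (rule pairing_coeffs[OF assms(1)]) blast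
  then obtain K where "?P K" by blast
  then have "?P (pairing_matrix G \<kappa>)" unfolding pairing_matrix_def by (rule someI[where P = ?P])
  then show ?thesis using assms(2,3) by blast
qed

lemma pairing_holomorphic:
  assumes "invariant_pairing G \<kappa>" "mat_holo F S" "mat_holo H S"
    "\<And>z. z \<in> S \<Longrightarrow> F z \<in> lie_algebra G" "\<And>z. z \<in> S \<Longrightarrow> H z \<in> lie_algebra G"
  shows "(\<lambda>z. \<kappa> (F z) (H z)) holomorphic_on S"
proof -
  have "(\<lambda>z. \<Sum>v\<in>UNIV. \<Sum>w\<in>UNIV. pairing_matrix G \<kappa> v w * (entries (F z) v * entries (H z) w)) holomorphic_on S"
    by (intro holomorphic_intros mat_holo_entries assms)
  then show ?thesis
    by (rule holomorphic_transform) (simp only: pairing_eq[OF assms(1,4,5)])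
qed

definition fls_pairing ::
  "(complex^'n^'n) set \<Rightarrow> (complex^'n^'n \<Rightarrow> complex^'n^'n \<Rightarrow> complex)
     \<Rightarrow> complex fls^'n^'n \<Rightarrow> complex fls^'n^'n \<Rightarrow> complex fls" where
  "fls_pairing G \<kappa> a b = (\<Sum>v\<in>UNIV. \<Sum>w\<in>UNIV. fls_const (pairing_matrix G \<kappa> v w) * (entries a v * entries b w))"

lemma fls_pairing_expansion:
  assumes "invariant_pairing G \<kappa>" "at_inf F a" "at_inf H b"
    "eventually (\<lambda>z. F z \<in> lie_algebra G \<and> H z \<in> lie_algebra G) at_infinity"
  shows "(\<lambda>u. \<kappa> (F (inverse u)) (H (inverse u))) has_laurent_expansion fls_pairing G \<kappa> a b"
proof -
  have "(\<lambda>u. \<Sum>v\<in>UNIV. \<Sum>w\<in>UNIV. pairing_matrix G \<kappa> v w * (entries (F (inverse u)) v * entries (H (inverse u)) w))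
      has_laurent_expansion fls_pairing G \<kappa> a b"
    unfolding fls_pairing_def
    by (intro has_laurent_expansion_sum has_laurent_expansion_mult has_laurent_expansion_const at_inf_entries assms)
  moreover have "eventually (\<lambda>u. (\<Sum>v\<in>UNIV. \<Sum>w\<in>UNIV. pairing_matrix G \<kappa> v w *
      (entries (F (inverse u)) v * entries (H (inverse u)) w)) = \<kappa> (F (inverse u)) (H (inverse u))) (at 0)"
    using eventually_at_inf[OF assms(4)] by eventually_elim (simp only: pairing_eq[OF assms(1)])
  ultimately show ?thesis by (rule has_laurent_expansion_transform)
qed

lemma entries_add: "entries (a + b) v = entries a v + entries b v"
  and entries_diff: "entries (a - b) v = entries a v - entries b v"
  by (cases v; simp)+

lemma fls_pairing_add_left: "fls_pairing G \<kappa> (a + b) c = fls_pairing G \<kappa> a c + fls_pairing G \<kappa> b c"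
  and fls_pairing_add_right: "fls_pairing G \<kappa> c (a + b) = fls_pairing G \<kappa> c a + fls_pairing G \<kappa> c b"
  and fls_pairing_diff_left: "fls_pairing G \<kappa> (a - b) c = fls_pairing G \<kappa> a c - fls_pairing G \<kappa> b c"
  and fls_pairing_diff_right: "fls_pairing G \<kappa> c (a - b) = fls_pairing G \<kappa> c a - fls_pairing G \<kappa> c b"
  unfolding fls_pairing_def entries_add entries_diff
  by (simp_all only: distrib_left distrib_right left_diff_distrib right_diff_distrib sum.distrib sum_subtractf)

lemma fls_pairing_zero [simp]: "fls_pairing G \<kappa> 0 c = 0" "fls_pairing G \<kappa> c 0 = 0"
  by (simp_all add: fls_pairing_def split_beta)

lemma fls_pairing_minus_right: "fls_pairing G \<kappa> c (- a) = - fls_pairing G \<kappa> c a"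
  using fls_pairing_diff_right[of G \<kappa> c 0 a] by simp

lemma fls_pairing_msmult_left: "fls_pairing G \<kappa> (msmult x a) c = x * fls_pairing G \<kappa> a c"
  and fls_pairing_msmult_right: "fls_pairing G \<kappa> c (msmult x a) = x * fls_pairing G \<kappa> c a"
  unfolding fls_pairing_def entries_msmult sum_distrib_left
  by (intro sum.cong refl; simp only: mult_ac)+

lemma fls_pairing_sum_left: "fls_pairing G \<kappa> (\<Sum>x\<in>S. f x) c = (\<Sum>x\<in>S. fls_pairing G \<kappa> (f x) c)"
  by (induction S rule: infinite_finite_induct) (auto simp: fls_pairing_add_left)

lemma fls_pairing_sum_right: "fls_pairing G \<kappa> c (\<Sum>x\<in>S. f x) = (\<Sum>x\<in>S. fls_pairing G \<kappa> c (f x))"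
  by (induction S rule: infinite_finite_induct) (auto simp: fls_pairing_add_right)

lemma fls_times_nth_finite:
  fixes f g :: "complex fls"
  assumes "finite I" "\<And>i. fls_nth f i \<noteq> 0 \<Longrightarrow> fls_nth g (n - i) \<noteq> 0 \<Longrightarrow> i \<in> I"
  shows "fls_nth (f * g) n = (\<Sum>i\<in>I. fls_nth f i * fls_nth g (n - i))"
proof -
  let ?J = "{fls_subdegree f..n - fls_subdegree g}"
  have out: "fls_nth f i * fls_nth g (n - i) = 0" if "i \<notin> ?J" for i
  proof (cases "i < fls_subdegree f")
    case False
    then have "n - i < fls_subdegree g" using that by auto
    then show ?thesis by simp
  qed simp
  have "fls_nth (f * g) n = (\<Sum>i\<in>?J. fls_nth f i * fls_nth g (n - i))" by (rule fls_times_nth(2))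
  also have "\<dots> = (\<Sum>i\<in>?J \<union> I. fls_nth f i * fls_nth g (n - i))"
    by (rule sum.mono_neutral_left) (use assms(1) out in auto)
  also have "\<dots> = (\<Sum>i\<in>I. fls_nth f i * fls_nth g (n - i))"
    by (rule sum.mono_neutral_right) (use assms in auto)
  finally show ?thesis .
qed

lemma finite_zcoeff_support: "finite {k. zcoeff a k \<noteq> 0 \<and> zcoeff b (n - k) \<noteq> 0}"
  for a b :: "complex fls^'n^'n"
proof -
  let ?S = "\<lambda>v w. {n + fls_subdegree (entries b w)..- fls_subdegree (entries a v)}"
  have "{k. zcoeff a k \<noteq> 0 \<and> zcoeff b (n - k) \<noteq> 0} \<subseteq> (\<Union>v. \<Union>w. ?S v w)"
  proof
    fix k assume "k \<in> {k. zcoeff a k \<noteq> 0 \<and> zcoeff b (n - k) \<noteq> 0}"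
    then obtain i j i' j' where *: "fls_nth (a $ i $ j) (- k) \<noteq> 0" "fls_nth (b $ i' $ j') (- (n - k)) \<noteq> 0"
      by (auto simp: vec_eq_iff)
    then have "fls_subdegree (a $ i $ j) \<le> - k" "fls_subdegree (b $ i' $ j') \<le> - (n - k)"
      by (meson fls_eq0_below_subdegree not_le)+
    then show "k \<in> (\<Union>v. \<Union>w. ?S v w)" by (intro UN_I[of "(i, j)"] UN_I[of "(i', j')"]) auto
  qed
  then show ?thesis by (rule finite_subset) auto
qed

text \<open>Index 1 is the coefficient of \<open>1 / z\<close>. This connects the finite sum of the
  definition with the pairing that is bilinear over Laurent series and arises from expanding
  functions.\<close>

lemma residue_pairing_eq:
  assumes \<kappa>: "invariant_pairing G \<kappa>" and a: "a \<in> loop_algebra G" and b: "b \<in> loop_algebra G"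
  shows "residue_pairing \<kappa> a b = fls_nth (fls_pairing G \<kappa> a b) 1"
proof -
  let ?S = "{k. zcoeff a k \<noteq> 0 \<and> zcoeff b (- 1 - k) \<noteq> 0}"
  have fin: "finite ?S" by (rule finite_zcoeff_support)
  have prod: "fls_nth (entries a v * entries b w) 1 = (\<Sum>k\<in>?S. entries (zcoeff a k) v * entries (zcoeff b (- 1 - k)) w)" for v w
  proof -
    have "fls_nth (entries a v * entries b w) 1 = (\<Sum>i\<in>uminus ` ?S. fls_nth (entries a v) i * fls_nth (entries b w) (1 - i))"
    proof (rule fls_times_nth_finite)
      fix i assume *: "fls_nth (entries a v) i \<noteq> 0" "fls_nth (entries b w) (1 - i) \<noteq> 0"
      have "zcoeff a (- i) $ fst v $ snd v \<noteq> 0" "zcoeff b (- 1 - (- i)) $ fst w $ snd w \<noteq> 0"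
        using * by (auto simp: split_beta algebra_simps)
      then have "zcoeff a (- i) \<noteq> 0" "zcoeff b (- 1 - (- i)) \<noteq> 0" by (metis zero_index)+
      then show "i \<in> uminus ` ?S" by (intro image_eqI[of _ _ "- i"]) auto
    qed (use fin in simp)
    also have "\<dots> = (\<Sum>k\<in>?S. fls_nth (entries a v) (- k) * fls_nth (entries b w) (1 - (- k)))"
      by (subst sum.reindex) auto
    also have "\<dots> = (\<Sum>k\<in>?S. entries (zcoeff a k) v * entries (zcoeff b (- 1 - k)) w)"
      by (simp add: split_beta algebra_simps)
    finally show ?thesis .
  qed
  have "residue_pairing \<kappa> a b = (\<Sum>k\<in>?S. \<Sum>v\<in>UNIV. \<Sum>w\<in>UNIV.
      pairing_matrix G \<kappa> v w * (entries (zcoeff a k) v * entries (zcoeff b (- 1 - k)) w))"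
    unfolding residue_pairing_def using a b
    by (intro sum.cong refl pairing_eq[OF \<kappa>]) (auto simp: loop_algebra_def)
  also have "\<dots> = (\<Sum>v\<in>UNIV. \<Sum>k\<in>?S. \<Sum>w\<in>UNIV.
      pairing_matrix G \<kappa> v w * (entries (zcoeff a k) v * entries (zcoeff b (- 1 - k)) w))"
    by (rule sum.swap)
  also have "\<dots> = (\<Sum>v\<in>UNIV. \<Sum>w\<in>UNIV. \<Sum>k\<in>?S.
      pairing_matrix G \<kappa> v w * (entries (zcoeff a k) v * entries (zcoeff b (- 1 - k)) w))"
    by (intro sum.cong refl sum.swap)
  also have "\<dots> = fls_nth (fls_pairing G \<kappa> a b) 1"
    unfolding fls_pairing_def fls_nth_sum fls_mult_const_nth prod sum_distrib_left ..
  finally show ?thesis .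
qed

section \<open>The symplectic form as a sum of residues\<close>

section \<open>The symplectic form\<close>

lemma local_rep_subset: "local_rep G D g \<delta> S XL XR \<Longrightarrow> T \<subseteq> S \<Longrightarrow> local_rep G D g \<delta> T XL XR"
  unfolding local_rep_def by (blast intro: holomorphic_on_subset)

lemma local_repD:
  assumes "local_rep G D g \<delta> S XL XR"
  shows "mat_holo XL S" "mat_holo XR S"
    "z \<in> S \<Longrightarrow> XL z \<in> lie_algebra G" "z \<in> S \<Longrightarrow> XR z \<in> lie_algebra G"
    "z \<in> S \<Longrightarrow> z \<notin> D \<Longrightarrow> \<delta> z = XL z ** g z + g z ** XR z"
  using assms by (auto simp: local_rep_def mat_holo_def)

lemma local_rep_infD:
  assumes "local_rep_inf G D g \<delta> S XL XR"
  shows "local_rep G D g \<delta> S XL XR" "(XL \<longlongrightarrow> 0) at_infinity" "(XR \<longlongrightarrow> 0) at_infinity"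
  using assms by (auto simp: local_rep_inf_def)

lemma eventually_norm_gt: "eventually (\<lambda>z. R < norm z) at_infinity" for R :: real
  unfolding eventually_at_infinity by (intro exI[of _ "R + 1"]) auto

text \<open>One map is fixed, since both brackets are computed pointwise. It ranges over the same
  space as the curves in \<open>curve_with_velocity\<close>.\<close>

locale group_map =
  fixes G :: "(complex^'n^'n) set" and \<kappa> :: "complex^'n^'n \<Rightarrow> complex^'n^'n \<Rightarrow> complex"
    and D :: "complex set" and g :: "complex \<Rightarrow> complex^'n^'n"
  assumes G: "algebraic_group G" and \<kappa>: "invariant_pairing G \<kappa>" and D: "finite D"
    and g: "g \<in> group_maps G D"
begin

abbreviation "\<g> \<equiv> lie_algebra G"

definition gi :: "complex \<Rightarrow> complex^'n^'n" where
  "gi z = matrix_inv (g z)"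

lemma open_off: "open (- D)"
  using D by (simp add: finite_imp_closed open_Compl)

lemma eventually_off: "eventually (\<lambda>z. z \<notin> D) at_infinity"
proof -
  obtain R where "D \<subseteq> ball 0 R" using finite_subset_ball[OF D] by blast
  then show ?thesis by (intro eventually_mono[OF eventually_norm_gt[of R]]) auto
qed

lemma off_gt:
  assumes "D \<subseteq> ball 0 R" "R \<le> norm z" shows "z \<notin> D"
  using assms by auto

lemma g_simps: "z \<notin> D \<Longrightarrow> g z ** gi z = mat 1" "z \<notin> D \<Longrightarrow> gi z ** g z = mat 1"
  using matrix_inv_cancel[of "g z"] algebraic_groupD(4)[OF G] group_mapsD(2)[OF g]
  by (auto simp: gi_def)

lemma g_cancel:
  assumes "z \<notin> D"
  shows "A ** g z ** gi z = A" "A ** gi z ** g z = A" "g z ** (gi z ** A) = A" "gi z ** (g z ** A) = A"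
  using g_simps[OF assms] by (metis matrix_mul_assoc matrix_mul_lid matrix_mul_rid)+

lemma holo_g: "mat_holo g (- D)" and holo_gi: "mat_holo gi (- D)"
  using group_mapsD(2,3)[OF g] algebraic_groupD(4)[OF G]
  by (auto simp: gi_def[abs_def] intro!: mat_holo_inv)

lemma lim_g: "(g \<longlongrightarrow> mat 1) at_infinity" and lim_gi: "(gi \<longlongrightarrow> mat 1) at_infinity"
proof -
  show "(g \<longlongrightarrow> mat 1) at_infinity" by (rule group_mapsD(4)[OF g])
  have "invertible (mat 1 :: complex^'n^'n)" unfolding invertible_def by auto
  then have "((\<lambda>z. matrix_inv (g z)) \<longlongrightarrow> matrix_inv (mat 1)) at_infinity"
    by (rule mat_tendsto_inv[OF group_mapsD(4)[OF g]])
       (use eventually_off in eventually_elim, use group_mapsD(2)[OF g] algebraic_groupD(4)[OF G] in auto)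
  moreover have "matrix_inv (mat 1) = (mat 1 :: complex^'n^'n)"
    using matrix_inv_left_cancel[OF \<open>invertible (mat 1)\<close>] by simp
  ultimately show "(gi \<longlongrightarrow> mat 1) at_infinity" by (simp add: gi_def[abs_def])
qed

lemma lie_Ad: "z \<notin> D \<Longrightarrow> X \<in> \<g> \<Longrightarrow> g z ** X ** gi z \<in> \<g>"
  and lie_Ad': "z \<notin> D \<Longrightarrow> X \<in> \<g> \<Longrightarrow> gi z ** X ** g z \<in> \<g>"
  using lie_algebra_conj[OF G] lie_algebra_conj'[OF G] group_mapsD(2)[OF g] by (auto simp: gi_def)

lemma pairing_Ad:
  assumes "z \<notin> D" "X \<in> \<g>" "Y \<in> \<g>"
  shows "\<kappa> (gi z ** X ** g z) Y = \<kappa> X (g z ** Y ** gi z)"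
proof -
  have "\<kappa> (g z ** (gi z ** X ** g z) ** gi z) (g z ** Y ** gi z) = \<kappa> (gi z ** X ** g z) Y"
    using invariant_pairingD(4)[OF \<kappa> _ lie_Ad'[OF assms(1,2)] assms(3)] group_mapsD(2)[OF g assms(1)]
    by (simp add: gi_def)
  then show ?thesis using g_cancel[OF assms(1)] by (simp add: matrix_mul_assoc)
qed

lemma pairing_add_right:
  assumes "X \<in> \<g>" "Y \<in> \<g>" "Z \<in> \<g>"
  shows "\<kappa> Z (X + Y) = \<kappa> Z X + \<kappa> Z Y"
  using assms invariant_pairingD(1)[OF \<kappa>] invariant_pairingD(3)[OF \<kappa>] lie_algebra_add by metis

abbreviation "T \<equiv> tangent_space G D g"

text \<open>The tangent vector translated to the identity. It does not depend on local
  representatives, and is holomorphic off \<open>D\<close> with possible singularities on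
  \<open>D\<close>.\<close>

definition eta :: "(complex \<Rightarrow> complex^'n^'n) \<Rightarrow> complex \<Rightarrow> complex^'n^'n" where
  "eta \<delta> z = \<delta> z ** gi z"

lemma eta_g: "z \<notin> D \<Longrightarrow> eta \<delta> z ** g z = \<delta> z"
  by (simp add: eta_def g_cancel)

lemma eta_local_rep:
  assumes "local_rep G D g \<delta> S XL XR" "z \<in> S" "z \<notin> D"
  shows "eta \<delta> z = XL z + g z ** XR z ** gi z" "eta \<delta> z \<in> \<g>"
proof -
  note X = local_repD[OF assms(1)]
  show *: "eta \<delta> z = XL z + g z ** XR z ** gi z"
    using X(5)[OF assms(2,3)] by (simp add: eta_def matrix_add_rdistrib g_cancel[OF assms(3)])
  show "eta \<delta> z \<in> \<g>"
    unfolding * using X(3,4)[OF assms(2)] lie_Ad[OF assms(3)] by (intro lie_algebra_add)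
qed

lemma tangent_lie_maps:
  assumes \<delta>: "\<delta> \<in> T"
  shows "lie_maps G D (eta \<delta>)"
proof -
  have loc: "\<exists>S XL XR. open S \<and> c \<in> S \<and> local_rep G D g \<delta> S XL XR" for c
    using \<delta> by (auto simp: tangent_space_def)
  have "mat_holo (eta \<delta>) (- D)"
    unfolding mat_holo_def
  proof (intro allI)
    fix i j
    show "(\<lambda>z. eta \<delta> z $ i $ j) holomorphic_on - D"
    proof (rule holomorphic_onI)
      fix z assume z: "z \<in> - D"
      obtain S XL XR where S: "open S" "z \<in> S" and rep: "local_rep G D g \<delta> S XL XR" using loc by blast
      note X = local_repD[OF rep]
      have "mat_holo (\<lambda>z. XL z + g z ** XR z ** gi z) (S - D)"
        by (intro mat_holo_add mat_holo_mult mat_holo_subset[OF X(1)] mat_holo_subset[OF X(2)]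
          mat_holo_subset[OF holo_g] mat_holo_subset[OF holo_gi]) auto
      then have "mat_holo (eta \<delta>) (S - D)"
        by (subst mat_holo_cong) (auto simp: eta_local_rep[OF rep])
      then have "(\<lambda>z. eta \<delta> z $ i $ j) field_differentiable at z"
        by (rule holomorphic_on_imp_differentiable_at[OF mat_holoD])
           (use S z D in \<open>auto simp: finite_imp_closed open_Diff\<close>)
      then show "(\<lambda>z. eta \<delta> z $ i $ j) field_differentiable at z within - D"
        by (rule field_differentiable_at_within)
    qed
  qed
  moreover have "eta \<delta> z \<in> \<g>" if "z \<notin> D" for z
    using loc[of z] eta_local_rep(2) that by blast
  moreover have "(eta \<delta> \<longlongrightarrow> 0) at_infinity"
  proof -
    obtain R XL XR where rep: "local_rep_inf G D g \<delta> {z. norm z > R} XL XR"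
      using \<delta> by (auto simp: tangent_space_def)
    note X = local_rep_infD[OF rep]
    have "((\<lambda>z. XL z + g z ** XR z ** gi z) \<longlongrightarrow> 0 + mat 1 ** 0 ** mat 1) at_infinity"
      by (intro tendsto_add mat_tendsto_mult X lim_g lim_gi)
    then have "((\<lambda>z. XL z + g z ** XR z ** gi z) \<longlongrightarrow> 0) at_infinity" by simp
    then show ?thesis
    proof (rule Lim_transform_eventually)
      show "eventually (\<lambda>z. XL z + g z ** XR z ** gi z = eta \<delta> z) at_infinity"
        using eventually_off eventually_norm_gt[of R]
        by eventually_elim (simp add: eta_local_rep[OF X(1)])
    qed
  qed
  ultimately show ?thesis by (simp add: lie_maps_def)
qed

lemmas tangentD = tangent_lie_maps[unfolded lie_maps_def]

lemma holo_eta: "\<delta> \<in> T \<Longrightarrow> mat_holo (eta \<delta>) (- D)"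
  and lie_eta: "\<delta> \<in> T \<Longrightarrow> z \<notin> D \<Longrightarrow> eta \<delta> z \<in> \<g>"
  and lim_eta: "\<delta> \<in> T \<Longrightarrow> (eta \<delta> \<longlongrightarrow> 0) at_infinity"
  using tangentD by auto

text \<open>Off \<open>D\<close> the freedom \<open>(Ad\<^sub>g Y, - Y)\<close> can be used with
  \<open>Y = X\<^sup>R\<close> to remove the right component.\<close>

lemma local_rep_eta: "\<delta> \<in> T \<Longrightarrow> S \<inter> D = {} \<Longrightarrow> local_rep G D g \<delta> S (eta \<delta>) (\<lambda>_. 0)"
  unfolding local_rep_def
proof (intro conjI allI ballI)
  fix i j assume \<delta>: "\<delta> \<in> T" and S: "S \<inter> D = {}"
  show "(\<lambda>z. eta \<delta> z $ i $ j) holomorphic_on S"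
    by (rule holomorphic_on_subset[OF mat_holoD[OF holo_eta[OF \<delta>]]]) (use S in auto)
qed (auto simp: eta_g intro: lie_eta)

text \<open>Both factors vanish at infinity, so the product starts with \<open>u\<^sup>2\<close> and
  has no coefficient at index 1.\<close>

lemma contour_at_infinity_vanishes:
  assumes F: "mat_holo F {z. R1 < norm z}" "(F \<longlongrightarrow> 0) at_infinity" "\<And>z. R1 < norm z \<Longrightarrow> F z \<in> \<g>"
    and H: "mat_holo H {z. R1 < norm z}" "(H \<longlongrightarrow> 0) at_infinity" "\<And>z. R1 < norm z \<Longrightarrow> H z \<in> \<g>"
    and R: "0 < R1" "R1 < R"
  shows "((\<lambda>z. \<kappa> (F z) (H z)) has_contour_integral 0) (circlepath 0 R)"
proof -
  obtain A where A: "at_inf F (fls_mat A)" "fcoeff A 0 = 0" using at_inf_fps_exists[OF F(1,2)] .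
  obtain B where B: "at_inf H (fls_mat B)" "fcoeff B 0 = 0" using at_inf_fps_exists[OF H(1,2)] .
  have "eventually (\<lambda>z. F z \<in> \<g> \<and> H z \<in> \<g>) at_infinity"
    using eventually_norm_gt[of R1] by eventually_elim (use F(3) H(3) in auto)
  then have ex: "(\<lambda>u. \<kappa> (F (inverse u)) (H (inverse u))) has_laurent_expansion fls_pairing G \<kappa> (fls_mat A) (fls_mat B)"
    by (rule fls_pairing_expansion[OF \<kappa> A(1) B(1)])
  have hol: "(\<lambda>z. \<kappa> (F z) (H z)) holomorphic_on {z. R1 < norm z}"
    using F(3) H(3) by (intro pairing_holomorphic[OF \<kappa> F(1) H(1)]) auto
  have "fps_nth (A $ i $ j) 0 = 0" "fps_nth (B $ i $ j) 0 = 0" for i j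
    using A(2) B(2) fcoeff_nth[of A 0 i j] fcoeff_nth[of B 0 i j] by simp_all
  then have "fls_nth (entries (fls_mat A) v * entries (fls_mat B) w) 1 = 0" for v w
    by (simp add: split_beta fls_times_fps_to_fls[symmetric] fps_mult_nth)
  then have "fls_nth (fls_pairing G \<kappa> (fls_mat A) (fls_mat B)) 1 = 0"
    by (simp add: fls_pairing_def fls_nth_sum)
  then show ?thesis
    using has_contour_integral_circle_at_infinity[OF hol R ex] by simp
qed

text \<open>Two representatives differ by holomorphic \<open>W\<close> and \<open>V\<close> with
  \<open>W g = g V\<close>. By invariance \<open>\<kappa> (W, \<eta>') = \<kappa> (W, Y\<^sup>L) +
  \<kappa> (V, Y\<^sup>R)\<close> near \<open>c\<close>, for any representative of
  \<open>\<delta>'\<close>; this is holomorphic and has no residue.\<close>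

lemma residue_local_rep_unique:
  assumes \<delta>': "\<delta>' \<in> T" and c: "c \<in> D"
    and rep1: "open S1" "c \<in> S1" "local_rep G D g \<delta> S1 XL XR"
    and rep2: "open S2" "c \<in> S2" "local_rep G D g \<delta> S2 XL' XR'"
  shows "residue (\<lambda>z. \<kappa> (XL z) (eta \<delta>' z)) c = residue (\<lambda>z. \<kappa> (XL' z) (eta \<delta>' z)) c"
proof -
  obtain S3 YL YR where rep3: "open S3" "c \<in> S3" "local_rep G D g \<delta>' S3 YL YR"
    using \<delta>' unfolding tangent_space_def by blast
  define S where "S = S1 \<inter> S2 \<inter> S3 \<inter> - (D - {c})"
  have "open S"
    unfolding S_def using rep1 rep2 rep3 D by (intro open_Int open_Compl finite_imp_closed) auto
  moreover have "c \<in> S" "S - {c} \<subseteq> - D" using rep1 rep2 rep3 by (auto simp: S_def)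
  ultimately have S: "open S" "c \<in> S" "S - {c} \<subseteq> - D" by auto
  have sub: "S \<subseteq> S1" "S \<subseteq> S2" "S \<subseteq> S3" by (auto simp: S_def)
  note X = local_repD[OF local_rep_subset[OF rep1(3) sub(1)]]
  note X' = local_repD[OF local_rep_subset[OF rep2(3) sub(2)]]
  note Y = local_repD[OF local_rep_subset[OF rep3(3) sub(3)]]
  define W where "W = (\<lambda>z. XL' z - XL z)"
  have W: "mat_holo W S" "\<And>z. z \<in> S \<Longrightarrow> W z \<in> \<g>"
    using X X' by (auto simp: W_def intro: mat_holo_diff lie_algebra_diff)
  define V where "V = (\<lambda>z. XR z - XR' z)"
  have V: "mat_holo V S" "\<And>z. z \<in> S \<Longrightarrow> V z \<in> \<g>"
    using X X' by (auto simp: V_def intro: mat_holo_diff lie_algebra_diff)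
  let ?H = "\<lambda>z. \<kappa> (W z) (YL z) + \<kappa> (V z) (YR z)"
  have hol: "?H holomorphic_on S"
    using W V Y by (intro holomorphic_on_add pairing_holomorphic[OF \<kappa>]) auto
  have eq: "\<kappa> (XL' z) (eta \<delta>' z) = \<kappa> (XL z) (eta \<delta>' z) + ?H z" if z: "z \<in> S - {c}" for z
  proof -
    have zD: "z \<notin> D" and zS: "z \<in> S" using S z by auto
    have "XL' z ** g z + g z ** XR' z = XL z ** g z + g z ** XR z"
      using X(5)[OF zS zD] X'(5)[OF zS zD] by simp
    then have "W z ** g z = g z ** V z"
      by (simp add: W_def V_def matrix_diff_ldistrib matrix_diff_rdistrib algebra_simps)
    then have WV: "gi z ** W z ** g z = V z" by (simp add: matrix_mul_assoc[symmetric] g_cancel[OF zD])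
    have "\<kappa> (XL' z) (eta \<delta>' z) = \<kappa> (XL z + W z) (eta \<delta>' z)" by (simp add: W_def)
    also have "\<dots> = \<kappa> (XL z) (eta \<delta>' z) + \<kappa> (W z) (eta \<delta>' z)"
      using X(3)[OF zS] W(2)[OF zS] lie_eta[OF \<delta>' zD] by (rule invariant_pairingD(1)[OF \<kappa>])
    also have "\<kappa> (W z) (eta \<delta>' z) = \<kappa> (W z) (YL z + g z ** YR z ** gi z)"
      using eta_local_rep(1)[OF rep3(3) _ zD] zS sub by auto
    also have "\<dots> = \<kappa> (W z) (YL z) + \<kappa> (W z) (g z ** YR z ** gi z)"
      using Y(3,4)[OF zS] W(2)[OF zS] lie_Ad[OF zD] by (intro pairing_add_right)
    also have "\<kappa> (W z) (g z ** YR z ** gi z) = \<kappa> (V z) (YR z)"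
      using pairing_Ad[OF zD W(2)[OF zS] Y(4)[OF zS]] WV by simp
    finally show ?thesis .
  qed
  have holX: "(\<lambda>z. \<kappa> (XL z) (eta \<delta>' z)) holomorphic_on S - {c}"
    using X S lie_eta[OF \<delta>']
    by (intro pairing_holomorphic[OF \<kappa>] mat_holo_subset[OF X(1)] mat_holo_subset[OF holo_eta[OF \<delta>']]) auto
  have "eventually (\<lambda>z. z \<in> S - {c}) (at c)" using S by (intro eventually_at_in_open) auto
  then have "residue (\<lambda>z. \<kappa> (XL' z) (eta \<delta>' z)) c = residue (\<lambda>z. \<kappa> (XL z) (eta \<delta>' z) + ?H z) c"
    by (intro residue_cong) (auto elim!: eventually_mono simp: eq)
  also have "\<dots> = residue (\<lambda>z. \<kappa> (XL z) (eta \<delta>' z)) c + residue ?H c"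
    using S hol holX by (intro residue_add) (auto intro: holomorphic_on_subset)
  also have "residue ?H c = 0" using S hol by (intro residue_holo)
  finally show ?thesis by simp
qed

text \<open>The integrand is \<open>\<kappa> (X\<^sup>L, \<eta>')\<close> minus a function that does
  not involve the representatives of \<open>\<delta>\<close>. That function is holomorphic on the
  whole holed disk, so its integrals over the small circles and the reversed large circle cancel.
  What remains are the residues at \<open>D\<close>; infinity contributes nothing.\<close>

lemma symplectic_value_eq:
  assumes \<delta>: "\<delta> \<in> T" and \<delta>': "\<delta>' \<in> T" and v: "symplectic_value G \<kappa> D g \<delta> \<delta>' v"
    and rep: "\<And>c. c \<in> D \<Longrightarrow> \<exists>S. open S \<and> c \<in> S \<and> local_rep G D g \<delta> S (XL c) (XR c)"
  shows "v = (\<Sum>c\<in>D. residue (\<lambda>z. \<kappa> (XL c z) (eta \<delta>' z)) c)"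
proof -
  obtain \<epsilon>0 \<epsilon> \<epsilon>1 R1 R R0 PL PR PLinf PRinf YL YR where
    cov: "disk_cover D \<epsilon>0 \<epsilon> \<epsilon>1 R1 R R0"
    and M: "\<forall>c\<in>D. local_rep G D g \<delta> (ball c \<epsilon>1) (PL c) (PR c)"
    and Minf: "local_rep_inf G D g \<delta> {z. norm z > R1} PLinf PRinf"
    and Y': "local_rep G D g \<delta>' {z. norm z < R0 \<and> (\<forall>c\<in>D. dist c z > \<epsilon>0)} YL YR"
    and v_eq: "v = 1 / (2 * of_real pi * \<i>) *
          ((\<Sum>c\<in>D. contour_integral (circlepath c \<epsilon>)
              (\<lambda>z. \<kappa> (PL c z) (YL z) - \<kappa> (PR c z) (YR z)))
           + contour_integral (reversepath (circlepath 0 R))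
              (\<lambda>z. \<kappa> (PLinf z) (YL z) - \<kappa> (PRinf z) (YR z)))"
    using v unfolding symplectic_value_def by blast
  let ?U = "holed_disk D \<epsilon>0 R0"
  have Y: "local_rep G D g \<delta>' ?U YL YR" using Y' by (simp add: holed_disk_def)
  note Y = local_repD[OF Y] eta_local_rep[OF Y]
  have cv: "0 < \<epsilon>0" "\<epsilon>0 < \<epsilon>" "\<epsilon> < \<epsilon>1" "0 < R1" "R1 < R" "R < R0"
    and disj: "\<And>c d. c \<in> D \<Longrightarrow> d \<in> D \<Longrightarrow> c \<noteq> d \<Longrightarrow> ball c \<epsilon>1 \<inter> ball d \<epsilon>1 = {}"
    and inside: "\<And>c. c \<in> D \<Longrightarrow> ball c \<epsilon>1 \<subseteq> ball 0 R1"
    using cov by (auto simp: disk_cover_def)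
  have UD: "z \<notin> D" if "z \<in> ?U" for z
    using that cv(1) unfolding holed_disk_def by force
  have Dball: "D \<subseteq> ball 0 R1"
  proof
    fix c assume c: "c \<in> D"
    have "c \<in> ball c \<epsilon>1" using cv by simp
    then show "c \<in> ball 0 R1" using inside[OF c] by blast
  qed
  \<comment> \<open>The pairing of \<open>Ad\<^sub>g\<^sup>-\<^sup>1 \<eta> =
    Ad\<^sub>g\<^sup>-\<^sup>1 X\<^sup>L + X\<^sup>R\<close> with \<open>Y\<^sup>R\<close>: it
    contains the unwanted term in \<open>X\<^sup>R\<close> and, by invariance, the one that turns
    \<open>Y\<^sup>L\<close> into \<open>\<eta>'\<close>.\<close>
  define F2 where "F2 = (\<lambda>z. \<kappa> (gi z ** eta \<delta> z ** g z) (YR z))"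
  have split: "\<kappa> (XL z) (YL z) - \<kappa> (XR z) (YR z) = \<kappa> (XL z) (eta \<delta>' z) - F2 z"
    if X: "local_rep G D g \<delta> S XL XR" and z: "z \<in> S" "z \<in> ?U" for S XL XR z
  proof -
    note zD = UD[OF z(2)]
    note X = local_repD(3,4)[OF X z(1)] eta_local_rep[OF X z(1) zD]
    have "gi z ** eta \<delta> z ** g z = gi z ** XL z ** g z + XR z"
      unfolding X(3) matrix_add_rdistrib matrix_add_ldistrib
      by (simp add: matrix_mul_assoc g_cancel[OF zD] g_simps[OF zD])
    then have "F2 z = \<kappa> (gi z ** XL z ** g z) (YR z) + \<kappa> (XR z) (YR z)"
      unfolding F2_def
      using invariant_pairingD(1)[OF \<kappa> lie_Ad'[OF zD X(1)] X(2) Y(4)[OF z(2)]] by simp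
    moreover have "\<kappa> (XL z) (eta \<delta>' z) = \<kappa> (XL z) (YL z) + \<kappa> (XL z) (g z ** YR z ** gi z)"
      unfolding Y(6)[OF z(2) zD] using X Y(3,4)[OF z(2)] lie_Ad[OF zD] by (intro pairing_add_right)
    ultimately show ?thesis using pairing_Ad[OF zD X(1) Y(4)[OF z(2)]] by simp
  qed
  have holF2: "F2 holomorphic_on ?U"
    unfolding F2_def using UD Y(2,4) lie_Ad'[OF _ lie_eta[OF \<delta>]]
    by (intro pairing_holomorphic[OF \<kappa>] mat_holo_mult mat_holo_subset[OF holo_g]
        mat_holo_subset[OF holo_gi] mat_holo_subset[OF holo_eta[OF \<delta>]]) auto
  have sph: "path_image (circlepath c \<epsilon>) \<subseteq> ball c \<epsilon>1 \<inter> ?U" if c: "c \<in> D" for c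
  proof
    fix z assume "z \<in> path_image (circlepath c \<epsilon>)"
    then have z: "dist c z = \<epsilon>" using cv by simp
    then have zb: "z \<in> ball c \<epsilon>1" using cv by simp
    moreover have "norm z < R0" using inside[OF c] zb cv by (auto simp: subset_iff)
    moreover have "\<epsilon>0 < dist d z" if "d \<in> D" for d
    proof (cases "d = c")
      case False
      then have "z \<notin> ball d \<epsilon>1" using disj[OF c that] zb by auto
      then show ?thesis using cv by simp
    qed (use z cv in simp)
    ultimately show "z \<in> ball c \<epsilon>1 \<inter> ?U" by (simp add: holed_disk_def)
  qed
  have bigU: "path_image (circlepath 0 R) \<subseteq> {z. norm z > R1} \<inter> ?U"
  proof
    fix z assume "z \<in> path_image (circlepath 0 R)"
    then have z: "norm z = R" using cv by simp
    moreover have "\<epsilon>0 < dist d z" if "d \<in> D" for d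
    proof -
      have "z \<notin> ball d \<epsilon>1" using inside[OF that] z cv by (auto simp: subset_iff)
      then show ?thesis using cv by simp
    qed
    ultimately show "z \<in> {z. norm z > R1} \<inter> ?U" using cv by (simp add: holed_disk_def)
  qed
  have intF2: "F2 contour_integrable_on \<gamma>" if "valid_path \<gamma>" "path_image \<gamma> \<subseteq> ?U" for \<gamma>
    using contour_integrable_holomorphic_simple[OF holF2 open_holed_disk[OF D] that] .
  have small: "contour_integral (circlepath c \<epsilon>) (\<lambda>z. \<kappa> (PL c z) (YL z) - \<kappa> (PR c z) (YR z)) =
      2 * of_real pi * \<i> * residue (\<lambda>z. \<kappa> (XL c z) (eta \<delta>' z)) c - contour_integral (circlepath c \<epsilon>) F2"
    if c: "c \<in> D" for c
  proof -
    have Mc: "local_rep G D g \<delta> (ball c \<epsilon>1) (PL c) (PR c)" using M c by blast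
    note Mc' = local_repD[OF Mc]
    let ?F1 = "\<lambda>z. \<kappa> (PL c z) (eta \<delta>' z)"
    have off: "ball c \<epsilon>1 - {c} \<subseteq> - D"
    proof
      fix z assume z: "z \<in> ball c \<epsilon>1 - {c}"
      have "z \<in> ball z \<epsilon>1" using cv by simp
      then show "z \<in> - D" using disj[OF c, of z] z by blast
    qed
    have "?F1 holomorphic_on ball c \<epsilon>1 - {c}"
      using off Mc'(3) lie_eta[OF \<delta>']
      by (intro pairing_holomorphic[OF \<kappa>] mat_holo_subset[OF Mc'(1)] mat_holo_subset[OF holo_eta[OF \<delta>']]) auto
    then have F1: "(?F1 has_contour_integral 2 * pi * \<i> * residue ?F1 c) (circlepath c \<epsilon>)"
      by (intro base_residue[of "ball c \<epsilon>1"]) (use cv in auto)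
    have "contour_integral (circlepath c \<epsilon>) (\<lambda>z. \<kappa> (PL c z) (YL z) - \<kappa> (PR c z) (YR z)) =
        contour_integral (circlepath c \<epsilon>) (\<lambda>z. ?F1 z - F2 z)"
    proof (rule contour_integral_eq)
      fix z assume "z \<in> path_image (circlepath c \<epsilon>)"
      then have "z \<in> ball c \<epsilon>1" "z \<in> ?U" using sph[OF c] by blast+
      then show "\<kappa> (PL c z) (YL z) - \<kappa> (PR c z) (YR z) = ?F1 z - F2 z" by (rule split[OF Mc])
    qed
    also have "\<dots> = contour_integral (circlepath c \<epsilon>) ?F1 - contour_integral (circlepath c \<epsilon>) F2"
      using F1 sph[OF c] by (intro contour_integral_diff intF2) (auto simp: contour_integrable_on_def)
    also have "contour_integral (circlepath c \<epsilon>) ?F1 = 2 * of_real pi * \<i> * residue ?F1 c"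
      using contour_integral_unique[OF F1] by simp
    also have "residue ?F1 c = residue (\<lambda>z. \<kappa> (XL c z) (eta \<delta>' z)) c"
    proof -
      obtain S where "open S" "c \<in> S" "local_rep G D g \<delta> S (XL c) (XR c)" using rep[OF c] by blast
      then show ?thesis using residue_local_rep_unique[OF \<delta>' c _ _ Mc] cv by auto
    qed
    finally show ?thesis .
  qed
  have large: "contour_integral (reversepath (circlepath 0 R)) (\<lambda>z. \<kappa> (PLinf z) (YL z) - \<kappa> (PRinf z) (YR z)) =
      contour_integral (circlepath 0 R) F2"
  proof -
    note Mi = local_rep_infD[OF Minf]
    note Mi' = local_repD[OF Mi(1)]
    let ?F1 = "\<lambda>z. \<kappa> (PLinf z) (eta \<delta>' z)"
    have F1: "(?F1 has_contour_integral 0) (circlepath 0 R)"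
    proof (rule contour_at_infinity_vanishes[OF _ _ _ _ _ _ cv(4,5)])
      show "mat_holo (eta \<delta>') {z. R1 < norm z}"
        by (rule mat_holo_subset[OF holo_eta[OF \<delta>']]) (use Dball in auto)
      show "eta \<delta>' z \<in> \<g>" if "R1 < norm z" for z
        using lie_eta[OF \<delta>' off_gt[OF Dball]] that by simp
    qed (use Mi' Mi cv lim_eta[OF \<delta>'] in auto)
    have "contour_integral (reversepath (circlepath 0 R)) (\<lambda>z. \<kappa> (PLinf z) (YL z) - \<kappa> (PRinf z) (YR z)) =
        contour_integral (reversepath (circlepath 0 R)) (\<lambda>z. ?F1 z - F2 z)"
    proof (rule contour_integral_eq)
      fix z assume "z \<in> path_image (reversepath (circlepath 0 R))"
      then have "z \<in> {z. norm z > R1}" "z \<in> ?U"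
        using bigU unfolding path_image_reversepath by blast+
      then show "\<kappa> (PLinf z) (YL z) - \<kappa> (PRinf z) (YR z) = ?F1 z - F2 z" by (rule split[OF Mi(1)])
    qed
    also have "\<dots> = - contour_integral (circlepath 0 R) (\<lambda>z. ?F1 z - F2 z)"
      by (rule contour_integral_reversepath) simp
    also have "contour_integral (circlepath 0 R) (\<lambda>z. ?F1 z - F2 z) =
        contour_integral (circlepath 0 R) ?F1 - contour_integral (circlepath 0 R) F2"
      using F1 bigU by (intro contour_integral_diff intF2) (auto simp: contour_integrable_on_def)
    finally show ?thesis using contour_integral_unique[OF F1] by simp
  qed
  have "(\<Sum>c\<in>D. contour_integral (circlepath c \<epsilon>) (\<lambda>z. \<kappa> (PL c z) (YL z) - \<kappa> (PR c z) (YR z))) =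
      2 * of_real pi * \<i> * (\<Sum>c\<in>D. residue (\<lambda>z. \<kappa> (XL c z) (eta \<delta>' z)) c)
      - contour_integral (circlepath 0 R) F2"
    unfolding sum_circles_holed_disk[OF cov D holF2, symmetric] sum_distrib_left
    by (simp add: small sum_subtractf)
  then show ?thesis unfolding v_eq large by simp
qed

text \<open>The disks are shrunk into the domains of local representatives of
  \<open>\<delta>\<close>; on the holed disk, which avoids \<open>D\<close>,
  \<open>\<delta>'\<close> has the representative \<open>(eta \<delta>', 0)\<close>.\<close>

lemma symplectic_value_exists:
  assumes \<delta>: "\<delta> \<in> T" and \<delta>': "\<delta>' \<in> T"
  obtains v where "symplectic_value G \<kappa> D g \<delta> \<delta>' v"
proof -
  have "\<forall>c. \<exists>S XL XR. open S \<and> c \<in> S \<and> local_rep G D g \<delta> S XL XR"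
    using \<delta> by (auto simp: tangent_space_def)
  then obtain S XL XR where S: "\<And>c. open (S c)" "\<And>c. c \<in> S c" "\<And>c. local_rep G D g \<delta> (S c) (XL c) (XR c)"
    by metis
  obtain Ri Ki Ki' where inf: "local_rep_inf G D g \<delta> {z. norm z > Ri} Ki Ki'"
    using \<delta> by (auto simp: tangent_space_def)
  obtain R' where R': "0 < R'" "D \<subseteq> ball 0 R'" using finite_subset_ball[OF D] .
  have "eventually (\<lambda>e. ball c e \<subseteq> S c) (at_right 0)" for c
  proof -
    obtain r where "0 < r" "ball c r \<subseteq> S c" using S(1,2) open_contains_ball by meson
    then show ?thesis
      unfolding eventually_at_right_field by (intro exI[of _ r]) (auto intro: order_trans[OF subset_ball])
  qed
  then have ev1: "eventually (\<lambda>e. \<forall>c\<in>D. ball c e \<subseteq> S c) (at_right 0)" by (simp add: eventually_ball_finite D)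
  have "eventually (\<lambda>e. c \<noteq> d \<longrightarrow> ball c e \<inter> ball d e = {}) (at_right 0)" for c d :: complex
  proof (cases "c = d")
    case False
    have "ball c e \<inter> ball d e = {}" if "e < dist c d / 2" for e
    proof (rule ccontr)
      assume "ball c e \<inter> ball d e \<noteq> {}"
      then obtain z where "dist c z < e" "dist d z < e" by auto
      then show False using dist_triangle[of c d z] that by (simp add: dist_commute)
    qed
    then show ?thesis
      unfolding eventually_at_right_field using False by (intro exI[of _ "dist c d / 2"]) auto
  qed simp
  then have ev2: "eventually (\<lambda>e. \<forall>c\<in>D. \<forall>d\<in>D. c \<noteq> d \<longrightarrow> ball c e \<inter> ball d e = {}) (at_right 0)"
    by (simp add: eventually_ball_finite D)
  have ev3: "eventually (\<lambda>e. 0 < e \<and> e < 1) (at_right (0 :: real))"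
    unfolding eventually_at_right_field by (intro exI[of _ 1]) auto
  obtain e where e: "0 < e" "e < 1" "\<And>c. c \<in> D \<Longrightarrow> ball c e \<subseteq> S c"
    "\<forall>c\<in>D. \<forall>d\<in>D. c \<noteq> d \<longrightarrow> ball c e \<inter> ball d e = {}"
    using eventually_happens'[OF _ eventually_conj[OF ev1 eventually_conj[OF ev2 ev3]]] by auto
  \<comment> \<open>The summand 1 makes room for the disks around points of \<open>D\<close>, whose
    radius is below 1.\<close>
  define R1 where "R1 = max R' Ri + 1"
  have R1: "R' + 1 \<le> R1" "Ri \<le> R1" "0 < R1" using R'(1) by (auto simp: R1_def)
  have "ball c e \<subseteq> ball 0 R1" if "c \<in> D" for c
  proof
    fix z assume "z \<in> ball c e"
    moreover have "norm c < R'" using R'(2) that by auto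
    ultimately show "z \<in> ball 0 R1"
      using norm_triangle_sub[of z c] R1(1) e(2) by (simp add: dist_norm norm_minus_commute)
  qed
  then have cov: "disk_cover D (e / 4) (e / 2) e R1 (R1 + 1) (R1 + 2)"
    using e R1 by (auto simp: disk_cover_def)
  have L: "\<forall>c\<in>D. local_rep G D g \<delta> (ball c e) (XL c) (XR c)"
    using S(3) e(3) by (blast intro: local_rep_subset)
  have Linf: "local_rep_inf G D g \<delta> {z. norm z > R1} Ki Ki'"
    using inf R1(2) unfolding local_rep_inf_def by (auto elim: local_rep_subset)
  have LY: "local_rep G D g \<delta>' {z. norm z < R1 + 2 \<and> (\<forall>c\<in>D. dist c z > e / 4)} (eta \<delta>') (\<lambda>_. 0)"
    by (rule local_rep_eta[OF \<delta>']) (use e(1) in force)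
  show ?thesis
    by (rule that) (unfold symplectic_value_def, intro exI conjI, rule cov, rule L, rule Linf, rule LY, rule refl)
qed

lemma symplectic_form_eq:
  assumes \<delta>: "\<delta> \<in> T" and \<delta>': "\<delta>' \<in> T"
    and rep: "\<And>c. c \<in> D \<Longrightarrow> \<exists>S. open S \<and> c \<in> S \<and> local_rep G D g \<delta> S (XL c) (XR c)"
  shows "symplectic_form G \<kappa> D g \<delta> \<delta>' = (\<Sum>c\<in>D. residue (\<lambda>z. \<kappa> (XL c z) (eta \<delta>' z)) c)"
proof -
  obtain v where v: "symplectic_value G \<kappa> D g \<delta> \<delta>' v" using symplectic_value_exists[OF \<delta> \<delta>'] .
  then show ?thesis
    unfolding symplectic_form_def using symplectic_value_eq[OF \<delta> \<delta>' _ rep] by (intro the_equality) auto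
qed

end

section \<open>From maps near infinity to power series, and the splitting of loops\<close>

section \<open>Restriction to a neighbourhood of infinity\<close>

lemma r_inf_eq:
  assumes "at_inf F (fls_mat A)" shows "r_inf F = A"
proof (rule matrix_eqI)
  fix i j
  have "laurent_expansion (\<lambda>u. F (inverse u) $ i $ j) 0 = fps_to_fls (A $ i $ j)"
    by (rule laurent_expansion_0_eqI) (use assms in \<open>simp add: at_inf_def\<close>)
  then show "r_inf F $ i $ j = A $ i $ j" by (simp add: r_inf_def)
qed

lemma meval_expansion:
  assumes "at_inf F A"
  shows "(\<lambda>u. meval (\<lambda>c. c) (F (inverse u)) p) has_laurent_expansion meval fls_const A p"
  unfolding meval_def
  by (induction p)
     (auto intro!: has_laurent_expansion_const has_laurent_expansion_add has_laurent_expansion_mult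
       assms[unfolded at_inf_def, rule_format])

lemma meval_fls_mat: "meval fls_const (fls_mat A) p = fps_to_fls (meval fps_const A p)"
proof -
  have "entries (fls_mat A) = (\<lambda>v. fps_to_fls (entries A v))" by (rule ext) auto
  then show ?thesis
    unfolding meval_def by (simp only:) (rule peval_hom; simp add: fls_times_fps_to_fls)
qed

lemma group_maps_holo_outside:
  assumes "g \<in> group_maps G D" "D \<subseteq> ball 0 R"
  shows "mat_holo g {z. R < norm z}"
  using group_mapsD(3)[OF assms(1)] by (rule mat_holo_subset) (use assms(2) in auto)

text \<open>An equation \<open>p\<close> of \<open>G\<close> vanishes along \<open>g\<close> near
  infinity, so its expansion is zero; that expansion is \<open>p\<close> evaluated on the power
  series.\<close>

lemma group_maps_at_inf:
  assumes "finite D" and "g \<in> group_maps G D"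
  shows "at_inf g (fls_mat (r_inf g))" "r_inf g \<in> G1 G"
proof -
  obtain R where R: "D \<subseteq> ball 0 R" using finite_subset_ball[OF assms(1)] by blast
  obtain A where A: "at_inf g (fls_mat A)" "fcoeff A 0 = mat 1"
    using at_inf_fps_exists[OF group_maps_holo_outside[OF assms(2) R] group_mapsD(4)[OF assms(2)]] .
  have rA: "r_inf g = A" by (rule r_inf_eq[OF A(1)])
  then show "at_inf g (fls_mat (r_inf g))" using A by simp
  have "meval fps_const A p = 0" if p: "p \<in> vanishing_ideal G" for p
  proof -
    have "eventually (\<lambda>z. meval (\<lambda>c. c) (g z) p = 0) at_infinity"
    proof (rule eventually_mono[OF eventually_norm_gt[of R]])
      fix z :: complex assume "R < norm z"
      then have "g z \<in> G" using R by (intro group_mapsD(2)[OF assms(2)]) auto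
      then show "meval (\<lambda>c. c) (g z) p = 0" using p by (simp add: vanishing_ideal_def)
    qed
    then have "(\<lambda>u. 0) has_laurent_expansion meval fls_const (fls_mat A) p"
      by (rule has_laurent_expansion_transform[OF meval_expansion[OF A(1)] eventually_at_inf])
    then have "meval fls_const (fls_mat A) p = 0" by (rule zero_has_laurent_expansion_imp_eq_0)
    then show ?thesis by (simp add: meval_fls_mat)
  qed
  then show "r_inf g \<in> G1 G" using A(2) rA by (simp add: G1_iff)
qed

lemma at_inf_zero_limit:
  assumes "at_inf F (fls_mat A)" "fcoeff A 0 = 0"
  shows "(F \<longlongrightarrow> 0) at_infinity"
  unfolding mat_tendsto_iff
proof (intro allI)
  fix i j
  have "((\<lambda>u. F (inverse u) $ i $ j) \<longlongrightarrow> fls_nth (fps_to_fls (A $ i $ j)) 0) (at 0)"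
    by (rule has_laurent_expansion_imp_tendsto_0)
       (use assms(1) in \<open>auto simp: at_inf_def fls_subdegree_fls_to_fps_gt0\<close>)
  moreover have "fps_nth (A $ i $ j) 0 = 0" using assms(2) fcoeff_nth[of A 0 i j] by simp
  ultimately have "(((\<lambda>z. F z $ i $ j) \<circ> inverse) \<longlongrightarrow> 0) (at 0)" by (simp add: o_def)
  then show "((\<lambda>z. F z $ i $ j) \<longlongrightarrow> 0 $ i $ j) at_infinity"
    using lim_at_infinity_0[of "\<lambda>z. F z $ i $ j" 0] by simp
qed

section \<open>Positive and negative parts of loops\<close>

text \<open>With \<open>pos_part\<close> this is the splitting of the Manin triple, g((1/z)) into
  g[z] and the loops in negative powers of \<open>z\<close>. The negative part is a power series,
  the form in which \<open>negative_loop_algebra\<close> is stated.\<close>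

definition neg_part :: "complex fls^'n^'n \<Rightarrow> complex fps^'n^'n" where
  "neg_part a = (\<chi> i j. Abs_fps (\<lambda>k. if k = 0 then 0 else fls_nth (a $ i $ j) (int k)))"

definition pos_part :: "complex fls^'n^'n \<Rightarrow> complex fls^'n^'n" where
  "pos_part a = a - fls_mat (neg_part a)"

definition polynomial_loop :: "complex fls^'n^'n \<Rightarrow> bool" where
  "polynomial_loop a \<longleftrightarrow> (\<forall>k<0. zcoeff a k = 0)"

lemma fcoeff_neg_part: "fcoeff (neg_part a) k = (if k = 0 then 0 else zcoeff a (- int k))"
  by (rule matrix_eqI) (simp add: neg_part_def)

lemma zcoeff_neg_part: "zcoeff (fls_mat (neg_part a)) k = (if k < 0 then zcoeff a k else 0)"
  by (auto simp: zcoeff_fls_mat fcoeff_neg_part)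

lemma zcoeff_pos_part: "zcoeff (pos_part a) k = (if k < 0 then 0 else zcoeff a k)"
  by (simp add: pos_part_def zcoeff_neg_part)

lemma pos_part_neg_part: "a = pos_part a + fls_mat (neg_part a)"
  by (simp add: pos_part_def)

lemma polynomial_loop_pos_part: "polynomial_loop (pos_part a)"
  by (simp add: polynomial_loop_def zcoeff_pos_part)

lemma pos_part_polynomial: "polynomial_loop a \<Longrightarrow> pos_part a = a"
  by (rule zcoeff_eqI) (auto simp: zcoeff_pos_part polynomial_loop_def)

lemma neg_part_mem: "a \<in> loop_algebra G \<Longrightarrow> neg_part a \<in> negative_loop_algebra G"
  by (auto simp: negative_loop_algebra_iff fcoeff_neg_part loop_algebra_def)

lemma pos_part_mem: "a \<in> loop_algebra G \<Longrightarrow> pos_part a \<in> loop_algebra G"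
  by (auto simp: loop_algebra_def zcoeff_pos_part)

lemma negative_loop_imp_loop: "X \<in> negative_loop_algebra G \<Longrightarrow> fls_mat X \<in> loop_algebra G"
  by (simp add: negative_loop_algebra_def)

lemma negative_loopI: "fls_mat X \<in> loop_algebra G \<Longrightarrow> fcoeff X 0 = 0 \<Longrightarrow> X \<in> negative_loop_algebra G"
  by (simp add: negative_loop_algebra_def zcoeff_fls_mat)

lemma residue_pairing_finite:
  assumes \<kappa>: "invariant_pairing G \<kappa>" and a: "a \<in> loop_algebra G" and b: "b \<in> loop_algebra G"
    and I: "finite I" "\<And>k. zcoeff a k \<noteq> 0 \<Longrightarrow> zcoeff b (- 1 - k) \<noteq> 0 \<Longrightarrow> k \<in> I"
  shows "residue_pairing \<kappa> a b = (\<Sum>k\<in>I. \<kappa> (zcoeff a k) (zcoeff b (- 1 - k)))"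
  unfolding residue_pairing_def
proof (rule sum.mono_neutral_left[OF I(1)])
  show "\<forall>k\<in>I - {k. zcoeff a k \<noteq> 0 \<and> zcoeff b (- 1 - k) \<noteq> 0}. \<kappa> (zcoeff a k) (zcoeff b (- 1 - k)) = 0"
    using a b pairing_zero[OF \<kappa>] by (auto simp: loop_algebra_def)
qed (use I(2) in auto)

text \<open>Isotropy of g[z]: two exponents with sum -1 are not both non-negative.\<close>

lemma residue_pairing_polynomials:
  assumes "polynomial_loop a" "polynomial_loop b"
  shows "residue_pairing \<kappa> a b = 0"
proof -
  have "zcoeff a k = 0 \<or> zcoeff b (- 1 - k) = 0" for k
    using assms by (cases "k < 0") (auto simp: polynomial_loop_def)
  then show ?thesis unfolding residue_pairing_def by (intro sum.neutral) auto
qed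

text \<open>Isotropy of the complement: two negative exponents have sum at most -2.\<close>

lemma residue_pairing_negatives:
  assumes "X \<in> negative_loop_algebra G" "Y \<in> negative_loop_algebra G"
  shows "residue_pairing \<kappa> (fls_mat X) (fls_mat Y) = 0"
proof -
  have "zcoeff (fls_mat X) k = 0 \<or> zcoeff (fls_mat Y) (- 1 - k) = 0" for k
    using assms by (cases "k < 0") (auto simp: zcoeff_fls_mat negative_loop_algebra_iff)
  then show ?thesis unfolding residue_pairing_def by (intro sum.neutral) auto
qed

lemma residue_pairing_linear:
  assumes "invariant_pairing G \<kappa>" "a \<in> loop_algebra G" "b \<in> loop_algebra G" "c \<in> loop_algebra G"
  shows "residue_pairing \<kappa> (a + b) c = residue_pairing \<kappa> a c + residue_pairing \<kappa> b c"
    and "residue_pairing \<kappa> c (a + b) = residue_pairing \<kappa> c a + residue_pairing \<kappa> c b"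
    and "residue_pairing \<kappa> c (a - b) = residue_pairing \<kappa> c a - residue_pairing \<kappa> c b"
    and "residue_pairing \<kappa> (- a) c = - residue_pairing \<kappa> a c"
    and "residue_pairing \<kappa> c (- a) = - residue_pairing \<kappa> c a"
  using assms fls_pairing_diff_left[of G \<kappa> 0 a c]
  by (simp_all add: residue_pairing_eq[OF assms(1)] loop_algebra_add loop_algebra_diff loop_algebra_minus
      fls_pairing_add_left fls_pairing_add_right fls_pairing_diff_right fls_pairing_minus_right)

lemma fls_pairing_const:
  assumes "invariant_pairing G \<kappa>" "X \<in> lie_algebra G" "Y \<in> lie_algebra G"
  shows "fls_pairing G \<kappa> (cmat fls_const X) (cmat fls_const Y) = fls_const (\<kappa> X Y)"
  using fls_pairing_expansion[OF assms(1) at_inf_const at_inf_const, of X Y] assms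
  by (auto intro: has_laurent_expansion_unique)

text \<open>The constant loops span the loop algebra over the field of Laurent series.\<close>

lemma loop_bilinear_eqI:
  assumes \<kappa>: "invariant_pairing G \<kappa>" and a: "a \<in> loop_algebra G" and b: "b \<in> loop_algebra G"
    and "\<And>X Y. X \<in> lie_algebra G \<Longrightarrow> Y \<in> lie_algebra G \<Longrightarrow> P (cmat fls_const X) (cmat fls_const Y) = (Q (cmat fls_const X) (cmat fls_const Y) :: complex fls)"
    and P: "\<And>S f c. P (\<Sum>x\<in>(S :: nat set). f x) c = (\<Sum>x\<in>S. P (f x) c)" "\<And>S f c. P c (\<Sum>x\<in>(S :: nat set). f x) = (\<Sum>x\<in>S. P c (f x))"
      "\<And>x u c. P (msmult x u) c = x * P u c" "\<And>x u c. P c (msmult x u) = x * P c u"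
    and Q: "\<And>S f c. Q (\<Sum>x\<in>(S :: nat set). f x) c = (\<Sum>x\<in>S. Q (f x) c)" "\<And>S f c. Q c (\<Sum>x\<in>(S :: nat set). f x) = (\<Sum>x\<in>S. Q c (f x))"
      "\<And>x u c. Q (msmult x u) c = x * Q u c" "\<And>x u c. Q c (msmult x u) = x * Q c u"
  shows "P a b = Q a b"
proof -
  obtain d e e' where db: "dual_bases G \<kappa> d e e'" using dual_bases_exist[OF \<kappa>] .
  obtain x where x: "a = (\<Sum>\<alpha><d. msmult (x \<alpha>) (cmat fls_const (e \<alpha>)))" using loop_algebra_expand[OF \<kappa> db a] .
  obtain y where y: "b = (\<Sum>\<alpha><d. msmult (y \<alpha>) (cmat fls_const (e \<alpha>)))" using loop_algebra_expand[OF \<kappa> db b] .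
  have L: "e \<alpha> \<in> lie_algebra G" if "\<alpha> < d" for \<alpha> using db that by (auto simp: dual_bases_def)
  show ?thesis unfolding x y P Q by (intro sum.cong refl) (simp add: assms(4) L)
qed

text \<open>\<open>\<kappa>\<close> is symmetric on the Lie algebra only, and
  \<open>pairing_matrix\<close> need not be a symmetric matrix; hence the reduction to constant
  loops.\<close>

lemma fls_pairing_commute:
  assumes "invariant_pairing G \<kappa>" "a \<in> loop_algebra G" "b \<in> loop_algebra G"
  shows "fls_pairing G \<kappa> a b = fls_pairing G \<kappa> b a"
  by (rule loop_bilinear_eqI[OF assms, where P = "fls_pairing G \<kappa>" and Q = "\<lambda>a b. fls_pairing G \<kappa> b a"])
     (simp_all add: fls_pairing_const[OF assms(1)] invariant_pairingD(3)[OF assms(1)]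
       fls_pairing_sum_left fls_pairing_sum_right fls_pairing_msmult_left fls_pairing_msmult_right)

lemma residue_pairing_commute:
  assumes "invariant_pairing G \<kappa>" "a \<in> loop_algebra G" "b \<in> loop_algebra G"
  shows "residue_pairing \<kappa> a b = residue_pairing \<kappa> b a"
  using assms by (simp add: residue_pairing_eq[OF assms(1)] fls_pairing_commute)

lemma zcoeff_zmonom: "zcoeff (zmonom X k) m = (if m = k then X else 0)"
  by (rule matrix_eqI) (auto simp: zmonom_def)

lemma zmonom_mem: "X \<in> lie_algebra G \<Longrightarrow> zmonom X k \<in> loop_algebra G"
  by (simp add: loop_algebra_def zcoeff_zmonom)

lemma residue_pairing_zmonom:
  assumes "invariant_pairing G \<kappa>" "X \<in> lie_algebra G" "a \<in> loop_algebra G"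
  shows "residue_pairing \<kappa> (zmonom X k) a = \<kappa> X (zcoeff a (- 1 - k))"
  by (subst residue_pairing_finite[OF assms(1) zmonom_mem[OF assms(2)] assms(3), where I = "{k}"])
     (auto simp: zcoeff_zmonom split: if_splits)

lemma zcoeff_sum [simp]: "zcoeff (\<Sum>x\<in>S. f x) k = (\<Sum>x\<in>S. zcoeff (f x) k)"
  by (rule matrix_eqI) (simp add: fls_nth_sum)

lemma zcoeff_vanishes: "\<exists>N. \<forall>k>int N. zcoeff a k = 0" for a :: "complex fls^'n^'n"
proof (intro exI allI impI matrix_eqI)
  fix k i j assume k: "int (\<Sum>i\<in>UNIV. \<Sum>j\<in>UNIV. nat (- fls_subdegree (a $ i $ j))) < k"
  have "nat (- fls_subdegree (a $ i $ j)) \<le> (\<Sum>j\<in>UNIV. nat (- fls_subdegree (a $ i $ j)))"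
    by (rule member_le_sum) auto
  also have "\<dots> \<le> (\<Sum>i\<in>UNIV. \<Sum>j\<in>UNIV. nat (- fls_subdegree (a $ i $ j)))"
    by (rule member_le_sum[of i]) auto
  finally have "- k < fls_subdegree (a $ i $ j)" using k by linarith
  then show "zcoeff a k $ i $ j = 0 $ i $ j" by simp
qed

text \<open>Turns an algebraic loop into an entire function, as needed for representatives on the
  whole plane.\<close>

lemma polynomial_loop_function:
  assumes a: "a \<in> loop_algebra G" "polynomial_loop a"
  obtains F where "mat_holo F UNIV" "\<And>z. F z \<in> lie_algebra G" "at_inf F a"
proof -
  obtain N where N: "\<forall>k>int N. zcoeff a k = 0" using zcoeff_vanishes[of a] by blast
  define F where "F = (\<lambda>z. \<Sum>k\<le>N. msmult (z ^ k) (zcoeff a (int k)))"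
  have mono: "at_inf (\<lambda>z. msmult (z ^ k) X) (zmonom X (int k))" for k X
    unfolding at_inf_def
  proof (intro allI)
    fix i j
    have "(\<lambda>u. X $ i $ j * u powi (- int k)) has_laurent_expansion (fls_const (X $ i $ j) * fls_X_intpow (- int k))"
      by (intro has_laurent_expansion_mult has_laurent_expansion_const has_laurent_expansion_fps_X_power_int)
    then show "(\<lambda>u. msmult (inverse u ^ k) X $ i $ j) has_laurent_expansion zmonom X (int k) $ i $ j"
      by (simp add: zmonom_def power_int_minus power_inverse mult.commute)
  qed
  have "at_inf F (\<Sum>k\<le>N. zmonom (zcoeff a (int k)) (int k))"
    unfolding F_def by (intro at_inf_sum mono)
  moreover have "(\<Sum>k\<le>N. zmonom (zcoeff a (int k)) (int k)) = a"
  proof (rule zcoeff_eqI)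
    fix m
    have "zcoeff (\<Sum>k\<le>N. zmonom (zcoeff a (int k)) (int k)) m = (\<Sum>k\<le>N. if m = int k then zcoeff a m else 0)"
      unfolding zcoeff_sum zcoeff_zmonom by (intro sum.cong) auto
    also have "\<dots> = (if 0 \<le> m \<and> m \<le> int N then zcoeff a m else 0)"
    proof (cases "0 \<le> m")
      case True
      then have "(m = int k) = (k = nat m)" for k by auto
      then show ?thesis using True by (auto simp: nat_le_iff)
    qed (auto intro!: sum.neutral)
    also have "\<dots> = zcoeff a m" using N a(2) by (auto simp: polynomial_loop_def)
    finally show "zcoeff (\<Sum>k\<le>N. zmonom (zcoeff a (int k)) (int k)) m = zcoeff a m" .
  qed
  moreover have "mat_holo F UNIV"
    unfolding F_def by (intro mat_holo_sum mat_holo_msmult mat_holo_const holomorphic_intros)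
  moreover have "F z \<in> lie_algebra G" for z
    unfolding F_def using a(1) by (intro lie_algebra_sum lie_algebra_msmult) (auto simp: loop_algebra_def)
  ultimately show ?thesis using that by metis
qed

section \<open>Tangent vectors attached to polynomial loops and their symplectic pairings\<close>

section \<open>Hamiltonian vectors\<close>

context group_map
begin

definition h :: "complex fps^'n^'n" where "h = r_inf g"
definition hi :: "complex fps^'n^'n" where "hi = r_inf gi"

lemma at_inf_g: "at_inf g (fls_mat h)" and h_G1: "h \<in> G1 G" and h0: "fcoeff h 0 = mat 1"
  using group_maps_at_inf[OF D g] by (auto simp: h_def G1_iff)

lemma at_inf_gi: "at_inf gi (fls_mat hi)" and hi0: "fcoeff hi 0 = mat 1"
proof -
  obtain R where R: "D \<subseteq> ball 0 R" using finite_subset_ball[OF D] by blast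
  have "mat_holo gi {z. R < norm z}" by (rule mat_holo_subset[OF holo_gi]) (use R in auto)
  then obtain A where A: "at_inf gi (fls_mat A)" "fcoeff A 0 = mat 1" using at_inf_fps_exists[OF _ lim_gi] by blast
  then show "at_inf gi (fls_mat hi)" "fcoeff hi 0 = mat 1" using r_inf_eq[OF A(1)] by (auto simp: hi_def)
qed

lemma h_hi: "h ** hi = mat 1" and hi_h: "hi ** h = mat 1"
proof -
  have c: "cmat fls_const (mat 1) = fls_mat (mat 1)" by (rule matrix_eqI) (simp add: mat_nth)
  have "at_inf (\<lambda>z. mat 1) (fls_mat (h ** hi))"
    unfolding fls_mat_mult
    by (rule at_inf_cong[OF _ at_inf_mult[OF at_inf_g at_inf_gi]]) (use eventually_off in eventually_elim, simp add: g_simps)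
  then have "fls_mat (h ** hi) = fls_mat (mat 1)" using at_inf_unique[OF _ at_inf_const] c by metis
  then show "h ** hi = mat 1" by (simp add: fls_mat_inject)
  have "at_inf (\<lambda>z. mat 1) (fls_mat (hi ** h))"
    unfolding fls_mat_mult
    by (rule at_inf_cong[OF _ at_inf_mult[OF at_inf_gi at_inf_g]]) (use eventually_off in eventually_elim, simp add: g_simps)
  then have "fls_mat (hi ** h) = fls_mat (mat 1)" using at_inf_unique[OF _ at_inf_const] c by metis
  then show "hi ** h = mat 1" by (simp add: fls_mat_inject)
qed

definition Ad :: "complex fls^'n^'n \<Rightarrow> complex fls^'n^'n" where
  "Ad a = fls_mat h ** a ** fls_mat hi"

definition Ad' :: "complex fls^'n^'n \<Rightarrow> complex fls^'n^'n" where
  "Ad' a = fls_mat hi ** a ** fls_mat h"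

lemma fls_h: "fls_mat h ** fls_mat hi = mat 1" "fls_mat hi ** fls_mat h = mat 1"
  by (simp_all add: fls_mat_mult[symmetric] h_hi hi_h fls_mat_one)

lemma fls_h_cancel:
  "A ** fls_mat h ** fls_mat hi = A" "A ** fls_mat hi ** fls_mat h = A"
  "fls_mat h ** (fls_mat hi ** A) = A" "fls_mat hi ** (fls_mat h ** A) = A"
  using fls_h by (metis matrix_mul_assoc matrix_mul_lid matrix_mul_rid)+

lemma Ad_Ad': "Ad (Ad' a) = a" and Ad'_Ad: "Ad' (Ad a) = a"
  unfolding Ad_def Ad'_def by (simp_all add: matrix_mul_assoc fls_h_cancel fls_h)

lemma Ad_linear:
  "Ad (a + b) = Ad a + Ad b" "Ad (a - b) = Ad a - Ad b" "Ad (msmult x a) = msmult x (Ad a)"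
  "Ad (\<Sum>x\<in>S. f x) = (\<Sum>x\<in>S. Ad (f x))"
  "Ad' (a + b) = Ad' a + Ad' b" "Ad' (a - b) = Ad' a - Ad' b" "Ad' (msmult x a) = msmult x (Ad' a)"
  "Ad' (\<Sum>x\<in>S. f x) = (\<Sum>x\<in>S. Ad' (f x))"
  unfolding Ad_def Ad'_def
  by (simp_all add: matrix_add_ldistrib matrix_add_rdistrib matrix_diff_ldistrib matrix_diff_rdistrib
      msmult_mult_left msmult_mult_right matrix_sum_left matrix_sum_right)

lemma Ad_at_inf: "at_inf F a \<Longrightarrow> at_inf (\<lambda>z. g z ** F z ** gi z) (Ad a)"
  unfolding Ad_def by (intro at_inf_mult at_inf_g at_inf_gi)

lemma Ad'_at_inf: "at_inf F a \<Longrightarrow> at_inf (\<lambda>z. gi z ** F z ** g z) (Ad' a)"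
  unfolding Ad'_def by (intro at_inf_mult at_inf_g at_inf_gi)

text \<open>For a constant loop this is the expansion of the pointwise adjoint action of
  \<open>g z\<close>. The general case follows because \<open>Ad\<close> is linear over Laurent
  series and constant loops span.\<close>

lemma Ad_loop:
  assumes a: "a \<in> loop_algebra G"
  shows "Ad a \<in> loop_algebra G" "Ad' a \<in> loop_algebra G"
proof -
  obtain d e e' where db: "dual_bases G \<kappa> d e e'" using dual_bases_exist[OF \<kappa>] .
  obtain x where x: "a = (\<Sum>\<alpha><d. msmult (x \<alpha>) (cmat fls_const (e \<alpha>)))" using loop_algebra_expand[OF \<kappa> db a] .
  have L: "e \<alpha> \<in> \<g>" if "\<alpha> < d" for \<alpha> using db that by (auto simp: dual_bases_def)
  have "Ad (cmat fls_const X) \<in> loop_algebra G" if "X \<in> \<g>" for X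
    by (rule loop_algebra_at_inf[OF Ad_at_inf[OF at_inf_const]])
       (use eventually_off in eventually_elim, use that lie_Ad in auto)
  then show "Ad a \<in> loop_algebra G"
    unfolding x Ad_linear using L by (intro loop_algebra_sum loop_algebra_msmult) auto
  have "Ad' (cmat fls_const X) \<in> loop_algebra G" if "X \<in> \<g>" for X
    by (rule loop_algebra_at_inf[OF Ad'_at_inf[OF at_inf_const]])
       (use eventually_off in eventually_elim, use that lie_Ad' in auto)
  then show "Ad' a \<in> loop_algebra G"
    unfolding x Ad_linear using L by (intro loop_algebra_sum loop_algebra_msmult) auto
qed

lemma fls_pairing_Ad:
  assumes "a \<in> loop_algebra G" "b \<in> loop_algebra G"
  shows "fls_pairing G \<kappa> (Ad' a) b = fls_pairing G \<kappa> a (Ad b)"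
proof (rule loop_bilinear_eqI[OF \<kappa> assms, where P = "\<lambda>a b. fls_pairing G \<kappa> (Ad' a) b" and Q = "\<lambda>a b. fls_pairing G \<kappa> a (Ad b)"])
  fix X Y assume X: "X \<in> \<g>" and Y: "Y \<in> \<g>"
  have 1: "(\<lambda>u. \<kappa> (gi (inverse u) ** X ** g (inverse u)) Y) has_laurent_expansion
      fls_pairing G \<kappa> (Ad' (cmat fls_const X)) (cmat fls_const Y)"
    by (rule fls_pairing_expansion[OF \<kappa> Ad'_at_inf[OF at_inf_const] at_inf_const])
       (use eventually_off in eventually_elim, use X Y lie_Ad' in auto)
  have 2: "(\<lambda>u. \<kappa> X (g (inverse u) ** Y ** gi (inverse u))) has_laurent_expansion
      fls_pairing G \<kappa> (cmat fls_const X) (Ad (cmat fls_const Y))"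
    by (rule fls_pairing_expansion[OF \<kappa> at_inf_const Ad_at_inf[OF at_inf_const]])
       (use eventually_off in eventually_elim, use X Y lie_Ad in auto)
  have "eventually (\<lambda>u. \<kappa> (gi (inverse u) ** X ** g (inverse u)) Y = \<kappa> X (g (inverse u) ** Y ** gi (inverse u))) (at 0)"
    using eventually_at_inf[OF eventually_off] by eventually_elim (rule pairing_Ad[OF _ X Y])
  then show "fls_pairing G \<kappa> (Ad' (cmat fls_const X)) (cmat fls_const Y) =
      fls_pairing G \<kappa> (cmat fls_const X) (Ad (cmat fls_const Y))"
    using has_laurent_expansion_unique[OF has_laurent_expansion_transform[OF 1] 2] by blast
qed (simp_all add: Ad_linear fls_pairing_sum_left fls_pairing_sum_right fls_pairing_msmult_left fls_pairing_msmult_right)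

lemma residue_pairing_Ad:
  assumes "a \<in> loop_algebra G" "b \<in> loop_algebra G"
  shows "residue_pairing \<kappa> (Ad' a) b = residue_pairing \<kappa> a (Ad b)"
  using assms by (simp add: residue_pairing_eq[OF \<kappa>] Ad_loop fls_pairing_Ad)

lemma Ad_negative:
  assumes "X \<in> negative_loop_algebra G"
  shows "h ** X ** hi \<in> negative_loop_algebra G" "Ad (fls_mat X) = fls_mat (h ** X ** hi)"
    "hi ** X ** h \<in> negative_loop_algebra G" "Ad' (fls_mat X) = fls_mat (hi ** X ** h)"
proof -
  show 1: "Ad (fls_mat X) = fls_mat (h ** X ** hi)" "Ad' (fls_mat X) = fls_mat (hi ** X ** h)"
    by (simp_all add: Ad_def Ad'_def fls_mat_mult)
  have "fcoeff X 0 = 0" using assms by (simp add: negative_loop_algebra_iff)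
  then have "fcoeff (h ** X ** hi) 0 = 0" "fcoeff (hi ** X ** h) 0 = 0" by (simp_all add: fcoeff_mult_0)
  then show "h ** X ** hi \<in> negative_loop_algebra G" "hi ** X ** h \<in> negative_loop_algebra G"
    using Ad_loop[OF negative_loop_imp_loop[OF assms]] unfolding 1 by (blast intro: negative_loopI)+
qed

lemma eta_at_inf:
  assumes "\<delta> \<in> T"
  obtains E where "at_inf (eta \<delta>) (fls_mat E)" "E \<in> negative_loop_algebra G"
proof -
  obtain R where R: "D \<subseteq> ball 0 R" using finite_subset_ball[OF D] by blast
  have "mat_holo (eta \<delta>) {z. R < norm z}" by (rule mat_holo_subset[OF holo_eta[OF assms]]) (use R in auto)
  then obtain E where E: "at_inf (eta \<delta>) (fls_mat E)" "fcoeff E 0 = 0"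
    using at_inf_fps_exists[OF _ lim_eta[OF assms]] by blast
  have "fls_mat E \<in> loop_algebra G"
    by (rule loop_algebra_at_inf[OF E(1)]) (use eventually_off in eventually_elim, rule lie_eta[OF assms])
  then show ?thesis using that E by (blast intro: negative_loopI)
qed

text \<open>Here data at the points of \<open>D\<close> become the residue pairing at infinity:
  neither function has singularities elsewhere.\<close>

lemma sum_residues_pairing:
  assumes F: "mat_holo F (- D)" "\<And>z. z \<notin> D \<Longrightarrow> F z \<in> \<g>" "at_inf F a"
    and H: "mat_holo H (- D)" "\<And>z. z \<notin> D \<Longrightarrow> H z \<in> \<g>" "at_inf H b"
  shows "(\<Sum>c\<in>D. residue (\<lambda>z. \<kappa> (F z) (H z)) c) = residue_pairing \<kappa> a b"
proof -
  have ev: "eventually (\<lambda>z. F z \<in> \<g> \<and> H z \<in> \<g>) at_infinity"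
    using eventually_off by eventually_elim (use F(2) H(2) in auto)
  have "a \<in> loop_algebra G" "b \<in> loop_algebra G"
    using loop_algebra_at_inf[OF F(3) eventually_mono[OF ev]] loop_algebra_at_inf[OF H(3) eventually_mono[OF ev]]
    by auto
  then have "residue_pairing \<kappa> a b = fls_nth (fls_pairing G \<kappa> a b) 1" by (rule residue_pairing_eq[OF \<kappa>])
  also have "\<dots> = (\<Sum>c\<in>D. residue (\<lambda>z. \<kappa> (F z) (H z)) c)"
    by (rule sum_residues[symmetric, OF D _ fls_pairing_expansion[OF \<kappa> F(3) H(3) ev]])
       (intro pairing_holomorphic[OF \<kappa> F(1) H(1)], use F(2) H(2) in auto)
  finally show ?thesis by simp
qed

text \<open>
  The vector with \<open>(X\<^sup>L, X\<^sup>R) = (- a, b\<^sub>+)\<close> on all of the complex plane, where \<open>b\<^sub>+\<close> is the polynomial part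
  of \<open>b = Ad\<^sub>g\<^sup>-\<^sup>1 a\<close> at infinity; subtracting the polynomial part makes it vanish there.
\<close>

definition is_loop_vector ::
  "complex fls^'n^'n \<Rightarrow> (complex \<Rightarrow> complex^'n^'n) \<Rightarrow> (complex \<Rightarrow> complex^'n^'n) \<Rightarrow> (complex \<Rightarrow> complex^'n^'n) \<Rightarrow> bool" where
  "is_loop_vector a F H \<xi> \<longleftrightarrow> mat_holo F UNIV \<and> (\<forall>z. F z \<in> \<g>) \<and> at_inf F a \<and>
     mat_holo H UNIV \<and> (\<forall>z. H z \<in> \<g>) \<and> at_inf H (pos_part (Ad' a)) \<and>
     (\<forall>z\<in>D. \<xi> z = 0) \<and> (\<forall>z. z \<notin> D \<longrightarrow> \<xi> z = g z ** H z - F z ** g z)"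

lemma loop_vector_exists:
  assumes a: "a \<in> loop_algebra G" "polynomial_loop a"
  obtains F H \<xi> where "is_loop_vector a F H \<xi>"
proof -
  obtain F where F: "mat_holo F UNIV" "\<And>z. F z \<in> \<g>" "at_inf F a" using polynomial_loop_function[OF a] by blast
  obtain H where H: "mat_holo H UNIV" "\<And>z. H z \<in> \<g>" "at_inf H (pos_part (Ad' a))"
    using polynomial_loop_function[OF pos_part_mem[OF Ad_loop(2)[OF a(1)]] polynomial_loop_pos_part] by blast
  have "is_loop_vector a F H (\<lambda>z. if z \<in> D then 0 else g z ** H z - F z ** g z)"
    using F H by (simp add: is_loop_vector_def)
  then show ?thesis by (rule that)
qed

lemma loop_vectorD:
  assumes "is_loop_vector a F H \<xi>"
  shows "mat_holo F UNIV" "F z \<in> \<g>" "at_inf F a" "mat_holo H UNIV" "H z \<in> \<g>" "at_inf H (pos_part (Ad' a))"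
    "z \<in> D \<Longrightarrow> \<xi> z = 0" "z \<notin> D \<Longrightarrow> \<xi> z = g z ** H z - F z ** g z"
  using assms by (auto simp: is_loop_vector_def)

lemma loop_vector_rep:
  assumes "is_loop_vector a F H \<xi>"
  shows "local_rep G D g \<xi> S (\<lambda>z. - F z) H"
  unfolding local_rep_def
proof (intro conjI allI ballI)
  note v' = loop_vectorD[OF assms]
  show "(\<lambda>z. (- F z) $ i $ j) holomorphic_on S" "(\<lambda>z. H z $ i $ j) holomorphic_on S" for i j
    by (rule holomorphic_on_subset[OF mat_holoD[OF mat_holo_minus[OF v'(1)]]], simp)
       (rule holomorphic_on_subset[OF mat_holoD[OF v'(4)]], simp)
  show "- F z \<in> \<g>" "H z \<in> \<g>" for z using v' by (auto intro: lie_algebra_minus)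
  show "\<xi> z = - F z ** g z + g z ** H z" if "z \<in> S - D" for z
    using that v'(8) by (simp add: matrix_minus_left)
qed

lemma loop_vector_loop:
  assumes "is_loop_vector a F H \<xi>"
  shows "a \<in> loop_algebra G"
  by (rule loop_algebra_at_inf[OF loop_vectorD(3)[OF assms]]) (simp add: loop_vectorD(2)[OF assms])

lemma loop_vector_eta:
  assumes v: "is_loop_vector a F H \<xi>" and z: "z \<notin> D"
  shows "eta \<xi> z = g z ** H z ** gi z - F z" "eta \<xi> z \<in> \<g>"
proof -
  note v' = loop_vectorD[OF v]
  show *: "eta \<xi> z = g z ** H z ** gi z - F z"
    by (simp add: eta_def v'(8)[OF z] matrix_diff_rdistrib g_cancel[OF z])
  show "eta \<xi> z \<in> \<g>" unfolding * by (rule lie_algebra_diff[OF lie_Ad[OF z v'(5)] v'(2)])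
qed

text \<open>The first form is used in pairings. The second, from \<open>Ad (Ad' a) = a\<close>,
  shows that the vector vanishes at infinity.\<close>

lemma loop_vector_expansion:
  assumes v: "is_loop_vector a F H \<xi>"
  shows "at_inf (eta \<xi>) (Ad (pos_part (Ad' a)) - a)"
    and "Ad (pos_part (Ad' a)) - a = - Ad (fls_mat (neg_part (Ad' a)))"
proof -
  note v' = loop_vectorD[OF v]
  show "at_inf (eta \<xi>) (Ad (pos_part (Ad' a)) - a)"
    by (rule at_inf_cong[OF _ at_inf_diff[OF Ad_at_inf[OF v'(6)] v'(3)]])
       (use eventually_off in eventually_elim, simp add: loop_vector_eta[OF v])
  show "Ad (pos_part (Ad' a)) - a = - Ad (fls_mat (neg_part (Ad' a)))"
    by (simp add: pos_part_def Ad_linear Ad_Ad')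
qed

lemma loop_vector_tangent:
  assumes v: "is_loop_vector a F H \<xi>"
  shows "\<xi> \<in> T"
proof -
  note v' = loop_vectorD[OF v]
  obtain R where R: "D \<subseteq> ball 0 R" using finite_subset_ball[OF D] by blast
  let ?N = "- (h ** neg_part (Ad' a) ** hi)"
  have neg: "neg_part (Ad' a) \<in> negative_loop_algebra G"
    by (rule neg_part_mem[OF Ad_loop(2)[OF loop_vector_loop[OF v]]])
  have "- fls_mat X = fls_mat (- X)" for X :: "complex fps^'n^'n"
    by (rule matrix_eqI) (simp add: fps_to_fls_uminus)
  then have "at_inf (eta \<xi>) (fls_mat ?N)"
    using loop_vector_expansion[OF v] Ad_negative(2)[OF neg] by simp
  moreover have "fcoeff ?N 0 = 0"
  proof -
    have "fcoeff (h ** neg_part (Ad' a) ** hi) 0 = 0"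
      using Ad_negative(1)[OF neg] by (simp add: negative_loop_algebra_iff)
    then show ?thesis by (simp add: vec_eq_iff)
  qed
  ultimately have lim: "(eta \<xi> \<longlongrightarrow> 0) at_infinity" by (rule at_inf_zero_limit)
  have holo: "mat_holo (eta \<xi>) (- D)"
  proof -
    have "mat_holo (\<lambda>z. g z ** H z ** gi z - F z) (- D)"
      using v'(1,4) by (intro mat_holo_diff mat_holo_mult holo_g holo_gi) (auto elim: mat_holo_subset)
    then show ?thesis by (subst mat_holo_cong) (auto simp: loop_vector_eta[OF v])
  qed
  \<comment> \<open>The polynomial pair \<open>(- F, H)\<close> need not vanish at infinity, so the
    representative there is \<open>(eta \<xi>, 0)\<close>.\<close>
  have "local_rep_inf G D g \<xi> {z. norm z > R} (eta \<xi>) (\<lambda>_. 0)"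
    unfolding local_rep_inf_def local_rep_def
  proof (intro conjI allI ballI)
    fix i j show "(\<lambda>z. eta \<xi> z $ i $ j) holomorphic_on {z. norm z > R}"
      by (rule holomorphic_on_subset[OF mat_holoD[OF holo]]) (use R in auto)
  next
    fix z :: complex assume "z \<in> {z. norm z > R}"
    then have "z \<notin> D" using R by auto
    then show "eta \<xi> z \<in> \<g>" by (rule loop_vector_eta[OF v])
  qed (use lim in \<open>auto simp: eta_g\<close>)
  then show ?thesis
    unfolding tangent_space_def using v'(7) loop_vector_rep[OF v, of UNIV] open_UNIV by blast
qed

text \<open>In the first argument the global representative \<open>- F\<close> enters, and the
  residue theorem applies at once.\<close>

lemma symplectic_form_loop_vector_left:
  assumes v: "is_loop_vector a F H \<xi>" and \<delta>: "\<delta> \<in> T" and E: "at_inf (eta \<delta>) b"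
  shows "symplectic_form G \<kappa> D g \<xi> \<delta> = - residue_pairing \<kappa> a b"
proof -
  note v' = loop_vectorD[OF v]
  have b: "b \<in> loop_algebra G"
    by (rule loop_algebra_at_inf[OF E]) (use eventually_off in eventually_elim, rule lie_eta[OF \<delta>])
  have "symplectic_form G \<kappa> D g \<xi> \<delta> = (\<Sum>c\<in>D. residue (\<lambda>z. \<kappa> (- F z) (eta \<delta> z)) c)"
    by (rule symplectic_form_eq[OF loop_vector_tangent[OF v] \<delta>, where XR = "\<lambda>_. H"])
       (use loop_vector_rep[OF v, of UNIV] in auto)
  also have "\<dots> = residue_pairing \<kappa> (- a) b"
    using v' lie_eta[OF \<delta>]
    by (intro sum_residues_pairing E holo_eta[OF \<delta>] at_inf_minus mat_holo_minus)
       (auto intro: mat_holo_subset lie_algebra_minus)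
  also have "\<dots> = - residue_pairing \<kappa> a b"
    using loop_vector_loop[OF v] b by (intro residue_pairing_linear(4)[OF \<kappa> _ _ b]) auto
  finally show ?thesis .
qed

text \<open>Now the residues contain local representatives of \<open>\<delta>\<close>, which do not
  fit together globally. Up to terms that are holomorphic at \<open>c\<close>, invariance replaces
  them by the global \<open>eta \<delta>\<close>, paired with \<open>?B\<close>; then everything can
  be moved to infinity.\<close>

lemma symplectic_form_loop_vector_right:
  assumes v: "is_loop_vector a F H \<xi>" and \<delta>: "\<delta> \<in> T"
    and E: "at_inf (eta \<delta>) (fls_mat E)" "E \<in> negative_loop_algebra G"
  shows "symplectic_form G \<kappa> D g \<delta> \<xi> = residue_pairing \<kappa> a (fls_mat E)"
proof -
  note v' = loop_vectorD[OF v]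
  have a: "a \<in> loop_algebra G" by (rule loop_vector_loop[OF v])
  have Eloop: "fls_mat E \<in> loop_algebra G" by (rule negative_loop_imp_loop[OF E(2)])
  let ?B = "\<lambda>z. g z ** H z ** gi z"
  have "\<forall>c. \<exists>S XL XR. open S \<and> c \<in> S \<and> local_rep G D g \<delta> S XL XR"
    using \<delta> by (auto simp: tangent_space_def)
  then obtain S XL XR where S: "\<And>c. open (S c)" "\<And>c. c \<in> S c" "\<And>c. local_rep G D g \<delta> (S c) (XL c) (XR c)"
    by metis
  have holB: "mat_holo ?B (- D)"
    using v'(4) by (intro mat_holo_mult holo_g holo_gi) (auto elim: mat_holo_subset)
  have "symplectic_form G \<kappa> D g \<delta> \<xi> = (\<Sum>c\<in>D. residue (\<lambda>z. \<kappa> (XL c z) (eta \<xi> z)) c)"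
    using S by (intro symplectic_form_eq[OF \<delta> loop_vector_tangent[OF v], where XR = XR]) blast
  also have "\<dots> = (\<Sum>c\<in>D. residue (\<lambda>z. \<kappa> (eta \<delta> z) (?B z)) c)"
  proof (intro sum.cong refl)
    fix c assume c: "c \<in> D"
    define U where "U = S c \<inter> - (D - {c})"
    have "open U" unfolding U_def using S(1) D by (intro open_Int open_Compl finite_imp_closed) auto
    then have U: "open U" "c \<in> U" "U - {c} \<subseteq> - D" "U \<subseteq> S c" using S(2) by (auto simp: U_def)
    note X = local_repD[OF local_rep_subset[OF S(3) U(4)]]
    let ?Q = "\<lambda>z. - \<kappa> (XL c z) (F z) - \<kappa> (XR c z) (H z)"
    have holQ: "?Q holomorphic_on U"
      using v' X by (intro holomorphic_intros pairing_holomorphic[OF \<kappa>]) (auto elim: mat_holo_subset)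
    have holB': "(\<lambda>z. \<kappa> (eta \<delta> z) (?B z)) holomorphic_on U - {c}"
      using U lie_eta[OF \<delta>] v' lie_Ad
      by (intro pairing_holomorphic[OF \<kappa>] mat_holo_subset[OF holo_eta[OF \<delta>]] mat_holo_subset[OF holB]) auto
    have eq: "\<kappa> (XL c z) (eta \<xi> z) = \<kappa> (eta \<delta> z) (?B z) + ?Q z" if z: "z \<in> U - {c}" for z
    proof -
      have zD: "z \<notin> D" and zU: "z \<in> U" using z U by auto
      have B: "?B z \<in> \<g>" using lie_Ad[OF zD] v' by simp
      have e1: "eta \<delta> z = XL c z + g z ** XR c z ** gi z"
        using eta_local_rep(1)[OF S(3) _ zD] zU U by auto
      have "\<kappa> (eta \<delta> z) (?B z) = \<kappa> (XL c z) (?B z) + \<kappa> (g z ** XR c z ** gi z) (?B z)"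
        unfolding e1 using X(3,4)[OF zU] lie_Ad[OF zD] B by (intro invariant_pairingD(1)[OF \<kappa>])
      also have "\<kappa> (g z ** XR c z ** gi z) (?B z) = \<kappa> (XR c z) (H z)"
        using invariant_pairingD(4)[OF \<kappa> group_mapsD(2)[OF g zD] X(4)[OF zU] v'(5)] by (simp add: gi_def)
      finally have 1: "\<kappa> (eta \<delta> z) (?B z) = \<kappa> (XL c z) (?B z) + \<kappa> (XR c z) (H z)" .
      have "\<kappa> (XL c z) (?B z - F z + F z) = \<kappa> (XL c z) (?B z - F z) + \<kappa> (XL c z) (F z)"
        using B v' X(3)[OF zU] by (intro pairing_add_right lie_algebra_diff)
      then show ?thesis using 1 loop_vector_eta(1)[OF v zD] by simp
    qed
    have "eventually (\<lambda>z. z \<in> U - {c}) (at c)" using U by (intro eventually_at_in_open) auto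
    then have "residue (\<lambda>z. \<kappa> (XL c z) (eta \<xi> z)) c = residue (\<lambda>z. \<kappa> (eta \<delta> z) (?B z) + ?Q z) c"
      by (intro residue_cong) (auto elim!: eventually_mono simp: eq)
    also have "\<dots> = residue (\<lambda>z. \<kappa> (eta \<delta> z) (?B z)) c + residue ?Q c"
      using U holB' holQ by (intro residue_add) (auto intro: holomorphic_on_subset)
    also have "residue ?Q c = 0" using U holQ by (intro residue_holo)
    finally show "residue (\<lambda>z. \<kappa> (XL c z) (eta \<xi> z)) c = residue (\<lambda>z. \<kappa> (eta \<delta> z) (?B z)) c" by simp
  qed
  also have "\<dots> = residue_pairing \<kappa> (fls_mat E) (Ad (pos_part (Ad' a)))"
    using lie_eta[OF \<delta>] lie_Ad v'
    by (intro sum_residues_pairing holo_eta[OF \<delta>] E holB Ad_at_inf) auto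
  \<comment> \<open>The polynomial part is traded for \<open>a\<close> minus a negative loop, which
    pairs to zero with the negative loop \<open>E\<close>.\<close>
  also have "Ad (pos_part (Ad' a)) = a - Ad (fls_mat (neg_part (Ad' a)))"
    using loop_vector_expansion(2)[OF v] by (simp add: algebra_simps)
  also have "residue_pairing \<kappa> (fls_mat E) \<dots> =
      residue_pairing \<kappa> (fls_mat E) a - residue_pairing \<kappa> (fls_mat E) (Ad (fls_mat (neg_part (Ad' a))))"
    using a Ad_loop negative_loop_imp_loop[OF neg_part_mem]
    by (intro residue_pairing_linear(3)[OF \<kappa> _ _ Eloop]) auto
  also have "residue_pairing \<kappa> (fls_mat E) (Ad (fls_mat (neg_part (Ad' a)))) = 0"
    using Ad_negative[OF neg_part_mem[OF Ad_loop(2)[OF a]]] residue_pairing_negatives[OF E(2)] by simp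
  finally show ?thesis using residue_pairing_commute[OF \<kappa> Eloop a] by simp
qed

end

section \<open>Differentials of pulled-back functions and uniqueness of Hamiltonian vectors\<close>

section \<open>Differentials of regular functions\<close>

abbreviation coords :: "complex fps^'n^'n \<Rightarrow> nat \<times> 'n \<times> 'n \<Rightarrow> complex" where
  "coords A \<equiv> (\<lambda>(k, i, j). fps_nth (A $ i $ j) k)"

lemma coords_msmult: "coords (msmult (fps_const c) A) v = c * coords A v"
  and coords_sum: "coords (\<Sum>x\<in>S. f x) v = (\<Sum>x\<in>S. coords (f x) v)"
  by (cases v; simp add: fps_sum_nth)+

definition differential ::
  "(nat \<times> 'n \<times> 'n) pexpr \<Rightarrow> complex fps^'n^'n \<Rightarrow> complex fps^'n^'n \<Rightarrow> complex" where
  "differential P A B = pder (\<lambda>c. c) (coords A) (coords B) P"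

lemma differential_sum: "differential P A (\<Sum>x\<in>S. f x) = (\<Sum>x\<in>S. differential P A (f x))"
  unfolding differential_def coords_sum[abs_def] by (rule pder_sum)

lemma differential_msmult: "differential P A (msmult (fps_const c) B) = c * differential P A B"
  unfolding differential_def coords_msmult[abs_def] by (rule pder_cmult)

lemma peval_coords_has_derivative:
  assumes "\<And>k i j. ((\<lambda>t. fcoeff (A t) k $ i $ j) has_field_derivative fcoeff B k $ i $ j) (at t)"
  shows "((\<lambda>t. peval (\<lambda>c. c) (coords (A t)) P) has_field_derivative differential P (A t) B) (at t)"
  unfolding differential_def
proof (rule peval_has_derivative)
  fix v show "((\<lambda>t. coords (A t) v) has_field_derivative coords B v) (at t)"
    using assms by (cases v) simp
qed

definition fmonom :: "complex^'n^'n \<Rightarrow> nat \<Rightarrow> complex fps^'n^'n" where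
  "fmonom X k = (\<chi> i j. fps_const (X $ i $ j) * fps_X ^ k)"

lemma fcoeff_fmonom: "fcoeff (fmonom X k) m = (if m = k then X else 0)"
  by (rule matrix_eqI) (simp add: fmonom_def)

lemma fmonom_sum_msmult:
  "fmonom (\<Sum>x\<in>S. msmult (c x) (f x)) k = (\<Sum>x\<in>S. msmult (fps_const (c x)) (fmonom (f x) k))"
  by (rule fps_matrix_eqI) (simp add: fcoeff_fmonom vec_eq_iff)

lemma fmonom_negative: "X \<in> lie_algebra G \<Longrightarrow> fmonom X (Suc k) \<in> negative_loop_algebra G"
  by (simp add: negative_loop_algebra_iff fcoeff_fmonom)

text \<open>
  The gradient is read off from the differential along \<open>e\<^sub>\<alpha> z\<^sup>-\<^sup>1\<^sup>-\<^sup>k\<close>; it is a polynomial because a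
  regular function depends on finitely many Taylor coefficients only.
\<close>

lemma gradient_exists:
  assumes \<kappa>: "invariant_pairing G \<kappa>"
  shows "\<exists>a\<in>loop_algebra G. polynomial_loop a \<and>
    (\<forall>X\<in>negative_loop_algebra G. differential P h (X ** h) = residue_pairing \<kappa> a (fls_mat X))"
proof -
  obtain d e e' where db: "dual_bases G \<kappa> d e e'" using dual_bases_exist[OF \<kappa>] .
  have L: "e \<alpha> \<in> lie_algebra G" "e' \<alpha> \<in> lie_algebra G" if "\<alpha> < d" for \<alpha>
    using db that by (auto simp: dual_bases_def)
  \<comment> \<open>The largest Taylor index that occurs in \<open>P\<close>; the 0 keeps
    \<open>Max\<close> defined when \<open>P\<close> has no variables.\<close>
  define N where "N = Max (insert 0 (fst ` set_pexpr P))"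
  have N: "fst v \<le> N" if "v \<in> set_pexpr P" for v
    unfolding N_def using that by (intro Max_ge) auto
  define l where "l = (\<lambda>k Y. differential P h (fmonom Y (Suc k) ** h))"
  \<comment> \<open>\<open>c k\<close> represents the functional \<open>l k\<close> under
    \<open>\<kappa>\<close>. It becomes the coefficient of \<open>z ^ k\<close>, since
    \<open>z ^ k\<close> pairs with the power of index \<open>Suc k\<close> in
    \<open>1 / z\<close>.\<close>
  define c where "c = (\<lambda>k. \<Sum>\<alpha><d. msmult (l k (e \<alpha>)) (e' \<alpha>))"
  have cL: "c k \<in> lie_algebra G" for k
    unfolding c_def using L by (intro lie_algebra_sum lie_algebra_msmult) auto
  have l: "l k Y = \<kappa> (c k) Y" if Y: "Y \<in> lie_algebra G" for k Y
  proof -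
    have "l k Y = l k (\<Sum>\<alpha><d. msmult (\<kappa> Y (e' \<alpha>)) (e \<alpha>))"
      using dual_bases_expand[OF \<kappa> db Y] by simp
    also have "\<dots> = (\<Sum>\<alpha><d. \<kappa> Y (e' \<alpha>) * l k (e \<alpha>))"
      by (simp add: l_def fmonom_sum_msmult matrix_sum_left msmult_mult_left differential_sum differential_msmult)
    also have "\<dots> = (\<Sum>\<alpha><d. \<kappa> (msmult (l k (e \<alpha>)) (e' \<alpha>)) Y)"
      using L Y by (intro sum.cong refl) (simp add: invariant_pairingD(2)[OF \<kappa>] invariant_pairingD(3)[OF \<kappa> _ Y])
    also have "\<dots> = \<kappa> (c k) Y"
      unfolding c_def using L Y by (subst pairing_sum_left[OF \<kappa>]) (auto intro: lie_algebra_msmult)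
    finally show ?thesis .
  qed
  define a where "a = (\<Sum>k<N. zmonom (c k) (int k))"
  have a: "a \<in> loop_algebra G" unfolding a_def by (intro loop_algebra_sum zmonom_mem cL)
  have za: "zcoeff a m = (if 0 \<le> m \<and> nat m < N then c (nat m) else 0)" for m
  proof -
    have "zcoeff a m = (\<Sum>k<N. if m = int k then c k else 0)"
      unfolding a_def zcoeff_sum zcoeff_zmonom ..
    also have "\<dots> = (if 0 \<le> m \<and> nat m < N then c (nat m) else 0)"
    proof (cases "0 \<le> m")
      case True
      then have "(m = int k) = (nat m = k)" for k by auto
      then show ?thesis using True by simp
    qed (auto intro!: sum.neutral)
    finally show ?thesis .
  qed
  have "differential P h (X ** h) = residue_pairing \<kappa> a (fls_mat X)" if X: "X \<in> negative_loop_algebra G" for X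
  proof -
    have XL: "fcoeff X k \<in> lie_algebra G" "fcoeff X 0 = 0" for k
      using X by (auto simp: negative_loop_algebra_iff)
    \<comment> \<open>A truncation of \<open>X\<close>: it agrees with \<open>X\<close> up to index
      \<open>N\<close>, hence so do the products with \<open>h\<close>, and \<open>P\<close> sees no
      more.\<close>
    let ?X' = "\<Sum>k<N. fmonom (fcoeff X (Suc k)) (Suc k)"
    have "fcoeff X m = fcoeff ?X' m" if "m \<le> N" for m
    proof (cases m)
      case (Suc m')
      have "fcoeff ?X' m = (\<Sum>k<N. if k = m' then fcoeff X m else 0)"
        unfolding fcoeff_sum fcoeff_fmonom Suc by (intro sum.cong) auto
      then show ?thesis using that Suc by simp
    qed (simp add: XL(2) fcoeff_fmonom)
    then have co: "fcoeff (X ** h) m = fcoeff (?X' ** h) m" if "m \<le> N" for m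
      using that by (intro fcoeff_mult_cong(2)) auto
    have "coords (X ** h) v = coords (?X' ** h) v" if v: "v \<in> set_pexpr P" for v
    proof -
      obtain k i j where vk: "v = (k, i, j)" by (cases v)
      have "fcoeff (X ** h) k $ i $ j = fcoeff (?X' ** h) k $ i $ j" using co[of k] N[OF v] vk by simp
      then show ?thesis by (simp add: vk)
    qed
    then have "differential P h (X ** h) = differential P h (?X' ** h)"
      unfolding differential_def by (rule pder_cong)
    also have "\<dots> = (\<Sum>k<N. \<kappa> (c k) (fcoeff X (Suc k)))"
      by (simp add: matrix_sum_left differential_sum l[OF XL(1), symmetric] l_def)
    also have "\<dots> = (\<Sum>m\<in>int ` {..<N}. \<kappa> (zcoeff a m) (zcoeff (fls_mat X) (- 1 - m)))"
      by (subst sum.reindex) (auto simp: za zcoeff_fls_mat nat_add_distrib intro!: sum.cong)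
    also have "\<dots> = residue_pairing \<kappa> a (fls_mat X)"
      by (rule residue_pairing_finite[OF \<kappa> a negative_loop_imp_loop[OF X], symmetric])
         (auto simp: za image_iff split: if_splits intro!: bexI[of _ "nat _"])
    finally show ?thesis .
  qed
  moreover have "polynomial_loop a" by (simp add: polynomial_loop_def za)
  ultimately show ?thesis using a by blast
qed

context group_map
begin

text \<open>A Taylor coefficient at infinity is an integral over one circle that avoids
  \<open>D\<close>, so uniform convergence of the difference quotients on that circle
  suffices.\<close>

lemma r_inf_curve_has_derivative:
  assumes \<gamma>: "curve_with_velocity G D g \<delta> \<gamma>" and \<delta>: "\<delta> \<in> T"
    and E: "at_inf (eta \<delta>) (fls_mat E)"
  shows "((\<lambda>t. fcoeff (r_inf (\<gamma> t)) k $ i $ j) has_field_derivative fcoeff (E ** h) k $ i $ j) (at 0)"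
proof -
  have \<gamma>': "\<gamma> 0 = g" "\<And>t. \<gamma> t \<in> group_maps G D"
    "\<And>K. closed K \<Longrightarrow> K \<inter> D = {} \<Longrightarrow> uniform_limit K (\<lambda>t z. msmult (1 / t) (\<gamma> t z - g z)) \<delta> (at 0)"
    using \<gamma> by (auto simp: curve_with_velocity_def)
  obtain R1 where R1: "0 < R1" "D \<subseteq> ball 0 R1" using finite_subset_ball[OF D] .
  define R where "R = R1 + 1"
  have R: "R1 < R" "0 < R" using R1 by (auto simp: R_def)
  have sph: "sphere 0 R \<inter> D = {}" using R R1 by auto
  \<comment> \<open>The coefficient of index \<open>k\<close> in \<open>1 / z\<close> is the residue
    at infinity of \<open>F\<close> times \<open>z\<close> to the power \<open>k - 1\<close>; this
    exponent is -1 for \<open>k = 0\<close>, hence the integer.\<close>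
  define m where "m = int k - 1"
  have coeff: "((\<lambda>z. F z $ i $ j * z powi m) has_contour_integral (2 * of_real pi * \<i> * (fcoeff A k $ i $ j))) (circlepath 0 R)"
    if hol: "mat_holo F {z. R1 < norm z}" and exp: "at_inf F (fls_mat A)" for F and A :: "complex fps^'n^'n"
  proof -
    have ex1: "(\<lambda>u. F (inverse u) $ i $ j * u powi (- m)) has_laurent_expansion fls_shift (- (- m)) (fps_to_fls (A $ i $ j))"
      by (rule has_laurent_expansion_shift) (use exp in \<open>simp add: at_inf_def\<close>)
    have ex: "(\<lambda>u. F (inverse u) $ i $ j * inverse u powi m) has_laurent_expansion fls_shift m (fps_to_fls (A $ i $ j))"
      using ex1 by (simp add: power_int_minus power_int_inverse)
    have hol1: "(\<lambda>z. F z $ i $ j * z powi m) holomorphic_on {z. R1 < norm z}"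
      using R1(1) by (intro holomorphic_intros mat_holoD[OF hol]) auto
    show ?thesis
      using has_contour_integral_circle_at_infinity[OF hol1 R1(1) R(1) ex] by (simp add: m_def)
  qed
  have holg: "mat_holo (\<gamma> t) {z. R1 < norm z}" for t by (rule group_maps_holo_outside[OF \<gamma>'(2) R1(2)])
  note cg = coeff[OF holg group_maps_at_inf(1)[OF D \<gamma>'(2)]]
  have holo_d: "mat_holo \<delta> {z. R1 < norm z}"
  proof -
    have "mat_holo (\<lambda>z. eta \<delta> z ** g z) (- D)" by (intro mat_holo_mult holo_eta[OF \<delta>] holo_g)
    then have "mat_holo \<delta> (- D)" by (subst mat_holo_cong[of _ _ "\<lambda>z. eta \<delta> z ** g z"]) (auto simp: eta_g)
    then show ?thesis by (rule mat_holo_subset) (use R1 in auto)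
  qed
  have exp_d: "at_inf \<delta> (fls_mat (E ** h))"
    unfolding fls_mat_mult
    by (rule at_inf_cong[OF _ at_inf_mult[OF E at_inf_g]]) (use eventually_off in eventually_elim, simp add: eta_g)
  note cd = coeff[OF holo_d exp_d]
  let ?q = "\<lambda>t z. msmult (1 / t) (\<gamma> t z - g z) $ i $ j * z powi m"
  let ?c = "\<lambda>t. fcoeff (r_inf (\<gamma> t)) k $ i $ j"
  have q: "(?q t has_contour_integral (2 * of_real pi * \<i> * ((?c t - ?c 0) / t))) (circlepath 0 R)" for t
  proof -
    have "((\<lambda>z. (1 / t) * (\<gamma> t z $ i $ j * z powi m - \<gamma> 0 z $ i $ j * z powi m)) has_contour_integral
        (1 / t) * (2 * of_real pi * \<i> * ?c t - 2 * of_real pi * \<i> * ?c 0)) (circlepath 0 R)"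
      by (intro has_contour_integral_lmul has_contour_integral_diff cg)
    moreover have "(\<lambda>z. (1 / t) * (\<gamma> t z $ i $ j * z powi m - \<gamma> 0 z $ i $ j * z powi m)) = ?q t"
      by (simp add: \<gamma>'(1) algebra_simps)
    moreover have "(1 / t) * (2 * of_real pi * \<i> * ?c t - 2 * of_real pi * \<i> * ?c 0) =
        2 * of_real pi * \<i> * ((?c t - ?c 0) / t)"
      by (simp add: diff_divide_distrib right_diff_distrib)
    ultimately show ?thesis by (simp only:)
  qed
  have "uniform_limit (sphere 0 R) ?q (\<lambda>z. \<delta> z $ i $ j * z powi m) (at 0)"
    unfolding uniform_limit_iff
  proof (intro allI impI)
    fix \<epsilon> :: real assume \<epsilon>: "0 < \<epsilon>"
    have Rm: "0 < R powi m" using R by simp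
    have "eventually (\<lambda>t. \<forall>z\<in>sphere 0 R. dist (msmult (1 / t) (\<gamma> t z - g z)) (\<delta> z) < \<epsilon> / R powi m) (at 0)"
      using \<gamma>'(3)[OF _ sph] \<epsilon> Rm by (simp add: uniform_limit_iff)
    then show "eventually (\<lambda>t. \<forall>z\<in>sphere 0 R. dist (?q t z) (\<delta> z $ i $ j * z powi m) < \<epsilon>) (at 0)"
    proof eventually_elim
      case (elim t)
      show ?case
      proof
        fix z :: complex assume z: "z \<in> sphere 0 R"
        have "?q t z - \<delta> z $ i $ j * z powi m = (msmult (1 / t) (\<gamma> t z - g z) - \<delta> z) $ i $ j * z powi m"
          by (simp only: vector_minus_component left_diff_distrib)
        moreover have "norm (z powi m) = R powi m" using z by (simp add: norm_power_int)
        ultimately have "dist (?q t z) (\<delta> z $ i $ j * z powi m) =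
            norm ((msmult (1 / t) (\<gamma> t z - g z) - \<delta> z) $ i $ j) * R powi m"
          by (simp only: dist_norm norm_mult)
        also have "\<dots> \<le> dist (msmult (1 / t) (\<gamma> t z - g z)) (\<delta> z) * R powi m"
          unfolding dist_norm using Rm by (intro mult_right_mono entry_le_norm) auto
        also have "\<dots> < \<epsilon>" using elim z Rm by (simp add: pos_less_divide_eq)
        finally show "dist (?q t z) (\<delta> z $ i $ j * z powi m) < \<epsilon>" .
      qed
    qed
  qed
  moreover have "eventually (\<lambda>t. ?q t contour_integrable_on circlepath 0 R) (at 0)"
    by (intro always_eventually allI) (rule has_contour_integral_integrable[OF q])
  ultimately have "((\<lambda>t. contour_integral (circlepath 0 R) (?q t)) \<longlongrightarrow>
      contour_integral (circlepath 0 R) (\<lambda>z. \<delta> z $ i $ j * z powi m)) (at 0)"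
    using R(2) by (intro contour_integral_uniform_limit_circlepath(2)) auto
  then have "((\<lambda>t. 2 * of_real pi * \<i> * ((?c t - ?c 0) / t)) \<longlongrightarrow>
      2 * of_real pi * \<i> * fcoeff (E ** h) k $ i $ j) (at 0)"
    by (simp only: contour_integral_unique[OF q] contour_integral_unique[OF cd])
  then have "((\<lambda>t. (2 * of_real pi * \<i> * ((?c t - ?c 0) / t)) / (2 * of_real pi * \<i>)) \<longlongrightarrow>
      (2 * of_real pi * \<i> * fcoeff (E ** h) k $ i $ j) / (2 * of_real pi * \<i>)) (at 0)"
    by (rule tendsto_divide[OF _ tendsto_const]) simp
  then have "((\<lambda>t. (?c (0 + t) - ?c 0) / t) \<longlongrightarrow> fcoeff (E ** h) k $ i $ j) (at 0)" by simp
  then show ?thesis unfolding DERIV_def .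
qed

lemma differential_along_curve:
  assumes f: "\<And>A. A \<in> G1 G \<Longrightarrow> f A = peval (\<lambda>c. c) (coords A) P"
    and \<gamma>: "curve_with_velocity G D g \<delta> \<gamma>" and \<delta>: "\<delta> \<in> T" and E: "at_inf (eta \<delta>) (fls_mat E)"
  shows "((\<lambda>t. f (r_inf (\<gamma> t))) has_field_derivative differential P h (E ** h)) (at 0)"
proof -
  have "\<gamma> 0 = g" "\<And>t. \<gamma> t \<in> group_maps G D" using \<gamma> by (auto simp: curve_with_velocity_def)
  then have "f (r_inf (\<gamma> t)) = peval (\<lambda>c. c) (coords (r_inf (\<gamma> t))) P" for t
    using f group_maps_at_inf(2)[OF D] by blast
  moreover have "((\<lambda>t. peval (\<lambda>c. c) (coords (r_inf (\<gamma> t))) P) has_field_derivative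
      differential P (r_inf (\<gamma> 0)) (E ** h)) (at 0)"
    by (rule peval_coords_has_derivative[OF r_inf_curve_has_derivative[OF \<gamma> \<delta> E]])
  ultimately show ?thesis using \<open>\<gamma> 0 = g\<close> by (simp add: h_def)
qed

text \<open>The representative in g[z] of the left gradient. The polynomial is kept because
  derivatives along arbitrary curves are read off from it, not only those along
  exponentials.\<close>

definition is_gradient :: "(complex fps^'n^'n \<Rightarrow> complex) \<Rightarrow> complex fls^'n^'n \<Rightarrow> bool" where
  "is_gradient f a \<longleftrightarrow> a \<in> loop_algebra G \<and> polynomial_loop a \<and>
     (\<exists>P. (\<forall>A\<in>G1 G. f A = peval (\<lambda>c. c) (coords A) P) \<and>
       (\<forall>X\<in>negative_loop_algebra G. differential P h (X ** h) = residue_pairing \<kappa> a (fls_mat X)))"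

lemma is_gradient_exists:
  assumes "f \<in> regular_functions G"
  obtains a where "is_gradient f a"
proof -
  obtain P where P: "\<forall>A\<in>G1 G. f A = peval (\<lambda>c. c) (coords A) P"
    using assms unfolding regular_functions_def by blast
  obtain a where "a \<in> loop_algebra G" "polynomial_loop a"
    "\<forall>X\<in>negative_loop_algebra G. differential P h (X ** h) = residue_pairing \<kappa> a (fls_mat X)"
    using gradient_exists[OF \<kappa>] by blast
  then have "is_gradient f a" using P unfolding is_gradient_def by blast
  then show ?thesis by (rule that)
qed

lemma loop_vector_hamiltonian:
  assumes a: "is_gradient f a" and v: "is_loop_vector a F H \<xi>"
  shows "is_hamiltonian_vector G \<kappa> D (\<lambda>h. f (r_inf h)) g \<xi>"
  unfolding is_hamiltonian_vector_def has_differential_value_def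
proof (intro conjI ballI allI impI)
  show "\<xi> \<in> T" by (rule loop_vector_tangent[OF v])
  fix \<delta> \<gamma> assume \<delta>: "\<delta> \<in> T" and \<gamma>: "curve_with_velocity G D g \<delta> \<gamma>"
  obtain P where P: "\<And>A. A \<in> G1 G \<Longrightarrow> f A = peval (\<lambda>c. c) (coords A) P"
    and aP: "\<And>X. X \<in> negative_loop_algebra G \<Longrightarrow> differential P h (X ** h) = residue_pairing \<kappa> a (fls_mat X)"
    using a by (auto simp: is_gradient_def)
  obtain E where E: "at_inf (eta \<delta>) (fls_mat E)" "E \<in> negative_loop_algebra G" using eta_at_inf[OF \<delta>] .
  show "((\<lambda>t. f (r_inf (\<gamma> t))) has_field_derivative symplectic_form G \<kappa> D g \<delta> \<xi>) (at 0)"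
    using differential_along_curve[OF P \<gamma> \<delta> E(1)]
    by (simp add: aP[OF E(2)] symplectic_form_loop_vector_right[OF v \<delta> E])
qed

text \<open>Equal expansions mean equality near infinity; the complement of the finite set
  \<open>D\<close> is connected, so the identity theorem spreads it.\<close>

lemma tangent_vector_eqI:
  assumes \<xi>: "\<xi> \<in> T" "\<xi>' \<in> T" and E: "at_inf (eta \<xi>) A" "at_inf (eta \<xi>') A"
  shows "\<xi> = \<xi>'"
proof
  fix z
  obtain R where R: "D \<subseteq> ball 0 R" using finite_subset_ball[OF D] by blast
  have "eta \<xi> z $ i $ j = eta \<xi>' z $ i $ j" if z: "z \<notin> D" for i j
  proof -
    let ?d = "\<lambda>z. eta \<xi> z $ i $ j - eta \<xi>' z $ i $ j"
    have hol: "?d holomorphic_on - D" by (intro holomorphic_on_diff mat_holoD holo_eta \<xi>)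
    have "(\<lambda>u. ?d (inverse u)) has_laurent_expansion A $ i $ j - A $ i $ j"
      by (intro has_laurent_expansion_diff) (use E in \<open>auto simp: at_inf_def\<close>)
    then have "eventually (\<lambda>u. ?d (inverse u) = 0) (at 0)"
      by (simp add: has_laurent_expansion_def)
    then obtain r where r: "0 < r" "\<And>u. u \<noteq> 0 \<Longrightarrow> norm u < r \<Longrightarrow> ?d (inverse u) = 0"
      unfolding eventually_at by (auto simp: dist_norm)
    have zero: "?d w = 0" if "norm w > max R (1 / r)" for w
    proof -
      have w: "norm w > 1 / r" "w \<noteq> 0" using that r(1) by (auto simp: less_le_trans[of 0 "1 / r"])
      then have "inverse (norm w) < r" using r(1) by (simp add: inverse_eq_divide field_simps)
      then have "norm (inverse w) < r" by (simp add: norm_inverse)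
      then show ?thesis using r(2)[of "inverse w"] w by simp
    qed
    let ?S = "{w :: complex. norm w > max R (1 / r)}"
    have "connected (- D)"
      unfolding Compl_eq_Diff_UNIV using D by (intro connected_open_delete_finite connected_UNIV) auto
    have "?d z = 0"
    proof (rule analytic_continuation_open[of ?S "- D" ?d "\<lambda>_. 0"])
      show "open ?S" by (intro open_Collect_less continuous_intros)
      have "max R (1 / r) < norm (of_real (max R (1 / r) + 1) :: complex)"
        unfolding norm_of_real by linarith
      then have "of_real (max R (1 / r) + 1) \<in> ?S" by blast
      then show "?S \<noteq> {}" by blast
      show "?S \<subseteq> - D" using R by auto
    qed (use hol open_off \<open>connected (- D)\<close> z zero in auto)
    then show ?thesis by simp
  qed
  then have "z \<notin> D \<Longrightarrow> eta \<xi> z = eta \<xi>' z" by (simp add: vec_eq_iff)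
  then show "\<xi> z = \<xi>' z"
    using \<xi> eta_g[of z \<xi>] eta_g[of z \<xi>'] by (cases "z \<in> D") (auto simp: tangent_space_def)
qed

lemma hamiltonian_vector_eq:
  assumes a: "is_gradient f a" and v: "is_loop_vector a F H \<xi>"
  shows "hamiltonian_vector G \<kappa> D (\<lambda>h. f (r_inf h)) g = \<xi>"
  unfolding hamiltonian_vector_def
proof (rule the_equality)
  show ham: "is_hamiltonian_vector G \<kappa> D (\<lambda>h. f (r_inf h)) g \<xi>" by (rule loop_vector_hamiltonian[OF a v])
  fix \<xi>' assume ham': "is_hamiltonian_vector G \<kappa> D (\<lambda>h. f (r_inf h)) g \<xi>'"
  have T: "\<xi> \<in> T" "\<xi>' \<in> T" using ham ham' by (auto simp: is_hamiltonian_vector_def)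
  have same: "symplectic_form G \<kappa> D g \<delta> \<xi> = symplectic_form G \<kappa> D g \<delta> \<xi>'" if \<delta>: "\<delta> \<in> T" for \<delta>
  proof -
    \<comment> \<open>Both candidates prescribe the derivative of the function along this one
      curve.\<close>
    obtain \<gamma> where \<gamma>: "curve_with_velocity G D g \<delta> \<gamma>"
      using curve_with_velocity_exists[OF G D g tangent_lie_maps[OF \<delta>], of \<delta>] \<delta>
      by (auto simp: tangent_space_def eta_g)
    show ?thesis
      using ham ham' \<delta> \<gamma> unfolding is_hamiltonian_vector_def has_differential_value_def
      by (blast intro: DERIV_unique)
  qed
  obtain E where E: "at_inf (eta \<xi>) (fls_mat E)" "E \<in> negative_loop_algebra G" using eta_at_inf[OF T(1)] .
  obtain E' where E': "at_inf (eta \<xi>') (fls_mat E')" "E' \<in> negative_loop_algebra G" using eta_at_inf[OF T(2)] .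
  have "fcoeff E k = fcoeff E' k" for k
  proof (cases k)
    case 0
    then show ?thesis using E(2) E'(2) by (simp add: negative_loop_algebra_iff)
  next
    case (Suc m)
    have EL: "fcoeff E k \<in> \<g>" "fcoeff E' k \<in> \<g>" using E(2) E'(2) by (auto simp: negative_loop_algebra_iff)
    have "\<kappa> (fcoeff E k - fcoeff E' k) X = 0" if X: "X \<in> \<g>" for X
    proof -
      \<comment> \<open>The loop vector of X z^m reads off the coefficient of index
        \<open>Suc m\<close>.\<close>
      let ?c = "zmonom X (int m)"
      have c: "?c \<in> loop_algebra G" "polynomial_loop ?c"
        using zmonom_mem[OF X] by (auto simp: polynomial_loop_def zcoeff_zmonom)
      obtain F' H' \<delta> where w: "is_loop_vector ?c F' H' \<delta>" using loop_vector_exists[OF c] .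
      have "residue_pairing \<kappa> ?c (fls_mat E) = residue_pairing \<kappa> ?c (fls_mat E')"
        using same[OF loop_vector_tangent[OF w]] symplectic_form_loop_vector_left[OF w T(1) E(1)]
          symplectic_form_loop_vector_left[OF w T(2) E'(1)] by simp
      then have "\<kappa> X (fcoeff E k) = \<kappa> X (fcoeff E' k)"
        using E(2) E'(2) Suc
        by (simp add: residue_pairing_zmonom[OF \<kappa> X] negative_loop_imp_loop zcoeff_fls_mat nat_add_distrib)
      then show ?thesis
        using pairing_diff_left[OF \<kappa> EL X] invariant_pairingD(3)[OF \<kappa> X] EL by simp
    qed
    then have "fcoeff E k - fcoeff E' k = 0"
      by (rule invariant_pairingD(5)[OF \<kappa> lie_algebra_diff[OF EL]])
    then show ?thesis by simp
  qed
  then have "E = E'" by (rule fps_matrix_eqI)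
  then show "\<xi>' = \<xi>" using tangent_vector_eqI[OF T E(1)] E'(1) by simp
qed

text \<open>By the sign convention this is \<open>\<Omega>(\<xi>2, \<xi>1)\<close>. At infinity
  \<open>eta \<xi>1\<close> is \<open>Ad (b\<^sub>1\<^sub>+) - a\<^sub>1\<close>, whose second term
  pairs to zero with the polynomial \<open>a2\<close>; the adjoint action is then moved to
  \<open>a2\<close>.\<close>

lemma mhiggs_bracket_eq:
  assumes a1: "is_gradient f1 a1" and a2: "is_gradient f2 a2"
  shows "mhiggs_bracket G \<kappa> D (\<lambda>h. f1 (r_inf h)) (\<lambda>h. f2 (r_inf h)) g =
    - residue_pairing \<kappa> (pos_part (Ad' a1)) (Ad' a2)"
proof -
  have l: "a1 \<in> loop_algebra G" "polynomial_loop a1" "a2 \<in> loop_algebra G" "polynomial_loop a2"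
    using a1 a2 by (auto simp: is_gradient_def)
  obtain F1 H1 \<xi>1 where v1: "is_loop_vector a1 F1 H1 \<xi>1" using loop_vector_exists[OF l(1,2)] .
  obtain F2 H2 \<xi>2 where v2: "is_loop_vector a2 F2 H2 \<xi>2" using loop_vector_exists[OF l(3,4)] .
  let ?b = "pos_part (Ad' a1)"
  have b: "?b \<in> loop_algebra G" by (intro pos_part_mem Ad_loop l)
  have "mhiggs_bracket G \<kappa> D (\<lambda>h. f1 (r_inf h)) (\<lambda>h. f2 (r_inf h)) g = symplectic_form G \<kappa> D g \<xi>2 \<xi>1"
    by (simp add: mhiggs_bracket_def hamiltonian_vector_eq[OF a1 v1] hamiltonian_vector_eq[OF a2 v2])
  also have "\<dots> = - residue_pairing \<kappa> a2 (Ad ?b - a1)"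
    by (rule symplectic_form_loop_vector_left[OF v2 loop_vector_tangent[OF v1] loop_vector_expansion(1)[OF v1]])
  also have "\<dots> = - (residue_pairing \<kappa> a2 (Ad ?b) - residue_pairing \<kappa> a2 a1)"
    using l b Ad_loop by (simp add: residue_pairing_linear(3)[OF \<kappa>])
  also have "residue_pairing \<kappa> a2 a1 = 0" by (rule residue_pairing_polynomials[OF l(4,2)])
  also have "residue_pairing \<kappa> a2 (Ad ?b) = residue_pairing \<kappa> (Ad' a2) ?b"
    by (rule residue_pairing_Ad[OF l(3) b, symmetric])
  also have "\<dots> = residue_pairing \<kappa> ?b (Ad' a2)"
    by (rule residue_pairing_commute[OF \<kappa> Ad_loop(2)[OF l(3)] b])
  finally show ?thesis by simp
qed

section \<open>Value of the Sklyanin formula and comparison of the brackets\<close>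

section \<open>The Sklyanin bracket\<close>

text \<open>The right derivative along \<open>X\<close> is the left derivative along the conjugate
  \<open>h ** X ** hi\<close>, so by invariance the right gradient is \<open>Ad' a\<close>.\<close>

lemma has_gradients_exist:
  assumes a: "is_gradient f a"
  shows "has_gradients G \<kappa> f h a (Ad' a)"
  unfolding has_gradients_def
proof (intro conjI ballI)
  have aL: "a \<in> loop_algebra G" using a by (simp add: is_gradient_def)
  then show "a \<in> loop_algebra G" "Ad' a \<in> loop_algebra G" by (auto intro: Ad_loop)
  show "a ** fls_mat h = fls_mat h ** Ad' a" by (simp add: Ad'_def matrix_mul_assoc fls_h)
  obtain P where P: "\<And>A. A \<in> G1 G \<Longrightarrow> f A = peval (\<lambda>c. c) (coords A) P"
    and aP: "\<And>X. X \<in> negative_loop_algebra G \<Longrightarrow> differential P h (X ** h) = residue_pairing \<kappa> a (fls_mat X)"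
    using a by (auto simp: is_gradient_def)
  fix X assume X: "X \<in> negative_loop_algebra G"
  have X0: "fcoeff X 0 = 0" using X by (simp add: negative_loop_algebra_iff)
  note hX = Ad_negative(1,2)[OF X]
  let ?E = "\<lambda>t. fps_mat_exp (msmult (fps_const t) X)"
  note dE = fps_mat_exp_has_derivative[OF X0]
  note E0 = fps_mat_exp_zero[of X]
  have "((\<lambda>t. fcoeff (mat 1 ** ?E t ** h) k $ i $ j) has_field_derivative
      fcoeff (mat 1 ** (X ** ?E 0) ** h) k $ i $ j) (at 0)" for k i j
    by (rule fcoeff_mult_const_has_derivative[OF dE])
  then have "((\<lambda>t. fcoeff (?E t ** h) k $ i $ j) has_field_derivative fcoeff (X ** h) k $ i $ j) (at 0)" for k i j
    unfolding E0 by simp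
  then have "((\<lambda>t. peval (\<lambda>c. c) (coords (?E t ** h)) P) has_field_derivative
      differential P (?E 0 ** h) (X ** h)) (at 0)" by (rule peval_coords_has_derivative)
  then show "((\<lambda>t. f (?E t ** h)) has_field_derivative residue_pairing \<kappa> a (fls_mat X)) (at 0)"
    unfolding E0 by (simp add: P fps_mat_exp_in_G1(1)[OF G \<kappa> X h_G1] aP[OF X])
  have "((\<lambda>t. fcoeff (h ** ?E t ** mat 1) k $ i $ j) has_field_derivative
      fcoeff (h ** (X ** ?E 0) ** mat 1) k $ i $ j) (at 0)" for k i j
    by (rule fcoeff_mult_const_has_derivative[OF dE])
  then have "((\<lambda>t. fcoeff (h ** ?E t) k $ i $ j) has_field_derivative fcoeff (h ** X) k $ i $ j) (at 0)" for k i j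
    unfolding E0 by simp
  then have "((\<lambda>t. peval (\<lambda>c. c) (coords (h ** ?E t)) P) has_field_derivative
      differential P (h ** ?E 0) (h ** X)) (at 0)" by (rule peval_coords_has_derivative)
  moreover have "h ** X = h ** X ** hi ** h" by (metis hi_h matrix_mul_assoc matrix_mul_rid)
  moreover have "residue_pairing \<kappa> a (fls_mat (h ** X ** hi)) = residue_pairing \<kappa> (Ad' a) (fls_mat X)"
    using residue_pairing_Ad[OF aL negative_loop_imp_loop[OF X]] hX(2) by simp
  ultimately show "((\<lambda>t. f (h ** ?E t)) has_field_derivative residue_pairing \<kappa> (Ad' a) (fls_mat X)) (at 0)"
    unfolding E0 using aP[OF hX(1)]
    by (simp add: P fps_mat_exp_in_G1(2)[OF G \<kappa> X h_G1 h_hi hi_h hX(1)])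
qed

text \<open>Pairing with Y z^(-1-k) reads off the coefficient of z^k up to non-degeneracy, so
  derivatives along negative loops determine exactly the polynomial part of a gradient.\<close>

lemma pos_part_unique:
  assumes a: "a \<in> loop_algebra G" "a' \<in> loop_algebra G"
    and eq: "\<And>X. X \<in> negative_loop_algebra G \<Longrightarrow> residue_pairing \<kappa> a (fls_mat X) = residue_pairing \<kappa> a' (fls_mat X)"
  shows "pos_part a = pos_part a'"
proof (rule zcoeff_eqI)
  fix k
  show "zcoeff (pos_part a) k = zcoeff (pos_part a') k"
  proof (cases "k < 0")
    case False
    define m where "m = nat k"
    have k: "k = int m" using False by (simp add: m_def)
    have L: "zcoeff a k \<in> \<g>" "zcoeff a' k \<in> \<g>" using a by (auto simp: loop_algebra_def)
    have "\<kappa> (zcoeff a k - zcoeff a' k) Y = 0" if Y: "Y \<in> \<g>" for Y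
    proof -
      have N: "fmonom Y (Suc m) \<in> negative_loop_algebra G" by (rule fmonom_negative[OF Y])
      have "fls_mat (fmonom Y (Suc m)) = zmonom Y (- 1 - k)"
        by (rule zcoeff_eqI) (auto simp: zcoeff_fls_mat fcoeff_fmonom zcoeff_zmonom k nat_eq_iff)
      then have "residue_pairing \<kappa> c (fls_mat (fmonom Y (Suc m))) = \<kappa> Y (zcoeff c k)" if "c \<in> loop_algebra G" for c
        using residue_pairing_commute[OF \<kappa> that zmonom_mem[OF Y]] residue_pairing_zmonom[OF \<kappa> Y that] by simp
      then have "\<kappa> Y (zcoeff a k) = \<kappa> Y (zcoeff a' k)" using eq[OF N] a by simp
      then show ?thesis
        using pairing_diff_left[OF \<kappa> L Y] invariant_pairingD(3)[OF \<kappa> Y] L by simp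
    qed
    then have "zcoeff a k - zcoeff a' k = 0"
      by (rule invariant_pairingD(5)[OF \<kappa> lie_algebra_diff[OF L]])
    then show ?thesis by (simp add: zcoeff_pos_part)
  qed (simp add: zcoeff_pos_part)
qed

text \<open>\<open>r\<close> is the projection to g[z] written as a tensor: its two factors pick the
  coefficient of z^i in \<open>a\<close> and of z^(-1-i) in \<open>b\<close>, and the Casimir
  contracts them with \<open>\<kappa>\<close>.\<close>

lemma r_pairing_eq:
  assumes db: "dual_bases G \<kappa> d e e'" and a: "a \<in> loop_algebra G" and b: "b \<in> loop_algebra G"
  shows "r_pairing \<kappa> d e e' a b = residue_pairing \<kappa> (pos_part a) b"
proof -
  have L: "e \<alpha> \<in> \<g>" "e' \<alpha> \<in> \<g>" if "\<alpha> < d" for \<alpha> using db that by (auto simp: dual_bases_def)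
  have aL: "zcoeff a k \<in> \<g>" "zcoeff b k \<in> \<g>" for k using a b by (auto simp: loop_algebra_def)
  let ?t = "\<lambda>i. \<kappa> (zcoeff a (int i)) (zcoeff b (- 1 - int i))"
  have summand: "(\<Sum>\<alpha><d. residue_pairing \<kappa> (zmonom (e \<alpha>) (- int i - 1)) a *
      residue_pairing \<kappa> (zmonom (e' \<alpha>) (int i)) b) = ?t i" for i
  proof -
    have "(\<Sum>\<alpha><d. residue_pairing \<kappa> (zmonom (e \<alpha>) (- int i - 1)) a *
        residue_pairing \<kappa> (zmonom (e' \<alpha>) (int i)) b) =
        (\<Sum>\<alpha><d. \<kappa> (zcoeff b (- 1 - int i)) (e' \<alpha>) * \<kappa> (e \<alpha>) (zcoeff a (int i)))"
      using L aL by (intro sum.cong refl)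
        (simp add: residue_pairing_zmonom[OF \<kappa>] a b invariant_pairingD(3)[OF \<kappa> _ aL(2)])
    also have "\<dots> = \<kappa> (zcoeff b (- 1 - int i)) (zcoeff a (int i))"
      by (rule pairing_dual_bases[OF \<kappa> db aL(2) aL(1), symmetric])
    finally show ?thesis using invariant_pairingD(3)[OF \<kappa> aL(2) aL(1)] by simp
  qed
  obtain N where N: "\<forall>k>int N. zcoeff a k = 0" using zcoeff_vanishes[of a] by blast
  have "r_pairing \<kappa> d e e' a b = (\<Sum>i. ?t i)" unfolding r_pairing_def summand ..
  \<comment> \<open>The infinite sum stops because only finitely many non-negative powers of
    \<open>z\<close> occur in \<open>a\<close>.\<close>
  also have "\<dots> = (\<Sum>i\<le>N. ?t i)"
    by (rule suminf_finite) (use N pairing_zero[OF \<kappa> aL(2)] in auto)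
  also have "\<dots> = (\<Sum>k\<in>int ` {..N}. \<kappa> (zcoeff (pos_part a) k) (zcoeff b (- 1 - k)))"
    by (subst sum.reindex) (auto simp: zcoeff_pos_part)
  also have "\<dots> = residue_pairing \<kappa> (pos_part a) b"
  proof (rule residue_pairing_finite[OF \<kappa> pos_part_mem[OF a] b, symmetric])
    fix k assume "zcoeff (pos_part a) k \<noteq> 0"
    then have "0 \<le> k" "k \<le> int N" using N by (auto simp: zcoeff_pos_part split: if_splits intro: leI)
    then show "k \<in> int ` {..N}" by (intro image_eqI[of _ _ "nat k"]) auto
  qed simp
  finally show ?thesis .
qed

text \<open>For polynomial representatives the left term vanishes by isotropy, and the right term is
  the claimed value. Only the polynomial parts of \<open>c1\<close> and \<open>b1\<close> enter.
  Adding a negative loop to the second gradient changes the left and right terms by the same amount,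
  because \<open>Ad'\<close> preserves negative loops.\<close>

lemma sklyanin_bracket_eq:
  assumes a1: "is_gradient f1 a1" and a2: "is_gradient f2 a2"
  shows "sklyanin_bracket G \<kappa> f1 f2 h = - residue_pairing \<kappa> (pos_part (Ad' a1)) (Ad' a2)"
proof -
  have l: "a1 \<in> loop_algebra G" "polynomial_loop a1" "a2 \<in> loop_algebra G" "polynomial_loop a2"
    using a1 a2 by (auto simp: is_gradient_def)
  note gr = has_gradients_exist[OF a1] has_gradients_exist[OF a2]
  have val: "r_pairing \<kappa> d e e' c1 c2 - r_pairing \<kappa> d e e' b1 b2 =
      - residue_pairing \<kappa> (pos_part (Ad' a1)) (Ad' a2)"
    if db: "dual_bases G \<kappa> d e e'" and g1: "has_gradients G \<kappa> f1 h c1 b1" and g2: "has_gradients G \<kappa> f2 h c2 b2"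
    for d e e' c1 b1 c2 b2
  proof -
    have L: "c1 \<in> loop_algebra G" "b1 \<in> loop_algebra G" "c2 \<in> loop_algebra G" "b2 \<in> loop_algebra G"
      using g1 g2 by (auto simp: has_gradients_def)
    have conj: "b = Ad' c" if "has_gradients G \<kappa> f h c b" for f c b
    proof -
      have "c ** fls_mat h = fls_mat h ** b" using that by (simp add: has_gradients_def)
      then have "Ad' c = fls_mat hi ** (fls_mat h ** b)" by (simp add: Ad'_def matrix_mul_assoc[symmetric])
      then show ?thesis by (simp add: fls_h_cancel)
    qed
    have uniq: "pos_part c = pos_part c'" "pos_part b = pos_part b'"
      if "has_gradients G \<kappa> f h c b" "has_gradients G \<kappa> f h c' b'" for f c b c' b'
      using that by (auto simp: has_gradients_def intro!: pos_part_unique intro: DERIV_unique)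
    have p1: "pos_part c1 = a1" "pos_part b1 = pos_part (Ad' a1)"
      using uniq[OF g1 gr(1)] pos_part_polynomial[OF l(2)] by auto
    have p2: "pos_part c2 = a2" using uniq[OF g2 gr(2)] pos_part_polynomial[OF l(4)] by auto
    \<comment> \<open>The ambiguity of the second gradient: \<open>c2\<close> is \<open>a2\<close>
      plus this negative loop, and \<open>b2\<close> changes by its image under
      \<open>Ad'\<close>.\<close>
    define n where "n = neg_part c2"
    have n: "n \<in> negative_loop_algebra G" unfolding n_def by (rule neg_part_mem[OF L(3)])
    have nl: "fls_mat n \<in> loop_algebra G" by (rule negative_loop_imp_loop[OF n])
    have c2: "c2 = a2 + fls_mat n" using pos_part_neg_part[of c2] p2 by (simp add: n_def)
    have b2: "b2 = Ad' a2 + Ad' (fls_mat n)" using conj[OF g2] c2 by (simp add: Ad_linear)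
    have B: "pos_part b1 \<in> loop_algebra G" by (rule pos_part_mem[OF L(2)])
    have neg: "residue_pairing \<kappa> c (fls_mat N) = residue_pairing \<kappa> (pos_part c) (fls_mat N)"
      if "c \<in> loop_algebra G" "N \<in> negative_loop_algebra G" for c N
    proof -
      have "residue_pairing \<kappa> (pos_part c + fls_mat (neg_part c)) (fls_mat N) =
          residue_pairing \<kappa> (pos_part c) (fls_mat N) + residue_pairing \<kappa> (fls_mat (neg_part c)) (fls_mat N)"
        using that by (intro residue_pairing_linear(1)[OF \<kappa>] pos_part_mem negative_loop_imp_loop neg_part_mem)
      then show ?thesis
        using residue_pairing_negatives[OF neg_part_mem[OF that(1)] that(2)] pos_part_neg_part[of c] by simp
    qed
    have "r_pairing \<kappa> d e e' c1 c2 = residue_pairing \<kappa> a1 (a2 + fls_mat n)"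
      using r_pairing_eq[OF db L(1,3)] p1 c2 by simp
    also have "\<dots> = residue_pairing \<kappa> a1 (fls_mat n)"
      using residue_pairing_linear(2)[OF \<kappa> l(3) nl l(1)] residue_pairing_polynomials[OF l(2,4)] by simp
    also have "\<dots> = residue_pairing \<kappa> c1 (fls_mat n)" using neg[OF L(1) n] p1 by simp
    also have "\<dots> = residue_pairing \<kappa> c1 (Ad (Ad' (fls_mat n)))" by (simp add: Ad_Ad')
    also have "\<dots> = residue_pairing \<kappa> b1 (Ad' (fls_mat n))"
      using residue_pairing_Ad[OF L(1) Ad_loop(2)[OF nl]] conj[OF g1] by simp
    also have "\<dots> = residue_pairing \<kappa> (pos_part b1) (Ad' (fls_mat n))"
      using neg[OF L(2) Ad_negative(3)[OF n]] Ad_negative(4)[OF n] by simp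
    finally have 1: "r_pairing \<kappa> d e e' c1 c2 = residue_pairing \<kappa> (pos_part b1) (Ad' (fls_mat n))" .
    have "r_pairing \<kappa> d e e' b1 b2 =
        residue_pairing \<kappa> (pos_part b1) (Ad' a2) + residue_pairing \<kappa> (pos_part b1) (Ad' (fls_mat n))"
      unfolding r_pairing_eq[OF db L(2,4)] unfolding b2
      by (rule residue_pairing_linear(2)[OF \<kappa> Ad_loop(2)[OF l(3)] Ad_loop(2)[OF nl] B])
    with 1 show ?thesis by (simp add: p1)
  qed
  obtain d e e' where db: "dual_bases G \<kappa> d e e'" using dual_bases_exist[OF \<kappa>] .
  show ?thesis
    unfolding sklyanin_bracket_def
  proof (rule the_equality)
    show "\<exists>d e e' c1 b1 c2 b2. dual_bases G \<kappa> d e e' \<and> has_gradients G \<kappa> f1 h c1 b1 \<and>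
        has_gradients G \<kappa> f2 h c2 b2 \<and>
        - residue_pairing \<kappa> (pos_part (Ad' a1)) (Ad' a2) = r_pairing \<kappa> d e e' c1 c2 - r_pairing \<kappa> d e e' b1 b2"
      using db gr val[OF db gr] by metis
  qed (use val in auto)
qed

lemma bracket_eq:
  assumes "f1 \<in> regular_functions G" "f2 \<in> regular_functions G"
  shows "mhiggs_bracket G \<kappa> D (\<lambda>h. f1 (r_inf h)) (\<lambda>h. f2 (r_inf h)) g = sklyanin_bracket G \<kappa> f1 f2 (r_inf g)"
proof -
  obtain a1 where a1: "is_gradient f1 a1" using is_gradient_exists[OF assms(1)] .
  obtain a2 where a2: "is_gradient f2 a2" using is_gradient_exists[OF assms(2)] .
  show ?thesis using mhiggs_bracket_eq[OF a1 a2] sklyanin_bracket_eq[OF a1 a2] by (simp add: h_def)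
qed

end

text \<open>Passes from the moduli space to the maps treated in \<open>group_map\<close>: the
  denominators have no zeros off \<open>D\<close>.\<close>

lemma mhiggs_subset_group_maps: "mhiggs G D \<omega> \<subseteq> group_maps G D"
proof
  fix g assume g: "g \<in> mhiggs G D \<omega>"
  have "(\<lambda>z. g z $ i $ j) holomorphic_on - D" for i j
  proof -
    have "rational_regular_off D (\<lambda>z. g z $ i $ j)" using g by (simp add: mhiggs_def)
    then obtain p q where pq: "\<forall>z. z \<notin> D \<longrightarrow> poly q z \<noteq> 0 \<and> g z $ i $ j = poly p z / poly q z"
      unfolding rational_regular_off_def by blast
    have "(\<lambda>z. poly p z / poly q z) holomorphic_on - D"
      using pq by (intro holomorphic_intros) auto
    then show ?thesis by (rule holomorphic_transform) (simp add: pq)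
  qed
  then show "g \<in> group_maps G D" using g by (auto simp: mhiggs_def group_maps_def)
qed

theorem theorem1p4:
  fixes G T B :: "(complex^'n^'n) set"
    and \<kappa> :: "complex^'n^'n \<Rightarrow> complex^'n^'n \<Rightarrow> complex"
    and D :: "complex set"
    and \<omega> :: "complex \<Rightarrow> complex \<Rightarrow> complex^'n^'n"
  assumes "reductive G"
    and "maximal_torus G T" and "borel_subgroup G B" and "T \<subseteq> B"
    and "invariant_pairing G \<kappa>"
    and "finite D"
    and "\<And>c. c \<in> D \<Longrightarrow> dominant_coweight T B (\<omega> c)"
  shows "r_inf ` mhiggs G D \<omega> \<subseteq> G1 G \<and>
    (\<forall>f1\<in>regular_functions G. \<forall>f2\<in>regular_functions G. \<forall>g\<in>mhiggs G D \<omega>.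
       mhiggs_bracket G \<kappa> D (\<lambda>h. f1 (r_inf h)) (\<lambda>h. f2 (r_inf h)) g =
       sklyanin_bracket G \<kappa> f1 f2 (r_inf g))"
proof -
  have G: "algebraic_group G" using assms(1) by (simp add: reductive_def)
  have "group_map G \<kappa> D g" if "g \<in> mhiggs G D \<omega>" for g
    using that mhiggs_subset_group_maps by unfold_locales (use G assms in auto)
  then show ?thesis
    using group_map.bracket_eq group_maps_at_inf(2)[OF assms(6)] mhiggs_subset_group_maps by blast
qed

end
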